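(* (a) Every separably injective Banach space is an $\mathcal L_\infty$-space, has Pełczyński's property $(V)$ and, when it is infinite-dimensional, contains a subspace isomorphic to $c_0$. (b) Every universally separably injective Banach space is a Grothendieck space and an $\mathcal L_\infty$-space, has Rosenthal's property $(V)$ and, when it is infinite-dimensional, contains a subspace isomorphic to $\ell_\infty$.
   Context: "Operator" means bounded linear map; "subspace" means closed linear subspace. A Banach space $E$ is separably injective if for every separable Banach space $X$ and each subspace $Y\subset X$, every operator $t:Y\to E$ extends to an operator $T:X\to E$. It is universally separably injective if for every Banach space $X$ and each separable subspace $Y\subset X$, every operator $t:Y\to E$ extends to an operator $T:X\to E$. A Banach space $X$ is an $\mathcal L_\infty$-space if for some $\lambda\ge1$ every finite-dimensional subspace of $X$ is contained in another finite-dimensional subspace $F$ of $X$ whose Banach-Mazur distance to $\ell_\infty^{\dim F}$ is at most $\lambda$. $X$ has Pełczyński's property $(V)$ (resp. Rosenthal's property $(V)$) if each operator from $X$ into a Banach space is either weakly compact or an isomorphism (onto its image) when restricted to some subspace of $X$ isomorphic to $c_0$ (resp. to $\ell_\infty$). $X$ is a Grothendieck space if every operator from $X$ to a separable Banach space (equivalently, to $c_0$) is weakly compact. *)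

theory Defs
  imports "HOL-Analysis.Analysis"
begin

text \<open>
  All Banach spaces are real.  The space under study and the targets of the operators in
  properties (V) and in the Grothendieck property are types of class \<open>banach\<close>; a statement
  with such a target as a free type variable is a statement about every Banach space.  The
  spaces \<open>X\<close> of the two extension properties, however, are quantified inside a hypothesis,
  where no type can be quantified; they are given as structures on a carrier set.
\<close>

subsection \<open>Banach spaces on carrier sets\<close>

record 'u nspace =
  vcarrier :: "'u set"
  vadd :: "'u \<Rightarrow> 'u \<Rightarrow> 'u"
  vzero :: "'u"
  vscale :: "real \<Rightarrow> 'u \<Rightarrow> 'u"
  vnorm :: "'u \<Rightarrow> real"

text \<open>The value outside the carrier is fixed because the library's locale \<open>Metric_space\<close>
  asks for nonnegativity and symmetry on the whole type.\<close>

definition vdist :: "'u nspace \<Rightarrow> 'u \<Rightarrow> 'u \<Rightarrow> real" where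
  "vdist X x y = (if x \<in> vcarrier X \<and> y \<in> vcarrier X
                  then vnorm X (vadd X x (vscale X (- 1) y)) else 0)"

definition normed_space :: "'u nspace \<Rightarrow> bool" where
  "normed_space X \<longleftrightarrow>
     vzero X \<in> vcarrier X \<and>
     (\<forall>x\<in>vcarrier X. \<forall>y\<in>vcarrier X. vadd X x y \<in> vcarrier X) \<and>
     (\<forall>a. \<forall>x\<in>vcarrier X. vscale X a x \<in> vcarrier X) \<and>
     (\<forall>x\<in>vcarrier X. \<forall>y\<in>vcarrier X. \<forall>z\<in>vcarrier X.
        vadd X (vadd X x y) z = vadd X x (vadd X y z)) \<and>
     (\<forall>x\<in>vcarrier X. \<forall>y\<in>vcarrier X. vadd X x y = vadd X y x) \<and>
     (\<forall>x\<in>vcarrier X. vadd X (vzero X) x = x) \<and>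
     (\<forall>x\<in>vcarrier X. vadd X x (vscale X (- 1) x) = vzero X) \<and>
     (\<forall>a. \<forall>x\<in>vcarrier X. \<forall>y\<in>vcarrier X.
        vscale X a (vadd X x y) = vadd X (vscale X a x) (vscale X a y)) \<and>
     (\<forall>a b. \<forall>x\<in>vcarrier X. vscale X (a + b) x = vadd X (vscale X a x) (vscale X b x)) \<and>
     (\<forall>a b. \<forall>x\<in>vcarrier X. vscale X a (vscale X b x) = vscale X (a * b) x) \<and>
     (\<forall>x\<in>vcarrier X. vscale X 1 x = x) \<and>
     (\<forall>x\<in>vcarrier X. vnorm X x = 0 \<longleftrightarrow> x = vzero X) \<and>
     (\<forall>a. \<forall>x\<in>vcarrier X. vnorm X (vscale X a x) = \<bar>a\<bar> * vnorm X x) \<and>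
     (\<forall>x\<in>vcarrier X. \<forall>y\<in>vcarrier X. vnorm X (vadd X x y) \<le> vnorm X x + vnorm X y)"

definition banach_space :: "'u nspace \<Rightarrow> bool" where
  "banach_space X \<longleftrightarrow> normed_space X \<and> Metric_space.mcomplete (vcarrier X) (vdist X)"

definition vtopology :: "'u nspace \<Rightarrow> 'u topology" where
  "vtopology X = Metric_space.mtopology (vcarrier X) (vdist X)"

definition closed_subspace :: "'u nspace \<Rightarrow> 'u set \<Rightarrow> bool" where
  "closed_subspace X Y \<longleftrightarrow>
     Y \<subseteq> vcarrier X \<and> vzero X \<in> Y \<and>
     (\<forall>x\<in>Y. \<forall>y\<in>Y. vadd X x y \<in> Y) \<and> (\<forall>a. \<forall>x\<in>Y. vscale X a x \<in> Y) \<and>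
     closedin (vtopology X) Y"

definition separable_subset :: "'u nspace \<Rightarrow> 'u set \<Rightarrow> bool" where
  "separable_subset X Y \<longleftrightarrow> separable_space (subtopology (vtopology X) Y)"

text \<open>Operators from the subspace \<open>Y\<close> of \<open>X\<close>; the values of \<open>t\<close> outside \<open>Y\<close> are irrelevant.\<close>

definition operator_from :: "'u nspace \<Rightarrow> 'u set \<Rightarrow> ('u \<Rightarrow> 'e::real_normed_vector) \<Rightarrow> bool" where
  "operator_from X Y t \<longleftrightarrow>
     (\<forall>x\<in>Y. \<forall>y\<in>Y. t (vadd X x y) = t x + t y) \<and>
     (\<forall>a. \<forall>x\<in>Y. t (vscale X a x) = a *\<^sub>R t x) \<and>
     (\<exists>K. \<forall>x\<in>Y. norm (t x) \<le> K * vnorm X x)"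

definition operators_extend :: "'e::banach itself \<Rightarrow> 'u nspace \<Rightarrow> 'u set \<Rightarrow> bool" where
  "operators_extend _ X Y \<longleftrightarrow>
     (\<forall>t :: 'u \<Rightarrow> 'e. operator_from X Y t \<longrightarrow>
        (\<exists>T :: 'u \<Rightarrow> 'e. operator_from X (vcarrier X) T \<and> (\<forall>y\<in>Y. T y = t y)))"

text \<open>
  Here \<open>X\<close> ranges over the Banach spaces whose points belong to the type \<open>'u\<close>.  Results
  are to be stated for every type \<open>'u\<close> of at least continuum cardinality, hence for \<open>X\<close> of
  arbitrarily large cardinality.  A separable Banach space has at most continuum many points,
  so for such \<open>'u\<close> the first notion admits every separable Banach space up to isometry.
\<close>

definition separably_injective :: "'u itself \<Rightarrow> 'e::banach itself \<Rightarrow> bool" where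
  "separably_injective _ E \<longleftrightarrow>
     (\<forall>(X :: 'u nspace) Y.
        banach_space X \<and> separable_subset X (vcarrier X) \<and> closed_subspace X Y
        \<longrightarrow> operators_extend E X Y)"

definition universally_separably_injective :: "'u itself \<Rightarrow> 'e::banach itself \<Rightarrow> bool" where
  "universally_separably_injective _ E \<longleftrightarrow>
     (\<forall>(X :: 'u nspace) Y.
        banach_space X \<and> closed_subspace X Y \<and> separable_subset X Y
        \<longrightarrow> operators_extend E X Y)"

subsection \<open>Isomorphisms between subspaces and the Banach-Mazur distance\<close>

definition operator_on :: "'a::real_normed_vector set \<Rightarrow> ('a \<Rightarrow> 'b::real_normed_vector) \<Rightarrow> bool"
  where
  "operator_on S f \<longleftrightarrow>
     (\<forall>x\<in>S. \<forall>y\<in>S. f (x + y) = f x + f y) \<and>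
     (\<forall>a. \<forall>x\<in>S. f (a *\<^sub>R x) = a *\<^sub>R f x) \<and>
     (\<exists>K. \<forall>x\<in>S. norm (f x) \<le> K * norm x)"

definition onorm_on :: "'a::real_normed_vector set \<Rightarrow> ('a \<Rightarrow> 'b::real_normed_vector) \<Rightarrow> real" where
  "onorm_on S f = (SUP x\<in>{x\<in>S. norm x \<le> 1}. norm (f x))"

definition isomorphism_on ::
  "'a::real_normed_vector set \<Rightarrow> 'b::real_normed_vector set \<Rightarrow> ('a \<Rightarrow> 'b) \<Rightarrow> bool" where
  "isomorphism_on S R f \<longleftrightarrow>
     operator_on S f \<and> bij_betw f S R \<and> operator_on R (inv_into S f)"

definition isomorphic_subspaces ::
  "'a::real_normed_vector set \<Rightarrow> 'b::real_normed_vector set \<Rightarrow> bool" where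
  "isomorphic_subspaces S R \<longleftrightarrow> (\<exists>f. isomorphism_on S R f)"

text \<open>The distance of non-isomorphic spaces is \<open>\<infinity>\<close>, the infimum of the empty set.\<close>

definition banach_mazur_dist ::
  "'a::real_normed_vector set \<Rightarrow> 'b::real_normed_vector set \<Rightarrow> ereal" where
  "banach_mazur_dist S R =
     (INF f\<in>{f. isomorphism_on S R f}. ereal (onorm_on S f * onorm_on R (inv_into S f)))"

subsection \<open>Sequence spaces\<close>

text \<open>As \<open>nat\<close> is discrete, \<open>nat \<Rightarrow>\<^sub>C real\<close> consists of all bounded real sequences, with the
  supremum norm.\<close>

type_synonym l_inf = "nat \<Rightarrow>\<^sub>C real"

definition c0_space :: "l_inf set" where
  "c0_space = {x. apply_bcontfun x \<longlonglongrightarrow> 0}"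

definition l_inf_dim :: "nat \<Rightarrow> l_inf set" where
  "l_inf_dim n = {x. \<forall>i\<ge>n. apply_bcontfun x i = 0}"

subsection \<open>Classes of Banach spaces\<close>

definition finite_dim_subspace :: "'a::real_vector set \<Rightarrow> bool" where
  "finite_dim_subspace S \<longleftrightarrow> subspace S \<and> (\<exists>B. finite B \<and> S = span B)"

definition infinite_dimensional :: "'e::real_vector itself \<Rightarrow> bool" where
  "infinite_dimensional _ \<longleftrightarrow> \<not> finite_dim_subspace (UNIV :: 'e set)"

definition L_inf_space :: "'e::banach itself \<Rightarrow> bool" where
  "L_inf_space _ \<longleftrightarrow>
     (\<exists>lambda::real. lambda \<ge> 1 \<and>
        (\<forall>G :: 'e set. finite_dim_subspace G \<longrightarrow>
           (\<exists>F. finite_dim_subspace F \<and> G \<subseteq> F \<and>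
                banach_mazur_dist F (l_inf_dim (dim F)) \<le> ereal lambda)))"

definition contains_copy_of :: "'e::banach itself \<Rightarrow> l_inf set \<Rightarrow> bool" where
  "contains_copy_of _ Z \<longleftrightarrow>
     (\<exists>S :: 'e set. subspace S \<and> closed S \<and> isomorphic_subspaces S Z)"

definition weak_topology :: "'a::real_normed_vector topology" where
  "weak_topology =
     topology_generated_by {phi -` U | (phi :: 'a \<Rightarrow> real) U. bounded_linear phi \<and> open U}"

definition weakly_compact_operator :: "('a::real_normed_vector \<Rightarrow> 'b::real_normed_vector) \<Rightarrow> bool"
  where
  "weakly_compact_operator T \<longleftrightarrow>
     bounded_linear T \<and> compactin weak_topology (weak_topology closure_of (T ` cball 0 1))"

definition fixes_copy_of :: "l_inf set \<Rightarrow> ('e::banach \<Rightarrow> 'f::banach) \<Rightarrow> bool" where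
  "fixes_copy_of Z T \<longleftrightarrow>
     (\<exists>S. subspace S \<and> closed S \<and> isomorphic_subspaces S Z \<and> isomorphism_on S (T ` S) T)"

text \<open>The three notions below are relative to one target space \<open>'f\<close>, which is to be left
  as a free type variable.\<close>

definition pelczynski_property_V :: "'e::banach itself \<Rightarrow> 'f::banach itself \<Rightarrow> bool" where
  "pelczynski_property_V _ _ \<longleftrightarrow>
     (\<forall>T :: 'e \<Rightarrow> 'f. bounded_linear T \<longrightarrow>
        weakly_compact_operator T \<or> fixes_copy_of c0_space T)"

definition rosenthal_property_V :: "'e::banach itself \<Rightarrow> 'f::banach itself \<Rightarrow> bool" where
  "rosenthal_property_V _ _ \<longleftrightarrow>
     (\<forall>T :: 'e \<Rightarrow> 'f. bounded_linear T \<longrightarrow>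
        weakly_compact_operator T \<or> fixes_copy_of (UNIV :: l_inf set) T)"

definition grothendieck_space :: "'e::banach itself \<Rightarrow> 'f::banach itself \<Rightarrow> bool" where
  "grothendieck_space _ _ \<longleftrightarrow>
     (separable_space (euclidean :: 'f topology) \<longrightarrow>
        (\<forall>T :: 'e \<Rightarrow> 'f. bounded_linear T \<longrightarrow> weakly_compact_operator T))"

end

theory Submission
  imports Defs
begin

text \<open>
  A countable subset of \<open>E\<close> spans a space that embeds isometrically into an algebra \<open>X\<close> of bounded
  sequences in which every function can be cut along its level sets by idempotents: all bounded
  sequences in the universal case, a separable algebra otherwise. Let \<open>S : X \<rightarrow> E\<close> extend the inverse
  of the embedding, and let \<open>T\<close> be an operator on \<open>E\<close>, with \<open>U = T \<circ> S\<close>.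

  Consider the submeasure \<open>\<eta> A = sup {\<parallel>U f\<parallel> : \<bar>f\<bar> \<le> 1\<^sub>A}\<close>. If it is not small along some disjoint
  sequence of sets, then Rosenthal's disjointness lemma yields a copy of \<open>c\<^sub>0\<close> (of \<open>\<ell>\<^sub>\<infinity>\<close> in the universal
  case) that \<open>U\<close> fixes, whence \<open>T\<close> fixes a copy as well. Otherwise finitely many functionals control
  \<open>\<eta>\<close>, so that up to \<open>\<epsilon> \<parallel>f\<parallel>\<close> the norm of \<open>U f\<close> is bounded by the Hilbertian seminorm
  \<open>sqrt (\<Lambda> (f\<^sup>2))\<close>. By the parallelogram identity this excludes the sequences that James's
  criterion provides when \<open>T\<close> is not weakly compact, which gives property (V). For \<open>T = id\<close> it
  makes the span a Hilbert space inside a sup-normed space, hence finite-dimensional, which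
  gives the copies of \<open>c\<^sub>0\<close> and \<open>\<ell>\<^sub>\<infinity>\<close> in \<open>E\<close>. As \<open>\<ell>\<^sub>\<infinity>\<close> is not separable, the Grothendieck property follows.

  For the \<open>\<L>\<^sub>\<infinity>\<close> property, a finite-dimensional subspace of \<open>E\<close> lies in the image of a sup-normed space of
  finite dimension under a correction of \<open>S\<close>; adding an almost transversal operator with range in the copy of
  \<open>c\<^sub>0\<close> turns it into an isomorphism, with constants that depend on \<open>S\<close> only. One \<open>S\<close> serves for
  countably many subspaces at once, so the constants are uniform.
\<close>

subsection \<open>Norming functionals\<close>

text \<open>Three obstacles shape the details. The separable algebra has no countable unions of
  idempotents, so the control of \<eta> by finitely many functionals cannot come from countably
  additive measures; exhaustiveness itself has to supply finite substitutes for tail unions.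
  Infinite sums enter only in the construction of copies, and there the algebra decides which
  coefficients it can absorb: null sequences always, all bounded sequences if it contains every
  bounded function. This is the source of c_0 in one case and of l_inf in the other. Next, E does
  not determine one algebra: each sequence in E has its own embedding, so weak compactness is tested
  on single sequences, by convex hulls of initial segments and of tails. Finally, the norm of E is
  not Hilbertian; what turns a bound on squares into a bound on norms is Chebyshev's inequality on
  level sets, for which the algebra must contain products and enough idempotents. Neither measures
  nor biduals appear as objects: the variation of a functional replaces the total variation measure,
  and a bidual point is a function on the dual that evaluations approximate.\<close>

definition sublinear :: "('a::real_vector \<Rightarrow> real) \<Rightarrow> bool" where
  "sublinear p \<longleftrightarrow> (\<forall>x y. p (x + y) \<le> p x + p y) \<and> (\<forall>t\<ge>0. \<forall>x. p (t *\<^sub>R x) = t * p x)"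

lemma sublinearI:
  assumes add: "\<And>x y. p (x + y) \<le> p x + p y"
    and zero: "p 0 = 0" and scale: "\<And>t x. t > 0 \<Longrightarrow> p (t *\<^sub>R x) \<le> t * p x"
  shows "sublinear p"
proof -
  have "p (t *\<^sub>R x) = t * p x" if "t \<ge> 0" for t x
  proof (cases "t = 0")
    case False
    with that have t: "t > 0" by simp
    have "p x = p (inverse t *\<^sub>R (t *\<^sub>R x))" using t by simp
    also have "\<dots> \<le> inverse t * p (t *\<^sub>R x)" using scale t by (meson positive_imp_inverse_positive)
    finally have "t * p x \<le> p (t *\<^sub>R x)" using t by (simp add: field_simps)
    with scale[OF t, of x] show ?thesis by simp
  qed (simp add: zero)
  then show ?thesis using add unfolding sublinear_def by blast
qed

lemma sublinear_zero: "sublinear p \<Longrightarrow> p 0 = 0"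
  unfolding sublinear_def by (metis mult_zero_left order_refl scaleR_zero_left)

lemma sublinear_neg: "sublinear p \<Longrightarrow> - p (- x) \<le> p x"
  using sublinear_zero[of p] unfolding sublinear_def
  by (metis add.right_inverse minus_le_iff neg_0_le_iff_le le_add_same_cancel1 add.inverse_inverse add_le_cancel_right diff_0 diff_le_eq)

text \<open>This is the descent step of Hahn-Banach: p is lowered as far as its growth along the ray
  through z permits. For a minimal p the result must be p itself, so p (- z) \<le> - p z; a minimal
  sublinear functional is odd and hence linear.\<close>

lemma sublinear_shift:
  assumes p: "sublinear p"
  obtains q where "sublinear q" "\<And>y. q y \<le> p y" "q (- z) \<le> - p z"
proof -
  have add: "p (x + y) \<le> p x + p y" and hom: "t \<ge> 0 \<Longrightarrow> p (t *\<^sub>R x) = t * p x" for x y t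
    using p by (auto simp: sublinear_def)
  define q where "q y = (INF t\<in>{0..}. p (y + t *\<^sub>R z) - t * p z)" for y
  have lower: "- p (- y) \<le> p (y + t *\<^sub>R z) - t * p z" if "t \<ge> 0" for y t
    using add[of "y + t *\<^sub>R z" "- y"] hom[OF that, of z] by simp
  have bdd: "bdd_below ((\<lambda>t. p (y + t *\<^sub>R z) - t * p z) ` {0..})" for y
    using lower by (intro bdd_belowI[of _ "- p (- y)"]) auto
  have qle: "q y \<le> p (y + t *\<^sub>R z) - t * p z" if "t \<ge> 0" for y t
    unfolding q_def using that by (intro cINF_lower bdd) auto
  have qge: "a \<le> q y" if "\<And>t. t \<ge> 0 \<Longrightarrow> a \<le> p (y + t *\<^sub>R z) - t * p z" for a y
    unfolding q_def using that by (intro cINF_greatest) auto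
  have near: "\<exists>t\<ge>0. p (y + t *\<^sub>R z) - t * p z < q y + e" if "e > 0" for y e
  proof (rule ccontr)
    assume "\<not> ?thesis"
    then have "q y + e \<le> q y" by (intro qge) (meson not_less)
    with that show False by simp
  qed
  have "sublinear q"
  proof (rule sublinearI)
    fix x y
    show "q (x + y) \<le> q x + q y"
    proof (rule field_le_epsilon)
      fix e :: real assume "e > 0"
      then obtain s t where s: "s \<ge> 0" "p (x + s *\<^sub>R z) - s * p z < q x + e / 2"
        and t: "t \<ge> 0" "p (y + t *\<^sub>R z) - t * p z < q y + e / 2"
        using near[of "e/2"] by (meson half_gt_zero)
      have "q (x + y) \<le> p (x + y + (s + t) *\<^sub>R z) - (s + t) * p z" using s t by (intro qle) auto
      also have "x + y + (s + t) *\<^sub>R z = (x + s *\<^sub>R z) + (y + t *\<^sub>R z)" by (simp add: scaleR_add_left)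
      also have "p \<dots> - (s + t) * p z \<le> (p (x + s *\<^sub>R z) - s * p z) + (p (y + t *\<^sub>R z) - t * p z)"
        using add[of "x + s *\<^sub>R z" "y + t *\<^sub>R z"] by (simp add: algebra_simps)
      finally show "q (x + y) \<le> q x + q y + e" using s t by linarith
    qed
  next
    have "0 \<le> q 0" using hom by (intro qge) auto
    moreover have "q 0 \<le> 0" using qle[of 0 0] sublinear_zero[OF p] by simp
    ultimately show "q 0 = 0" by simp
  next
    fix s :: real and x assume s: "s > 0"
    show "q (s *\<^sub>R x) \<le> s * q x"
    proof (rule field_le_epsilon)
      fix e :: real assume "e > 0"
      then obtain t where t: "t \<ge> 0" "p (x + t *\<^sub>R z) - t * p z < q x + e / s"
        using near[of "e / s" x] s by auto
      have "q (s *\<^sub>R x) \<le> p (s *\<^sub>R x + (s * t) *\<^sub>R z) - (s * t) * p z" using s t by (intro qle) auto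
      also have "s *\<^sub>R x + (s * t) *\<^sub>R z = s *\<^sub>R (x + t *\<^sub>R z)" by (simp add: scaleR_add_right)
      also have "p \<dots> - (s * t) * p z = s * (p (x + t *\<^sub>R z) - t * p z)"
        unfolding hom[OF less_imp_le[OF s]] by (simp add: algebra_simps)
      also have "\<dots> \<le> s * (q x + e / s)" using t s by (intro mult_left_mono) auto
      finally show "q (s *\<^sub>R x) \<le> s * q x + e" using s by (simp add: algebra_simps)
    qed
  qed
  moreover have "q y \<le> p y" for y using qle[of 0 y] by simp
  moreover have "q (- z) \<le> - p z" using qle[of 1 "- z"] sublinear_zero[OF p] by simp
  ultimately show thesis using that by blast
qed

text \<open>Zorn's lemma for the reversed order. The pointwise infimum of a chain is finite because
  every member dominates \<open>- p0 (- x)\<close>, and it is subadditive because any two members of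
  the chain lie above a common one.\<close>

lemma minimal_sublinear:
  fixes p0 :: "'a::real_vector \<Rightarrow> real"
  assumes p0: "sublinear p0"
  obtains p where "sublinear p" "\<And>x. p x \<le> p0 x"
    "\<And>q. sublinear q \<Longrightarrow> (\<And>x. q x \<le> p x) \<Longrightarrow> q = p"
proof -
  define A where "A = {p. sublinear p \<and> p \<le> p0}"
  define P :: "('a \<Rightarrow> real) \<Rightarrow> ('a \<Rightarrow> real) \<Rightarrow> bool" where "P = (\<lambda>a b. b \<le> a)"
  have "\<exists>m\<in>A. \<forall>a\<in>A. P m a \<longrightarrow> a = m"
  proof (rule predicate_Zorn)
    show "partial_order_on A (relation_of P A)"
      by (auto simp: partial_order_on_def preorder_on_def P_def refl_on_def trans_def antisym_def
          relation_of_def intro: order_trans)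
  next
    fix C assume C: "C \<in> Chains (relation_of P A)"
    then have CA: "C \<subseteq> A" unfolding Chains_def relation_of_def by auto
    show "\<exists>u\<in>A. \<forall>a\<in>C. P a u"
    proof (cases "C = {}")
      case True
      with p0 show ?thesis by (auto simp: A_def)
    next
      case ne: False
      define u where "u x = (INF p\<in>C. p x)" for x
      have low: "- p0 (- x) \<le> p x" if "p \<in> C" for p x
      proof -
        have "- p0 (- x) \<le> - p (- x)" using that CA by (auto simp: A_def le_fun_def)
        also have "\<dots> \<le> p x" using that CA by (intro sublinear_neg) (auto simp: A_def)
        finally show ?thesis .
      qed
      have bdd: "bdd_below ((\<lambda>p. p x) ` C)" for x
        using low by (intro bdd_belowI[of _ "- p0 (- x)"]) auto
      have ule: "u x \<le> p x" if "p \<in> C" for p x unfolding u_def using that by (intro cINF_lower bdd)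
      have near: "\<exists>p\<in>C. p x < u x + e" if "e > 0" for x e
      proof (rule ccontr)
        assume "\<not> ?thesis"
        then have "u x + e \<le> u x" unfolding u_def[of x] using ne by (intro cINF_greatest) (auto simp: not_less u_def)
        with that show False by simp
      qed
      have sub: "sublinear p" if "p \<in> C" for p using that CA by (auto simp: A_def)
      have "sublinear u"
      proof (rule sublinearI)
        fix x y
        show "u (x + y) \<le> u x + u y"
        proof (rule field_le_epsilon)
          fix e :: real assume "e > 0"
          then obtain p q where p: "p \<in> C" "p x < u x + e / 2" and q: "q \<in> C" "q y < u y + e / 2"
            using near[of "e/2"] by (meson half_gt_zero)
          obtain r where r: "r \<in> C" "r \<le> p" "r \<le> q"
            using C p(1) q(1) unfolding Chains_def relation_of_def P_def by blast
          have "u (x + y) \<le> r x + r y"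
            using ule[OF r(1), of "x + y"] sub[OF r(1)] unfolding sublinear_def by (meson order_trans)
          also have "\<dots> \<le> p x + q y" using r by (simp add: le_fun_def add_mono)
          finally show "u (x + y) \<le> u x + u y + e" using p q by linarith
        qed
      next
        have "u 0 = (INF p\<in>C. 0)" unfolding u_def using sub sublinear_zero by (intro INF_cong) auto
        then show "u 0 = 0" using ne by simp
      next
        fix t :: real and x assume t: "t > 0"
        have "u (t *\<^sub>R x) / t \<le> u x" unfolding u_def[of x]
        proof (rule cINF_greatest[OF ne])
          fix p assume p: "p \<in> C"
          have "u (t *\<^sub>R x) \<le> t * p x"
            using ule[OF p, of "t *\<^sub>R x"] sub[OF p] t unfolding sublinear_def by auto
          then show "u (t *\<^sub>R x) / t \<le> p x" using t by (simp add: field_simps)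
        qed
        then show "u (t *\<^sub>R x) \<le> t * u x" using t by (simp add: field_simps)
      qed
      moreover have "u \<le> p0"
      proof -
        obtain p where "p \<in> C" using ne by blast
        with ule[OF this] CA show ?thesis unfolding A_def le_fun_def by (blast intro: order_trans)
      qed
      ultimately have "u \<in> A" by (simp add: A_def)
      moreover have "\<forall>a\<in>C. P a u" using ule by (simp add: P_def le_fun_def)
      ultimately show ?thesis by blast
    qed
  qed
  then obtain m where m: "m \<in> A" "\<And>a. a \<in> A \<Longrightarrow> a \<le> m \<Longrightarrow> a = m" unfolding P_def by blast
  show thesis
  proof (rule that[of m])
    show "sublinear m" "\<And>x. m x \<le> p0 x" using m(1) by (auto simp: A_def le_fun_def)
    fix q assume q: "sublinear q" "\<And>x. q x \<le> m x"
    then have "q \<le> m" "m \<le> p0" using m(1) by (auto simp: A_def le_fun_def)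
    then have "q \<in> A" using q(1) unfolding A_def by (auto intro: order_trans)
    then show "q = m" using m(2) \<open>q \<le> m\<close> by blast
  qed
qed

text \<open>Shifting the norm in the direction of x first forces the value at \<open>- x\<close>
  down to \<open>- norm x\<close>. A minimal sublinear functional below the result is linear, and
  this value makes it attain the norm at x.\<close>

lemma norming_functional:
  fixes x :: "'a::real_normed_vector"
  obtains \<phi> :: "'a \<Rightarrow> real" where "linear \<phi>" "\<And>y. \<bar>\<phi> y\<bar> \<le> norm y" "\<phi> x = norm x"
proof -
  have "sublinear (norm :: 'a \<Rightarrow> real)"
    by (intro sublinearI) (auto simp: norm_triangle_ineq)
  then obtain p0 where p0: "sublinear p0" "\<And>y::'a. p0 y \<le> norm y" "p0 (- x) \<le> - norm x"
    using sublinear_shift[of norm x] by blast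
  obtain p where p: "sublinear p" "\<And>x. p x \<le> p0 x"
    "\<And>q. sublinear q \<Longrightarrow> (\<And>x. q x \<le> p x) \<Longrightarrow> q = p"
    using minimal_sublinear[OF p0(1)] by blast
  have neg: "p (- z) = - p z" for z
  proof -
    obtain q where "sublinear q" "\<And>y. q y \<le> p y" "q (- z) \<le> - p z"
      using sublinear_shift[OF p(1), of z] by blast
    with p(3)[of q] have "p (- z) \<le> - p z" by auto
    moreover have "- p z \<le> p (- z)" using sublinear_neg[OF p(1), of "- z"] by simp
    ultimately show ?thesis by simp
  qed
  have sub: "p (x + y) \<le> p x + p y" and hom: "t \<ge> 0 \<Longrightarrow> p (t *\<^sub>R x) = t * p x" for x y t
    using p(1) by (auto simp: sublinear_def)
  have "linear p"
  proof (rule linearI)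
    fix x y
    have "p (- x + - y) \<le> p (- x) + p (- y)" by (rule sub)
    then have "- p (x + y) \<le> - p x - p y" using neg[of "x + y"] neg[of x] neg[of y] by simp
    with sub[of x y] show "p (x + y) = p x + p y" by simp
  next
    fix r x show "p (r *\<^sub>R x) = r *\<^sub>R p x"
      using hom[of r x] hom[of "- r" x] neg[of "r *\<^sub>R x"] by (cases "r \<ge> 0") auto
  qed
  moreover have le: "p y \<le> norm y" for y using p(2) p0(2) order_trans by blast
  moreover have "\<bar>p y\<bar> \<le> norm y" for y
    using le[of y] le[of "- y"] neg[of y] by (simp add: abs_le_iff)
  moreover have "p x = norm x"
    using neg[of x] p(2)[of "- x"] p0(3) le[of x] by simp
  ultimately show thesis using that by blast
qed

subsection \<open>Weak compactness by separation of convex hulls\<close>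

text \<open>Here \<xi> plays the role of a bidual point in the weak-star closure of A, and
  \<open>sep\<close> denies the separated sequences of James's criterion. If no point were within d
  of \<xi> uniformly on the dual ball, one could choose a sequence in A whose initial hulls stay
  away from \<xi> while its tails approach \<xi> on the functionals that witness this.\<close>

lemma approximable_functional_is_evaluation:
  fixes A :: "'f::banach set" and \<xi> :: "('f \<Rightarrow> real) \<Rightarrow> real"
  assumes approx: "\<And>F e. finite F \<Longrightarrow> F \<subseteq> Collect bounded_linear \<Longrightarrow> e > 0 \<Longrightarrow>
      \<exists>a\<in>A. \<forall>\<phi>\<in>F. \<bar>\<phi> a - \<xi> \<phi>\<bar> < e"
    and sep: "\<And>x \<theta>. (\<And>n. x n \<in> A) \<Longrightarrow> \<theta> > 0 \<Longrightarrow>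
      \<exists>N::nat. \<exists>u\<in>convex hull (x ` {..<N}). \<exists>v\<in>convex hull (x ` {N..}). norm (u - v) < \<theta>"
  shows "\<exists>x. \<forall>\<phi>. bounded_linear \<phi> \<longrightarrow> \<xi> \<phi> = \<phi> x"
proof -
  define B where "B = {\<phi> :: 'f \<Rightarrow> real. linear \<phi> \<and> (\<forall>y. \<bar>\<phi> y\<bar> \<le> norm y)}"
  have B_bl: "bounded_linear \<phi>" if "\<phi> \<in> B" for \<phi>
    using that unfolding B_def
    by (intro bounded_linear_intro[where K = 1]) (auto simp: linear_add linear_scale)
  have "\<exists>x. \<forall>\<phi>\<in>B. \<bar>\<xi> \<phi> - \<phi> x\<bar> \<le> d" if d: "d > 0" for d
  proof (rule ccontr)
    assume "\<not> ?thesis"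
    then have far: "\<exists>\<phi>\<in>B. \<bar>\<xi> \<phi> - \<phi> x\<bar> > d" for x by (meson not_le)
    \<comment> \<open>The hull of finitely many points is compact, so finitely many functionals
      witness the distance for all of its points.\<close>
    have "\<exists>F\<subseteq>B. finite F \<and> (\<forall>u\<in>convex hull S. \<exists>\<phi>\<in>F. \<bar>\<xi> \<phi> - \<phi> u\<bar> > d)" if "finite S" for S
    proof -
      have "compact (convex hull S)" using that by (rule finite_imp_compact_convex_hull)
      moreover have "open {u. \<bar>\<xi> \<phi> - \<phi> u\<bar> > d}" if "\<phi> \<in> B" for \<phi>
        using B_bl[OF that] by (intro open_Collect_less continuous_intros linear_continuous_on)
      moreover have "convex hull S \<subseteq> (\<Union>\<phi>\<in>B. {u. \<bar>\<xi> \<phi> - \<phi> u\<bar> > d})" using far by blast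
      ultimately obtain F where "F \<subseteq> B" "finite F" "convex hull S \<subseteq> (\<Union>\<phi>\<in>F. {u. \<bar>\<xi> \<phi> - \<phi> u\<bar> > d})"
        by (rule compactE_image)
      then show ?thesis by blast
    qed
    then obtain G where G: "finite S \<Longrightarrow> G S \<subseteq> B \<and> finite (G S) \<and>
        (\<forall>u\<in>convex hull S. \<exists>\<phi>\<in>G S. \<bar>\<xi> \<phi> - \<phi> u\<bar> > d)" for S by metis
    \<comment> \<open>The n-th point approximates \<xi> on the witnesses of all initial segments
      chosen so far; these are finitely many functionals.\<close>
    define P where "P f n r \<longleftrightarrow> r \<in> A \<and> (\<forall>k\<le>n. \<forall>\<phi>\<in>G (f ` {..<k}). \<bar>\<phi> r - \<xi> \<phi>\<bar> < d / 4)"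
      for f :: "nat \<Rightarrow> 'f" and n r
    have "\<exists>x. \<forall>n. P x n (x n)"
    proof (rule dependent_wellorder_choice)
      fix r and f g :: "nat \<Rightarrow> 'f" and n :: nat assume eq: "\<And>y. y < n \<Longrightarrow> f y = g y"
      have "f ` {..<k} = g ` {..<k}" if "k \<le> n" for k using eq that by (intro image_cong) auto
      then show "P f n r = P g n r" by (simp add: P_def)
    next
      fix n and f :: "nat \<Rightarrow> 'f"
      have "\<exists>a\<in>A. \<forall>\<phi>\<in>(\<Union>k\<le>n. G (f ` {..<k})). \<bar>\<phi> a - \<xi> \<phi>\<bar> < d / 4"
        using G B_bl d by (intro approx) auto
      then show "\<exists>r. P f n r" unfolding P_def by blast
    qed
    then obtain x where x: "\<And>n. P x n (x n)" by blast
    then have "\<And>n. x n \<in> A" by (simp add: P_def)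
    then obtain N u v where uv: "u \<in> convex hull (x ` {..<N})" "v \<in> convex hull (x ` {N..})"
      "norm (u - v) < d / 2"
      using sep[of x "d / 2"] d by auto
    obtain \<phi> where \<phi>: "\<phi> \<in> G (x ` {..<N})" "\<bar>\<xi> \<phi> - \<phi> u\<bar> > d" using G[of "x ` {..<N}"] uv(1) by blast
    then have B: "\<phi> \<in> B" using G[of "x ` {..<N}"] by blast
    have lin: "linear \<phi>" using B by (simp add: B_def)
    have "convex (\<phi> -` cball (\<xi> \<phi>) (d / 4))" using lin by (intro convex_linear_vimage convex_cball)
    moreover have "x ` {N..} \<subseteq> \<phi> -` cball (\<xi> \<phi>) (d / 4)"
      using x \<phi>(1) by (fastforce simp: P_def dist_real_def abs_minus_commute)
    ultimately have "v \<in> \<phi> -` cball (\<xi> \<phi>) (d / 4)" using uv(2) hull_minimal by blast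
    \<comment> \<open>At \<phi> the point u misses \<xi> by more than d and v by at most d / 4, yet
      u and v differ by less than d / 2.\<close>
    then have "\<bar>\<xi> \<phi> - \<phi> v\<bar> \<le> d / 4" by (simp add: dist_real_def)
    moreover have "\<bar>\<phi> u - \<phi> v\<bar> \<le> norm (u - v)" using B unfolding B_def by (metis (mono_tags, lifting) mem_Collect_eq linear_diff)
    ultimately show False using \<phi>(2) uv(3) d by linarith
  qed
  then have "\<forall>n. \<exists>x. \<forall>\<phi>\<in>B. \<bar>\<xi> \<phi> - \<phi> x\<bar> \<le> inverse (Suc n)" by simp
  then obtain x where x: "\<And>n \<phi>. \<phi> \<in> B \<Longrightarrow> \<bar>\<xi> \<phi> - \<phi> (x n)\<bar> \<le> inverse (Suc n)" by metis
  have dist: "norm (x m - x n) \<le> inverse (Suc m) + inverse (Suc n)" for m n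
  proof -
    obtain \<phi> :: "'f \<Rightarrow> real" where \<phi>: "linear \<phi>" "\<And>y. \<bar>\<phi> y\<bar> \<le> norm y" "\<phi> (x m - x n) = norm (x m - x n)"
      using norming_functional by blast
    then have "\<phi> \<in> B" by (simp add: B_def)
    then show ?thesis using x[of \<phi> m] x[of \<phi> n] \<phi>(3) linear_diff[OF \<phi>(1)] by fastforce
  qed
  have "Cauchy x"
  proof (rule CauchyI)
    fix e :: real assume "e > 0"
    then obtain M where M: "inverse (Suc M) < e / 2" by (metis reals_Archimedean half_gt_zero)
    have "norm (x m - x n) < e" if "m \<ge> M" "n \<ge> M" for m n
    proof -
      have "inverse (Suc m) \<le> inverse (Suc M)" "inverse (Suc n) \<le> inverse (Suc M)"
        using that by (auto intro!: le_imp_inverse_le)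
      with dist[of m n] M show ?thesis by linarith
    qed
    then show "\<exists>M. \<forall>m\<ge>M. \<forall>n\<ge>M. norm (x m - x n) < e" by blast
  qed
  then obtain z where z: "x \<longlonglongrightarrow> z" using Cauchy_convergent convergent_def by blast
  have B_ev: "\<xi> \<phi> = \<phi> z" if "\<phi> \<in> B" for \<phi>
  proof -
    have "(\<lambda>n. \<phi> (x n)) \<longlonglongrightarrow> \<phi> z" using B_bl[OF that] z by (rule bounded_linear.tendsto)
    moreover have "(\<lambda>n. \<phi> (x n)) \<longlonglongrightarrow> \<xi> \<phi>"
    proof (rule LIM_zero_cancel, rule tendsto_rabs_zero_cancel, rule tendsto_sandwich[OF _ _ tendsto_const LIMSEQ_inverse_real_of_nat])
      show "\<forall>\<^sub>F n in sequentially. \<bar>\<phi> (x n) - \<xi> \<phi>\<bar> \<le> inverse (real (Suc n))"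
        using x[OF that] by (simp add: abs_minus_commute)
    qed auto
    ultimately show ?thesis using LIMSEQ_unique by blast
  qed
  \<comment> \<open>Homogeneity of \<xi> is inherited from the points of A that approximate it at
    \<phi> and at \<phi> / K simultaneously; this reduces \<phi> to the dual ball.\<close>
  have "\<xi> \<phi> = \<phi> z" if bl: "bounded_linear \<phi>" for \<phi>
  proof -
    obtain K where K: "K > 0" "\<And>y. norm (\<phi> y) \<le> norm y * K" using bounded_linear.pos_bounded[OF bl] by blast
    define \<psi> where "\<psi> y = \<phi> y / K" for y
    have \<psi>: "\<psi> \<in> B"
      unfolding B_def \<psi>_def using K bounded_linear.linear[OF bl]
      by (auto simp: field_simps linear_add linear_scale intro!: linearI)
    have "\<bar>\<xi> \<phi> - K * \<xi> \<psi>\<bar> \<le> e" if "e > 0" for e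
    proof -
      define e' where "e' = e / (1 + K)"
      have "e' > 0" using that K by (simp add: e'_def)
      then obtain a where a: "a \<in> A" "\<bar>\<phi> a - \<xi> \<phi>\<bar> < e'" "\<bar>\<psi> a - \<xi> \<psi>\<bar> < e'"
        using approx[of "{\<phi>, \<psi>}" e'] bl B_bl[OF \<psi>] by auto
      have "\<phi> a = K * \<psi> a" using K by (simp add: \<psi>_def)
      then have "\<bar>\<xi> \<phi> - K * \<xi> \<psi>\<bar> = \<bar>K * (\<psi> a - \<xi> \<psi>) - (\<phi> a - \<xi> \<phi>)\<bar>"
        by (simp add: algebra_simps)
      also have "\<dots> \<le> \<bar>K * (\<psi> a - \<xi> \<psi>)\<bar> + \<bar>\<phi> a - \<xi> \<phi>\<bar>" by (rule abs_triangle_ineq4)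
      also have "\<dots> = \<bar>\<phi> a - \<xi> \<phi>\<bar> + K * \<bar>\<psi> a - \<xi> \<psi>\<bar>" using K(1) by (simp add: abs_mult)
      also have "\<dots> \<le> e' + K * e'" using a K by (intro add_mono mult_left_mono) auto
      also have "\<dots> = e' * (1 + K)" by (simp add: algebra_simps)
      also have "\<dots> = e" using K by (simp add: e'_def)
      finally show ?thesis .
    qed
    then have "\<xi> \<phi> = K * \<xi> \<psi>" by (metis abs_le_zero_iff eq_iff_diff_eq_0 field_le_epsilon add_0)
    then show ?thesis using B_ev[OF \<psi>] K by (simp add: \<psi>_def)
  qed
  then show ?thesis by blast
qed

text \<open>The weak topology is pulled back by \<open>ev\<close> from a product of real lines, one
  for each functional. There the closure of A is compact by Tychonoff's theorem, and by the
  preceding lemma all its points are evaluations, so the inverse of \<open>ev\<close> carries it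
  back.\<close>

proposition weakly_compact_criterion:
  fixes A :: "'f::banach set"
  assumes bdd: "bounded A"
    and sep: "\<And>x \<theta>. (\<And>n. x n \<in> A) \<Longrightarrow> \<theta> > 0 \<Longrightarrow>
      \<exists>N::nat. \<exists>u\<in>convex hull (x ` {..<N}). \<exists>v\<in>convex hull (x ` {N..}). norm (u - v) < \<theta>"
  shows "compactin weak_topology (weak_topology closure_of A)"
proof -
  define \<Phi> where "\<Phi> = {\<phi> :: 'f \<Rightarrow> real. bounded_linear \<phi>}"
  define P where "P = product_topology (\<lambda>\<phi>. euclideanreal) \<Phi>"
  define ev where "ev x = restrict (\<lambda>\<phi>. \<phi> x) \<Phi>" for x :: 'f
  define K where "K = P closure_of (ev ` A)"
  have topP: "topspace P = PiE \<Phi> (\<lambda>_. UNIV)" by (simp add: P_def)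
  have topW: "topspace (weak_topology :: 'f topology) = UNIV"
  proof -
    have "bounded_linear (\<lambda>x::'f. 0::real)" by (rule bounded_linear_zero)
    then have "(\<lambda>x::'f. 0::real) -` UNIV \<in> {phi -` U | (phi :: 'f \<Rightarrow> real) U. bounded_linear phi \<and> open U}"
      by blast
    then show ?thesis unfolding weak_topology_def topology_generated_by_topspace by auto
  qed
  have evP: "ev x \<in> topspace P" for x by (simp add: topP ev_def)
  have "compactin P (PiE \<Phi> (\<lambda>\<phi>. closure (\<phi> ` A)))"
    unfolding P_def compactin_PiE using bounded_linear_image[OF bdd]
    by (auto simp: \<Phi>_def compact_closure compactin_euclidean_iff)
  moreover have "K \<subseteq> PiE \<Phi> (\<lambda>\<phi>. closure (\<phi> ` A))"
    unfolding K_def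
  proof (rule closure_of_minimal)
    show "ev ` A \<subseteq> PiE \<Phi> (\<lambda>\<phi>. closure (\<phi> ` A))" using closure_subset by (fastforce simp: ev_def)
    show "closedin P (PiE \<Phi> (\<lambda>\<phi>. closure (\<phi> ` A)))" by (simp add: P_def closedin_product_topology)
  qed
  ultimately have K: "compactin P K" by (rule closed_compactin) (simp add: K_def)
  have Krange: "K \<subseteq> range ev"
  proof
    fix \<xi> :: "('f \<Rightarrow> real) \<Rightarrow> real" assume \<xi>: "\<xi> \<in> K"
    have "\<exists>x. \<forall>\<phi>. bounded_linear \<phi> \<longrightarrow> \<xi> \<phi> = \<phi> x"
    proof (rule approximable_functional_is_evaluation[OF _ sep])
      fix F :: "('f \<Rightarrow> real) set" and e :: real assume F: "finite F" "F \<subseteq> Collect bounded_linear" and e: "e > 0"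
      define U where "U = PiE \<Phi> (\<lambda>\<phi>. if \<phi> \<in> F then ball (\<xi> \<phi>) e else UNIV)"
      have "openin P U"
        unfolding U_def P_def
      proof (rule product_topology_basis)
        have "{\<phi>. (if \<phi> \<in> F then ball (\<xi> \<phi>) e else UNIV) \<noteq> topspace euclideanreal} \<subseteq> F" by auto
        then show "finite {\<phi>. (if \<phi> \<in> F then ball (\<xi> \<phi>) e else UNIV) \<noteq> topspace euclideanreal}"
          using F(1) finite_subset by blast
      qed simp
      moreover have "\<xi> \<in> U"
        using \<xi> e closure_of_subset_topspace[of P "ev ` A"] unfolding U_def K_def topP by (auto simp: PiE_iff)
      ultimately obtain a where a: "a \<in> A" "ev a \<in> U" using \<xi> unfolding K_def in_closure_of by blast
      have "\<bar>\<phi> a - \<xi> \<phi>\<bar> < e" if "\<phi> \<in> F" for \<phi>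
      proof -
        have "\<phi> \<in> \<Phi>" using that F by (auto simp: \<Phi>_def)
        then have "ev a \<phi> \<in> ball (\<xi> \<phi>) e" using a(2) that unfolding U_def by (auto simp: PiE_iff)
        then show ?thesis using \<open>\<phi> \<in> \<Phi>\<close> by (simp add: ev_def dist_real_def abs_minus_commute)
      qed
      then show "\<exists>a\<in>A. \<forall>\<phi>\<in>F. \<bar>\<phi> a - \<xi> \<phi>\<bar> < e" using a(1) by blast
    qed
    then obtain x where x: "\<And>\<phi>. bounded_linear \<phi> \<Longrightarrow> \<xi> \<phi> = \<phi> x" by blast
    have "\<xi> \<in> PiE \<Phi> (\<lambda>_. UNIV)"
      using \<xi> closure_of_subset_topspace[of P "ev ` A"] unfolding K_def topP by blast
    moreover have "ev x \<in> PiE \<Phi> (\<lambda>_. UNIV)" using evP topP by blast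
    ultimately have "\<xi> = ev x"
      by (rule PiE_ext) (use x in \<open>simp add: ev_def \<Phi>_def\<close>)
    then show "\<xi> \<in> range ev" by blast
  qed
  have inj: "inj ev"
  proof (rule injI)
    fix x y assume eq: "ev x = ev y"
    obtain \<phi> :: "'f \<Rightarrow> real" where \<phi>: "linear \<phi>" "\<And>y. \<bar>\<phi> y\<bar> \<le> norm y" "\<phi> (x - y) = norm (x - y)"
      using norming_functional by blast
    then have "\<phi> \<in> \<Phi>" unfolding \<Phi>_def
      by (auto intro!: bounded_linear_intro[where K = 1] simp: linear_add linear_scale)
    then have "\<phi> x = \<phi> y" using eq unfolding ev_def by (metis restrict_apply')
    then show "x = y" using \<phi> by (simp add: linear_diff)
  qed
  define g where "g = inv ev"
  have g: "g (ev x) = x" for x using inj by (simp add: g_def)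
  define S where "S = {phi -` U | (phi :: 'f \<Rightarrow> real) U. bounded_linear phi \<and> open U}"
  have W: "weak_topology = topology_generated_by S" by (simp add: weak_topology_def S_def)
  have "continuous_map (subtopology P (range ev)) weak_topology g"
    unfolding W
  proof (rule continuous_on_generated_topo)
    fix V assume "V \<in> S"
    then obtain \<phi> :: "'f \<Rightarrow> real" and U where V: "V = \<phi> -` U" and bl: "bounded_linear \<phi>" and U: "open U"
      unfolding S_def mem_Collect_eq by (elim exE conjE)
    have \<Phi>: "\<phi> \<in> \<Phi>" using bl by (simp add: \<Phi>_def)
    have "continuous_map P euclideanreal (\<lambda>h. h \<phi>)"
      unfolding P_def using \<Phi> by (rule continuous_map_product_projection)
    then have "openin P {h \<in> topspace P. h \<phi> \<in> U}" 
      by (rule openin_continuous_map_preimage) (use U in simp)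
    moreover have "g -` V \<inter> topspace (subtopology P (range ev)) = range ev \<inter> {h \<in> topspace P. h \<phi> \<in> U}"
    proof -
      have "g h \<in> V \<longleftrightarrow> h \<phi> \<in> U" if "h \<in> range ev" for h
        using that g \<Phi> by (auto simp: V ev_def)
      then show ?thesis using evP by (auto simp: topspace_subtopology)
    qed
    ultimately show "openin (subtopology P (range ev)) (g -` V \<inter> topspace (subtopology P (range ev)))"
      by (simp add: openin_subtopology_Int2)
  next
    show "g ` topspace (subtopology P (range ev)) \<subseteq> \<Union> S"
      using topW unfolding W topology_generated_by_topspace by simp
  qed
  moreover have "compactin (subtopology P (range ev)) K"
    using K Krange by (simp add: compactin_subtopology)
  ultimately have gK: "compactin weak_topology (g ` K)" by (rule image_compactin[rotated])
  have cont: "continuous_map weak_topology P ev"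
    unfolding P_def continuous_map_componentwise
  proof (intro conjI ballI)
    show "ev ` topspace weak_topology \<subseteq> extensional \<Phi>" by (auto simp: ev_def)
    fix \<phi> assume \<Phi>: "\<phi> \<in> \<Phi>"
    have "openin weak_topology (\<phi> -` U)" if "open U" for U
      unfolding weak_topology_def using that \<Phi> by (intro topology_generated_by_Basis) (auto simp: \<Phi>_def)
    then show "continuous_map weak_topology euclideanreal (\<lambda>x. ev x \<phi>)"
      using \<Phi> topW by (simp add: continuous_map_def ev_def vimage_def)
  qed
  have "closedin weak_topology (ev -` K)"
    using closedin_continuous_map_preimage[OF cont, of K] topW by (simp add: K_def vimage_def)
  moreover have "ev -` K = g ` K"
  proof
    show "ev -` K \<subseteq> g ` K" using g by (metis image_eqI subsetI vimage_eq)
    show "g ` K \<subseteq> ev -` K" using g Krange by auto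
  qed
  moreover have "ev ` A \<subseteq> K"
    unfolding K_def by (rule closure_of_subset) (rule image_subsetI, rule evP)
  then have "A \<subseteq> ev -` K" by auto
  ultimately have "weak_topology closure_of A \<subseteq> g ` K" using closure_of_minimal by metis
  then show ?thesis using gK closed_compactin closedin_closure_of by blast
qed

subsection \<open>Banach spaces with points in the universe\<close>

text \<open>The extension properties speak about spaces with points in the universe, so subspaces of
  \<open>l_inf\<close> are transported there along an injection; \<open>inv code\<close> decodes a
  point before each operation.\<close>

definition coded_space :: "('b::real_normed_vector \<Rightarrow> 'u) \<Rightarrow> 'b set \<Rightarrow> 'u nspace" where
  "coded_space code X =
     \<lparr>vcarrier = code ` X, vadd = (\<lambda>u v. code (inv code u + inv code v)), vzero = code 0,
      vscale = (\<lambda>a u. code (a *\<^sub>R inv code u)), vnorm = (\<lambda>u. norm (inv code u))\<rparr>"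

context
  fixes code :: "'b::real_normed_vector \<Rightarrow> 'u" and X :: "'b set"
  assumes inj: "inj code" and X: "subspace X" "complete X"
begin

lemma coded_simps:
  "vcarrier (coded_space code X) = code ` X"
  "vadd (coded_space code X) (code x) (code y) = code (x + y)"
  "vzero (coded_space code X) = code 0"
  "vscale (coded_space code X) a (code x) = code (a *\<^sub>R x)"
  "vnorm (coded_space code X) (code x) = norm x"
  using inj by (simp_all add: coded_space_def)

lemma coded_normed: "normed_space (coded_space code X)"
  unfolding normed_space_def coded_simps(1) ball_simps(9)
  using X(1) inj
  by (auto simp: coded_simps subspace_add subspace_scale subspace_0 algebra_simps inj_eq norm_triangle_ineq)

lemma coded_dist: "x \<in> X \<Longrightarrow> y \<in> X \<Longrightarrow> vdist (coded_space code X) (code x) (code y) = dist x y"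
  by (simp add: vdist_def coded_simps dist_norm)

lemma coded_metric: "Metric_space (code ` X) (vdist (coded_space code X))"
proof
  fix u v
  show "0 \<le> vdist (coded_space code X) u v"
    by (auto simp: vdist_def coded_space_def)
  show "vdist (coded_space code X) u v = vdist (coded_space code X) v u"
    using coded_dist by (cases "u \<in> code ` X \<and> v \<in> code ` X")
      (auto simp: vdist_def coded_simps norm_minus_commute)
next
  fix u v assume "u \<in> code ` X" "v \<in> code ` X"
  then show "vdist (coded_space code X) u v = 0 \<longleftrightarrow> u = v"
    using inj by (auto simp: coded_dist inj_eq)
next
  fix u v w assume "u \<in> code ` X" "v \<in> code ` X" "w \<in> code ` X"
  then show "vdist (coded_space code X) u w \<le> vdist (coded_space code X) u v + vdist (coded_space code X) v w"
    by (auto simp: coded_dist dist_triangle)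
qed

interpretation M: Metric_space "code ` X" "vdist (coded_space code X)"
  by (rule coded_metric)

lemma coded_mball: "x \<in> X \<Longrightarrow> M.mball (code x) r = code ` (X \<inter> ball x r)"
  by (auto simp: M.mball_def coded_dist)

text \<open>Through this map closedness and separability of coded sets are read off the ordinary
  subspace topology.\<close>

lemma coded_homeomorphic: "homeomorphic_map (top_of_set X) (vtopology (coded_space code X)) code"
proof -
  have top: "vtopology (coded_space code X) = M.mtopology"
    by (simp add: vtopology_def coded_simps)
  have "openin (top_of_set X) {x \<in> X. code x \<in> U} \<longleftrightarrow> openin M.mtopology U" if U: "U \<subseteq> code ` X" for U
  proof -
    define V where "V = {x \<in> X. code x \<in> U}"
    have UV: "U = code ` V" using U by (auto simp: V_def)
    have "openin (top_of_set X) V \<longleftrightarrow> (\<forall>x\<in>V. \<exists>r>0. X \<inter> ball x r \<subseteq> V)"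
      by (subst openin_contains_ball) (auto simp: V_def Int_commute)
    also have "\<dots> \<longleftrightarrow> (\<forall>x\<in>V. \<exists>r>0. M.mball (code x) r \<subseteq> U)"
    proof (intro ball_cong refl)
      fix x assume "x \<in> V"
      then have "M.mball (code x) r = code ` (X \<inter> ball x r)" for r
        by (intro coded_mball) (simp add: V_def)
      then show "(\<exists>r>0. X \<inter> ball x r \<subseteq> V) \<longleftrightarrow> (\<exists>r>0. M.mball (code x) r \<subseteq> U)"
        unfolding UV by (simp add: inj_image_subset_iff[OF inj])
    qed
    also have "\<dots> \<longleftrightarrow> openin M.mtopology U" using U by (auto simp: M.openin_mtopology UV)
    finally show ?thesis by (simp add: V_def)
  qed
  then show ?thesis
    unfolding homeomorphic_map_def quotient_map_def top using inj by (auto simp: inj_on_def)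
qed

lemma coded_banach: "banach_space (coded_space code X)"
proof -
  have "\<exists>l. limitin M.mtopology \<sigma> l sequentially" if \<sigma>: "M.MCauchy \<sigma>" for \<sigma>
  proof -
    have "\<exists>s. \<forall>n. s n \<in> X \<and> \<sigma> n = code (s n)"
      using \<sigma> unfolding M.MCauchy_def image_subset_iff by (intro choice) (metis UNIV_I imageE)
    then obtain s where s: "\<And>n. s n \<in> X" "\<sigma> = (\<lambda>n. code (s n))" by auto
    have "Cauchy s"
      using \<sigma> s(1) unfolding M.MCauchy_def Cauchy_def s(2) by (auto simp: coded_dist)
    then obtain l where "l \<in> X" and l: "s \<longlonglongrightarrow> l" using X(2) s(1) unfolding complete_def by blast
    moreover have "\<forall>\<^sub>F n in sequentially. dist (s n) l < e" if "e > 0" for e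
      using l that by (rule tendstoD)
    ultimately have "limitin M.mtopology \<sigma> (code l) sequentially"
      by (auto simp: M.limitin_metric s coded_dist)
    then show ?thesis by blast
  qed
  then show ?thesis using coded_normed by (simp add: banach_space_def M.mcomplete_def coded_simps)
qed

lemma coded_separable:
  assumes "Y \<subseteq> X" "countable D" "D \<subseteq> Y" "Y \<subseteq> closure D"
  shows "separable_subset (coded_space code X) (code ` Y)"
proof -
  have "homeomorphic_map (subtopology (top_of_set X) Y) (subtopology (vtopology (coded_space code X)) (code ` Y)) code"
  proof (rule homeomorphic_map_subtopologies[OF coded_homeomorphic])
    have "topspace (vtopology (coded_space code X)) = code ` X"
      by (simp add: vtopology_def coded_simps)
    then show "code ` (topspace (top_of_set X) \<inter> Y) = topspace (vtopology (coded_space code X)) \<inter> code ` Y"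
      using assms(1) by auto
  qed
  then have "homeomorphic_map (top_of_set Y) (subtopology (vtopology (coded_space code X)) (code ` Y)) code"
    using assms(1) by (simp add: subtopology_subtopology Int_absorb1)
  moreover have "separable_space (top_of_set Y)"
    unfolding separable_space_def
    using assms by (intro exI[of _ D]) (auto simp: closure_of_subtopology Int_absorb1)
  ultimately show ?thesis
    unfolding separable_subset_def using homeomorphic_separable_space homeomorphic_map_imp_homeomorphic_space by blast
qed

lemma coded_closed_subspace:
  assumes "Y \<subseteq> X" "subspace Y" "closed Y"
  shows "closed_subspace (coded_space code X) (code ` Y)"
proof -
  have "closedin (top_of_set X) Y" using assms by (simp add: closed_subset)
  then have "closedin (vtopology (coded_space code X)) (code ` Y)"
    using homeomorphic_map_closedness_eq[OF coded_homeomorphic] by blast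
  then show ?thesis
    unfolding closed_subspace_def using assms
    by (auto simp: coded_simps subspace_add subspace_scale subspace_0)
qed

lemma operators_extend_decode:
  fixes t :: "'b \<Rightarrow> 'e::banach"
  assumes ext: "operators_extend TYPE('e) (coded_space code X) (code ` Y)"
    and Y: "Y \<subseteq> X" and t: "operator_on Y t"
  shows "\<exists>T. operator_on X T \<and> (\<forall>y\<in>Y. T y = t y)"
proof -
  have "operator_from (coded_space code X) (code ` Y) (t \<circ> inv code)"
    using t inj unfolding operator_from_def operator_on_def by (auto simp: coded_simps)
  then obtain T where T: "operator_from (coded_space code X) (code ` X) T" "\<And>y. y \<in> Y \<Longrightarrow> T (code y) = t y"
    using ext inj unfolding operators_extend_def coded_simps by auto
  have "operator_on X (T \<circ> code)"
    using T(1) unfolding operator_from_def operator_on_def by (auto simp: coded_simps)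
  then show ?thesis using T(2) by (intro exI[of _ "T \<circ> code"]) auto
qed

end

lemma complete_l_inf: "closed X \<Longrightarrow> complete X" for X :: "l_inf set"
proof -
  have "convergent f" if "Cauchy f" for f :: "nat \<Rightarrow> l_inf"
  proof -
    from that obtain g where "uniform_limit UNIV f g sequentially"
      using uniformly_convergent_eq_cauchy[of "\<lambda>_. True" f]
      unfolding Cauchy_def uniform_limit_sequentially_iff
      by (metis dist_fun_lt_imp_dist_val_lt)
    from uniform_limit_bcontfunE[OF this sequentially_bot] show ?thesis
      by (metis convergentI)
  qed
  then show "complete X" if "closed X"
    unfolding complete_def convergent_def using closed_sequentially[OF that] by blast
qed

text \<open>A real sequence is determined by the rationals below each of its entries, hence by a
  subset of a countable set. This is where the cardinality of the universe enters.\<close>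

lemma l_inf_inject:
  fixes c :: "real \<Rightarrow> 'u"
  assumes "inj c"
  obtains code :: "l_inf \<Rightarrow> 'u" where "inj code"
proof -
  define cut where "cut x = {k. of_rat (nat_to_rat_surj (snd (prod_decode k))) < apply_bcontfun x (fst (prod_decode k))}"
    for x :: l_inf
  have "inj cut"
  proof (rule injI, rule ccontr)
    fix x y assume eq: "cut x = cut y" and "x \<noteq> y"
    then obtain n where "apply_bcontfun x n \<noteq> apply_bcontfun y n" by (meson bcontfun_eqI)
    have False if lt: "apply_bcontfun x n < apply_bcontfun y n" and cut: "cut x = cut y" for x y :: l_inf
    proof -
      obtain q where q: "apply_bcontfun x n < of_rat q" "of_rat q < apply_bcontfun y n"
        using of_rat_dense[OF lt] by blast
      obtain m where "q = nat_to_rat_surj m" using surj_nat_to_rat_surj by (metis surjD)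
      with q have "prod_encode (n, m) \<in> cut y" "prod_encode (n, m) \<notin> cut x" by (auto simp: cut_def)
      then show False using cut by simp
    qed
    then show False using eq \<open>apply_bcontfun x n \<noteq> apply_bcontfun y n\<close> by (metis linorder_neqE)
  qed
  moreover obtain g :: "nat set \<Rightarrow> real" where "inj g"
    using nat_sets_eqpoll_reals unfolding eqpoll_def by (metis bij_betw_def)
  ultimately have "inj (c \<circ> g \<circ> cut)" using assms by (simp add: inj_compose)
  then show thesis by (rule that)
qed

section \<open>Both injectivity notions, restated for closed subspaces of
  \<open>l_inf\<close>\<close>

lemma separably_injective_extension:
  fixes c :: "real \<Rightarrow> 'u" and t :: "l_inf \<Rightarrow> 'e::banach" and X Y D :: "l_inf set"
  assumes "inj c" "separably_injective TYPE('u) TYPE('e)"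
    and X: "subspace X" "closed X" "countable D" "D \<subseteq> X" "X \<subseteq> closure D"
    and Y: "subspace Y" "closed Y" "Y \<subseteq> X" and t: "operator_on Y t"
  shows "\<exists>T. operator_on X T \<and> (\<forall>y\<in>Y. T y = t y)"
proof -
  have cX: "complete X" using X(2) by (rule complete_l_inf)
  obtain code :: "l_inf \<Rightarrow> 'u" where code: "inj code" using l_inf_inject[OF assms(1)] .
  have "operators_extend TYPE('e) (coded_space code X) (code ` Y)"
    using assms(2) coded_banach[OF code X(1) cX] coded_separable[OF code X(1) cX order_refl X(3-5)]
      coded_closed_subspace[OF code X(1) cX Y(3,1,2)]
    unfolding separably_injective_def by (simp add: coded_simps(1)[OF code X(1) cX])
  then show ?thesis by (rule operators_extend_decode[OF code X(1) cX _ Y(3) t])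
qed

lemma universally_separably_injective_extension:
  fixes c :: "real \<Rightarrow> 'u" and t :: "l_inf \<Rightarrow> 'e::banach" and X Y D :: "l_inf set"
  assumes "inj c" "universally_separably_injective TYPE('u) TYPE('e)"
    and X: "subspace X" "closed X"
    and Y: "subspace Y" "closed Y" "Y \<subseteq> X" "countable D" "D \<subseteq> Y" "Y \<subseteq> closure D" and t: "operator_on Y t"
  shows "\<exists>T. operator_on X T \<and> (\<forall>y\<in>Y. T y = t y)"
proof -
  have cX: "complete X" using X(2) by (rule complete_l_inf)
  obtain code :: "l_inf \<Rightarrow> 'u" where code: "inj code" using l_inf_inject[OF assms(1)] .
  have "operators_extend TYPE('e) (coded_space code X) (code ` Y)"
    using assms(2) coded_banach[OF code X(1) cX] coded_separable[OF code X(1) cX Y(3-6)]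
      coded_closed_subspace[OF code X(1) cX Y(3,1,2)]
    unfolding universally_separably_injective_def by (simp add: coded_simps(1)[OF code X(1) cX])
  then show ?thesis by (rule operators_extend_decode[OF code X(1) cX _ Y(3) t])
qed

subsection \<open>Exhaustive submeasures and disjointness\<close>

definition submeasure :: "'a set set \<Rightarrow> ('a set \<Rightarrow> real) \<Rightarrow> bool" where
  "submeasure \<A> \<mu> \<longleftrightarrow> \<mu> {} = 0 \<and> (\<forall>A\<in>\<A>. \<forall>B\<in>\<A>. A \<subseteq> B \<longrightarrow> \<mu> A \<le> \<mu> B) \<and>
     (\<forall>A\<in>\<A>. \<forall>B\<in>\<A>. \<mu> (A \<union> B) \<le> \<mu> A + \<mu> B)"

text \<open>For a submeasure, one small value per disjoint sequence already means convergence to 0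
  along every such sequence, since the condition also applies to subsequences.\<close>

definition exhaustive :: "'a set set \<Rightarrow> ('a set \<Rightarrow> real) \<Rightarrow> bool" where
  "exhaustive \<A> \<eta> \<longleftrightarrow>
     (\<forall>A :: nat \<Rightarrow> 'a set. \<forall>\<delta>>0. range A \<subseteq> \<A> \<and> disjoint_family A \<longrightarrow> (\<exists>n. \<eta> (A n) < \<delta>))"

context ring_of_sets
begin

lemma submeasure_UN_le:
  assumes \<mu>: "submeasure M \<mu>" and I: "finite I" and A: "\<And>i. i \<in> I \<Longrightarrow> A i \<in> M"
  shows "\<mu> (\<Union>i\<in>I. A i) \<le> (\<Sum>i\<in>I. \<mu> (A i))"
  using I A
proof (induction I)
  case (insert i I)
  then have "(\<Union>i\<in>I. A i) \<in> M" by (intro finite_UN) auto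
  then have "\<mu> (A i \<union> (\<Union>i\<in>I. A i)) \<le> \<mu> (A i) + \<mu> (\<Union>i\<in>I. A i)"
    using \<mu> insert.prems unfolding submeasure_def by auto
  then show ?case using insert by auto
qed (use \<mu> in \<open>simp add: submeasure_def\<close>)

text \<open>Otherwise one passes along indices between which the set keeps growing by at least e,
  and the successive differences are disjoint and uniformly large.\<close>

lemma exhaustive_increasing:
  fixes C :: "nat \<Rightarrow> 'a set"
  assumes \<eta>: "submeasure M \<eta>" "exhaustive M \<eta>"
    and C: "\<And>n. C n \<in> M" "mono C" and e: "e > 0"
  shows "\<exists>n. \<forall>m\<ge>n. \<eta> (C m - C n) < e"
proof (rule ccontr)
  assume "\<not> ?thesis"
  then have "\<forall>n. \<exists>m\<ge>n. e \<le> \<eta> (C m - C n)" by (meson not_less)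
  then obtain f where f: "\<And>n. f n \<ge> n" "\<And>n. e \<le> \<eta> (C (f n) - C n)" by metis
  have "f n \<noteq> n" for n using f(2)[of n] e \<eta>(1) by (auto simp: submeasure_def)
  define r where "r j = (f ^^ j) 0" for j
  have r: "r (Suc j) = f (r j)" for j by (simp add: r_def)
  have "mono r" using f(1) r by (simp add: mono_iff_le_Suc)
  define A where "A j = C (r (Suc j)) - C (r j)" for j
  have "disjoint_family A"
    unfolding disjoint_family_on_def
  proof (intro ballI impI)
    have *: "A i \<inter> A j = {}" if "i < j" for i j
    proof -
      have "r (Suc i) \<le> r j" using that \<open>mono r\<close> by (simp add: monoD)
      then have "C (r (Suc i)) \<subseteq> C (r j)" using C(2) monoD by blast
      then show ?thesis unfolding A_def by blast
    qed
    fix i j :: nat assume "i \<noteq> j"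
    then show "A i \<inter> A j = {}" using *[of i j] *[of j i] by (cases "i < j") auto
  qed
  moreover have "range A \<subseteq> M" using C(1) by (auto simp: A_def)
  ultimately obtain n where "\<eta> (A n) < e" using \<eta>(2) e unfolding exhaustive_def by blast
  then show False using f(2)[of "r n"] by (simp add: A_def r)
qed

text \<open>A sliding hump in a ring without countable unions. If all diagonal values were at least
  e, finite unions \<open>G k\<close> that nearly exhaust the tails of A would have decreasing
  intersections \<open>H k\<close> with \<mu> k (H k) at least e / 2. Exhaustiveness makes
  \<open>H k\<close> nearly equal to every later \<open>H l\<close>, and \<mu> k is small on
  \<open>H l\<close> by the hypothesis \<open>small\<close>.\<close>

lemma exhaustive_small:
  assumes \<eta>: "submeasure M \<eta>" "exhaustive M \<eta>"
    and \<mu>: "\<And>k. submeasure M (\<mu> k)" "\<And>k A. A \<in> M \<Longrightarrow> 0 \<le> \<mu> k A" "\<And>k A. A \<in> M \<Longrightarrow> \<mu> k A \<le> \<eta> A"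
    and A: "\<And>k. A k \<in> M" and small: "\<And>i k. i < k \<Longrightarrow> \<mu> i (A k) \<le> (1/2) ^ k" and e: "e > 0"
  shows "\<exists>k::nat. \<mu> k (A k) < e"
proof (rule ccontr)
  assume "\<not> ?thesis"
  then have large: "e \<le> \<mu> k (A k)" for k by (meson not_less)
  have mono: "\<mu> k B \<le> \<mu> k C" if "B \<subseteq> C" "B \<in> M" "C \<in> M" for k B C
    using \<mu>(1) that unfolding submeasure_def by blast
  have un: "\<mu> k (B \<union> C) \<le> \<mu> k B + \<mu> k C" if "B \<in> M" "C \<in> M" for k B C
    using \<mu>(1) that unfolding submeasure_def by blast
  define T where "T k m = (\<Union>j\<in>{k..m}. A j)" for k m
  have T: "T k m \<in> M" for k m using A by (auto simp: T_def)
  have "\<exists>n. \<forall>m\<ge>n. \<eta> (T k m - T k n) < e / 8 * (1/2) ^ k" for k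
  proof (rule exhaustive_increasing[OF \<eta> T])
    show "mono (T k)" unfolding T_def by (intro monoI UN_mono) auto
  qed (use e in simp)
  then obtain n where n: "\<And>k m. m \<ge> n k \<Longrightarrow> \<eta> (T k m - T k (n k)) < e / 8 * (1/2) ^ k" by metis
  \<comment> \<open>\<open>G k\<close> replaces the union of all A j with j \<ge> k: what any longer
    finite union adds to it has \<eta> value below e / 8 * (1/2) ^ k.\<close>
  define G where "G k = T k (n k)" for k
  define H where "H k = (\<Inter>i\<in>{..k}. G i)" for k
  have G: "G k \<in> M" for k by (simp add: G_def T)
  have H: "H k \<in> M" for k unfolding H_def using G by (intro finite_INT) auto
  \<comment> \<open>Intersecting with \<open>G i\<close> costs A k at most e / 8 * (1/2) ^ i, in
    total at most e / 4.\<close>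
  have H_large: "e / 2 \<le> \<mu> k (H k)" for k
  proof -
    have diff: "\<mu> k (A k - G i) \<le> e / 8 * (1/2) ^ i" if "i \<le> k" for i
    proof -
      have "\<mu> k (A k - G i) \<le> \<mu> k (T i (max k (n i)) - G i)"
      proof (rule mono)
        have "A k \<subseteq> T i (max k (n i))" using that unfolding T_def by (intro UN_upper) simp
        then show "A k - G i \<subseteq> T i (max k (n i)) - G i" by blast
      qed (use A G T in auto)
      also have "\<dots> \<le> \<eta> (T i (max k (n i)) - G i)" using T G by (intro \<mu>(3)) auto
      also have "\<dots> \<le> e / 8 * (1/2) ^ i" unfolding G_def by (rule less_imp_le[OF n]) simp
      finally show ?thesis .
    qed
    have UG: "(\<Union>i\<in>{..k}. A k - G i) \<in> M" by (rule finite_UN) (use A G in auto)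
    have "e \<le> \<mu> k (A k)" by (rule large)
    also have "\<dots> \<le> \<mu> k (H k \<union> (\<Union>i\<in>{..k}. A k - G i))"
    proof (rule mono)
      show "A k \<subseteq> H k \<union> (\<Union>i\<in>{..k}. A k - G i)" unfolding H_def by blast
    qed (use A H UG in auto)
    also have "\<dots> \<le> \<mu> k (H k) + \<mu> k (\<Union>i\<in>{..k}. A k - G i)" using H UG by (rule un)
    also have "\<mu> k (\<Union>i\<in>{..k}. A k - G i) \<le> (\<Sum>i\<in>{..k}. \<mu> k (A k - G i))"
      using A G by (intro submeasure_UN_le[OF \<mu>(1)]) auto
    also have "\<dots> \<le> (\<Sum>i\<in>{..k}. e / 8 * (1/2) ^ i)" using diff by (intro sum_mono) auto
    also have "\<dots> = e / 8 * (\<Sum>i<Suc k. (1/2) ^ i)" by (simp only: sum_distrib_left lessThan_Suc_atMost)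
    also have "\<dots> \<le> e / 8 * 2"
    proof (rule mult_left_mono)
      have "(\<Sum>i<Suc k. (1/2) ^ i) = 2 * (1 - (1/2::real) ^ Suc k)" by (subst sum_gp_strict) simp
      also have "\<dots> \<le> 2" by (simp add: power_le_one)
      finally show "(\<Sum>i<Suc k. (1/2) ^ i) \<le> (2::real)" .
    qed (use e in simp)
    finally show ?thesis using e by simp
  qed
  have "\<exists>k. \<forall>l\<ge>k. \<eta> ((H 0 - H l) - (H 0 - H k)) < e / 4"
  proof (rule exhaustive_increasing[OF \<eta>])
    show "H 0 - H n \<in> M" for n using H[of 0] H[of n] by (rule Diff)
    show "mono (\<lambda>n. H 0 - H n)" by (rule monoI) (auto simp: H_def)
  qed (use e in simp)
  then obtain k where k: "\<And>l. l \<ge> k \<Longrightarrow> \<eta> ((H 0 - H l) - (H 0 - H k)) < e / 4" by blast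
  obtain p where p: "2 * (1/2) ^ p < e / 4" using real_arch_pow_inv[of "e / 8" "1/2"] e by (auto simp: mult.commute)
  define l where "l = max p (Suc k)"
  \<comment> \<open>Since l > k, every A j in the union \<open>G l\<close> has \<mu> k value at most
    (1/2) ^ j; these values form a geometric tail.\<close>
  have "\<mu> k (H l) \<le> \<mu> k (G l)" using H G by (intro mono) (auto simp: H_def)
  also have "\<dots> \<le> (\<Sum>j\<in>{l..n l}. \<mu> k (A j))"
    unfolding G_def T_def using A by (intro submeasure_UN_le[OF \<mu>(1)]) auto
  also have "\<dots> \<le> (\<Sum>j\<in>{l..n l}. (1/2) ^ j)" by (intro sum_mono small) (auto simp: l_def)
  also have "\<dots> \<le> 2 * (1/2) ^ l"
  proof (cases "n l < l")
    case False
    then have "(\<Sum>j\<in>{l..n l}. (1/2::real) ^ j) = 2 * ((1/2) ^ l - (1/2) ^ Suc (n l))"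
      by (subst sum_gp) simp
    then show ?thesis by simp
  qed simp
  also have "\<dots> \<le> 2 * (1/2) ^ p" unfolding l_def by (intro mult_left_mono power_decreasing) auto
  finally have "\<mu> k (H l) < e / 4" using p by simp
  moreover have "\<mu> k (H k - H l) < e / 4"
  proof -
    have "(H 0 - H l) - (H 0 - H k) = H k - H l" by (auto simp: H_def)
    then have "\<eta> (H k - H l) < e / 4" using k[of l] by (simp add: l_def)
    then show ?thesis using \<mu>(3)[of "H k - H l" k] H by (simp add: Diff)
  qed
  moreover have "\<mu> k (H k) \<le> \<mu> k (H l) + \<mu> k (H k - H l)"
  proof -
    have "\<mu> k (H k) \<le> \<mu> k (H l \<union> (H k - H l))" using H by (intro mono) auto
    also have "\<dots> \<le> \<mu> k (H l) + \<mu> k (H k - H l)" using H by (intro un) auto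
    finally show ?thesis .
  qed
  ultimately show False using H_large[of k] by simp
qed

end

lemma infinite_partition:
  fixes N :: "nat set"
  assumes "infinite N"
  shows "\<exists>P :: nat \<Rightarrow> nat set. (\<forall>p. infinite (P p) \<and> P p \<subseteq> N) \<and> disjoint_family P"
proof -
  define P where "P p = (\<lambda>i. enumerate N (prod_encode (p, i))) ` UNIV" for p
  have inj: "enumerate N i = enumerate N j \<longleftrightarrow> i = j" for i j
    using strict_mono_eq[OF strict_mono_enumerate[OF assms]] .
  show ?thesis
  proof (intro exI[of _ P] conjI allI)
    show "infinite (P p)" for p unfolding P_def
      by (rule range_inj_infinite) (auto intro!: injI simp: inj prod_encode_eq)
    show "P p \<subseteq> N" for p using enumerate_in_set[OF assms] by (auto simp: P_def)
    show "disjoint_family P" by (auto simp: disjoint_family_on_def P_def inj prod_encode_eq)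
  qed
qed

text \<open>Descent on a bound n * e for the masses on an infinite index set. Split the set into
  infinitely many infinite parts. If every part fails, the indices at which the parts fail form a
  new infinite set; each of them sees mass at least e in its own part, away from the new set, so
  superadditivity lowers the bound by e.\<close>

lemma rosenthal_disjointness:
  fixes m :: "nat \<Rightarrow> nat set \<Rightarrow> real"
  assumes nonneg: "\<And>k A. 0 \<le> m k A"
    and super: "\<And>k A B. A \<inter> B = {} \<Longrightarrow> m k A + m k B \<le> m k (A \<union> B)"
    and bound: "\<And>k. m k UNIV \<le> C" and e: "e > 0"
  obtains M where "infinite M" "\<And>k. k \<in> M \<Longrightarrow> m k (M - {k}) < e"
proof -
  have mono: "m k A \<le> m k B" if "A \<subseteq> B" for k A B
  proof -
    have "m k A + m k (B - A) \<le> m k (A \<union> (B - A))" by (rule super) auto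
    moreover have "A \<union> (B - A) = B" using that by auto
    ultimately show ?thesis using nonneg[of k "B - A"] by simp
  qed
  have step: "\<exists>M. infinite M \<and> (\<forall>k\<in>M. m k (M - {k}) < e)"
    if "infinite N" "\<And>k. k \<in> N \<Longrightarrow> m k N \<le> real n * e" for n N
    using that
  proof (induction n arbitrary: N)
    case 0
    have "m k (N - {k}) < e" if "k \<in> N" for k
      using mono[of "N - {k}" N k] 0(2)[OF that] e by simp
    then show ?case using 0(1) by blast
  next
    case (Suc n)
    from infinite_partition[OF Suc.prems(1)] obtain P :: "nat \<Rightarrow> nat set"
      where "\<forall>p. infinite (P p) \<and> P p \<subseteq> N" and disj: "disjoint_family P" by (elim exE conjE)
    then have P: "infinite (P p)" "P p \<subseteq> N" for p by auto
    show ?case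
    proof (cases "\<exists>p. \<forall>k\<in>P p. m k (P p - {k}) < e")
      case True
      then obtain p where "\<forall>k\<in>P p. m k (P p - {k}) < e" by (rule exE)
      then show ?thesis using P(1)[of p] by (intro exI[of _ "P p"] conjI)
    next
      case False
      then have "\<forall>p. \<exists>k. k \<in> P p \<and> e \<le> m k (P p - {k})" by (simp add: not_less Bex_def)
      from choice[OF this] obtain k where k: "\<And>p. k p \<in> P p" "\<And>p. e \<le> m (k p) (P p - {k p})"
        by blast
      have inj: "inj k"
      proof (rule injI)
        fix p q assume "k p = k q"
        then have "k p \<in> P p \<inter> P q" using k(1)[of p] k(1)[of q] by simp
        then show "p = q" using disj unfolding disjoint_family_on_def by blast
      qed
      show ?thesis
      proof (rule Suc.IH)
        show "infinite (range k)" using inj by (rule range_inj_infinite)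
        fix j assume "j \<in> range k"
        then obtain p where p: "j = k p" by blast
        have "k q \<notin> P p" if "q \<noteq> p" for q
          using k(1)[of q] disj that unfolding disjoint_family_on_def by blast
        then have "range k \<inter> (P p - {k p}) = {}" by fast
        then have "m j (range k) + m j (P p - {k p}) \<le> m j (range k \<union> (P p - {k p}))" by (rule super)
        also have "\<dots> \<le> m j N" using k(1) P(2) by (intro mono) blast
        also have "\<dots> \<le> real (Suc n) * e" using k(1) P(2) p by (intro Suc.prems(2)) blast
        finally show "m j (range k) \<le> real n * e" using k(2)[of p] p by (simp add: algebra_simps)
      qed
    qed
  qed
  obtain n where "C \<le> real n * e" using reals_Archimedean3[OF e] less_imp_le by metis
  then have "m k UNIV \<le> real n * e" for k using bound[of k] by simp
  then have "\<exists>M. infinite M \<and> (\<forall>k\<in>M. m k (M - {k}) < e)"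
    by (intro step[of UNIV n]) auto
  then show thesis using that by blast
qed

subsection \<open>Operators on algebras of bounded sequences\<close>

text \<open>A substitute for C(K) with K compact and totally disconnected. In
  \<open>zero_dim\<close> the factor 2 leaves a gap between the level sets: idempotents separate
  sets at a distance, while the indicator of an exact level set need not lie in X.\<close>

locale function_algebra =
  fixes X :: "(nat \<Rightarrow> real) set"
  assumes bdd: "f \<in> X \<Longrightarrow> \<exists>M. \<forall>k. \<bar>f k\<bar> \<le> M"
    and const: "(\<lambda>k. a) \<in> X"
    and add: "f \<in> X \<Longrightarrow> g \<in> X \<Longrightarrow> (\<lambda>k. f k + g k) \<in> X"
    and mult: "f \<in> X \<Longrightarrow> g \<in> X \<Longrightarrow> (\<lambda>k. f k * g k) \<in> X"
    and abs: "f \<in> X \<Longrightarrow> (\<lambda>k. \<bar>f k\<bar>) \<in> X"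
    and limit: "(\<And>e. e > 0 \<Longrightarrow> \<exists>g\<in>X. \<forall>k. \<bar>f k - g k\<bar> \<le> e) \<Longrightarrow> f \<in> X"
    and zero_dim: "f \<in> X \<Longrightarrow> t > 0 \<Longrightarrow>
      \<exists>A. indicat_real A \<in> X \<and> {k. 2 * t \<le> \<bar>f k\<bar>} \<subseteq> A \<and> A \<subseteq> {k. t \<le> \<bar>f k\<bar>}"
begin

lemma scale: "f \<in> X \<Longrightarrow> (\<lambda>k. a * f k) \<in> X"
  using mult[OF const[of a]] by simp

lemma diff: "f \<in> X \<Longrightarrow> g \<in> X \<Longrightarrow> (\<lambda>k. f k - g k) \<in> X"
  using add[of f "\<lambda>k. (-1) * g k"] scale[of g "-1"] by simp

lemma square: "f \<in> X \<Longrightarrow> (\<lambda>k. (f k)\<^sup>2) \<in> X"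
  using mult[of f f] by (simp add: power2_eq_square)

lemma sum: "(\<And>i. i \<in> I \<Longrightarrow> f i \<in> X) \<Longrightarrow> (\<lambda>k. \<Sum>i\<in>I. f i k) \<in> X"
proof (induction I rule: infinite_finite_induct)
  case (insert i I)
  then show ?case using add[of "f i" "\<lambda>k. \<Sum>i\<in>I. f i k"] by simp
qed (use const[of 0] in auto)

lemma max: "f \<in> X \<Longrightarrow> g \<in> X \<Longrightarrow> (\<lambda>k. max (f k) (g k)) \<in> X"
proof -
  assume fg: "f \<in> X" "g \<in> X"
  have "(\<lambda>k. (1/2) * ((f k + g k) + \<bar>f k - g k\<bar>)) \<in> X"
    by (intro scale add abs diff fg)
  moreover have "(\<lambda>k. (1/2) * ((f k + g k) + \<bar>f k - g k\<bar>)) = (\<lambda>k. max (f k) (g k))"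
    by (auto simp: max_def abs_if)
  ultimately show ?thesis by simp
qed

lemma min: "f \<in> X \<Longrightarrow> g \<in> X \<Longrightarrow> (\<lambda>k. min (f k) (g k)) \<in> X"
proof -
  assume fg: "f \<in> X" "g \<in> X"
  have "(\<lambda>k. (f k + g k) - max (f k) (g k)) \<in> X"
    by (intro diff add max fg)
  moreover have "(\<lambda>k. (f k + g k) - max (f k) (g k)) = (\<lambda>k. min (f k) (g k))"
    by (auto simp: max_def min_def)
  ultimately show ?thesis by simp
qed

definition sets_in :: "nat set set" where
  "sets_in = {A. indicat_real A \<in> X}"

lemma ring_sets_in: "ring_of_sets UNIV sets_in"
  unfolding ring_of_sets_iff
proof (intro conjI ballI)
  have "indicat_real {} = (\<lambda>k::nat. 0)" by (rule ext) simp
  then show "{} \<in> sets_in" using const[of 0] by (simp add: sets_in_def)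
  fix A B assume AB: "A \<in> sets_in" "B \<in> sets_in"
  have "(\<lambda>k. max (indicat_real A k) (indicat_real B k)) \<in> X"
    using AB by (intro max) (auto simp: sets_in_def)
  moreover have "(\<lambda>k. max (indicat_real A k) (indicat_real B k)) = indicat_real (A \<union> B)"
    by (auto simp: indicator_def)
  ultimately show "A \<union> B \<in> sets_in" by (simp add: sets_in_def)
  have "(\<lambda>k. indicat_real A k - indicat_real A k * indicat_real B k) \<in> X"
    using AB by (intro diff mult) (auto simp: sets_in_def)
  moreover have "(\<lambda>k. indicat_real A k - indicat_real A k * indicat_real B k) = indicat_real (A - B)"
    by (auto simp: indicator_def)
  ultimately show "A - B \<in> sets_in" by (simp add: sets_in_def)
qed simp

end

text \<open>For scalar U this is the modulus of U in the sense of Riesz spaces, the integral of h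
  against the total variation. For vector values it is a semivariation and only subadditive.\<close>

definition variation :: "(nat \<Rightarrow> real) set \<Rightarrow> ((nat \<Rightarrow> real) \<Rightarrow> 'f::real_normed_vector) \<Rightarrow> (nat \<Rightarrow> real) \<Rightarrow> real" where
  "variation X U h = (SUP g\<in>{g \<in> X. \<forall>k. \<bar>g k\<bar> \<le> h k}. norm (U g))"

text \<open>The norm of X enters through pointwise bounds M, so that U can act on plain functions
  instead of elements of \<open>l_inf\<close>.\<close>

locale bounded_operator = function_algebra +
  fixes U :: "(nat \<Rightarrow> real) \<Rightarrow> 'f::real_normed_vector" and K :: real
  assumes U_add: "f \<in> X \<Longrightarrow> g \<in> X \<Longrightarrow> U (\<lambda>k. f k + g k) = U f + U g"
    and U_scale: "f \<in> X \<Longrightarrow> U (\<lambda>k. a * f k) = a *\<^sub>R U f"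
    and U_bound: "f \<in> X \<Longrightarrow> (\<And>k. \<bar>f k\<bar> \<le> M) \<Longrightarrow> norm (U f) \<le> K * M"
begin

lemma K_nonneg: "K \<ge> 0"
  using U_bound[OF const[of 1], of 1] norm_ge_zero[of "U (\<lambda>k. 1)"] by (simp del: norm_ge_zero)

lemma U_zero: "U (\<lambda>k. 0) = 0"
  using U_scale[OF const[of 0], of 0] by simp

lemma U_diff: "f \<in> X \<Longrightarrow> g \<in> X \<Longrightarrow> U (\<lambda>k. f k - g k) = U f - U g"
  using U_add[of f "\<lambda>k. (-1) * g k"] scale[of g "-1"] U_scale[of g "-1"] by simp

abbreviation "var \<equiv> variation X U"

lemma variation_bdd: "h \<in> X \<Longrightarrow> bdd_above ((\<lambda>g. norm (U g)) ` {g \<in> X. \<forall>k. \<bar>g k\<bar> \<le> h k})"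
proof -
  assume "h \<in> X"
  then obtain M where "\<And>k. \<bar>h k\<bar> \<le> M" using bdd by blast
  then have "\<bar>g k\<bar> \<le> M" if "\<forall>k. \<bar>g k\<bar> \<le> h k" for g k
    using that by (meson abs_ge_self order_trans)
  then show ?thesis by (intro bdd_aboveI[of _ "K * M"]) (auto intro: U_bound)
qed

lemma variation_ge: "h \<in> X \<Longrightarrow> g \<in> X \<Longrightarrow> (\<And>k. \<bar>g k\<bar> \<le> h k) \<Longrightarrow> norm (U g) \<le> var h"
  unfolding variation_def by (rule cSUP_upper) (auto intro: variation_bdd)

lemma variation_le:
  "(\<And>k. 0 \<le> h k) \<Longrightarrow> (\<And>g. g \<in> X \<Longrightarrow> (\<And>k. \<bar>g k\<bar> \<le> h k) \<Longrightarrow> norm (U g) \<le> c) \<Longrightarrow> var h \<le> c"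
  unfolding variation_def using const[of 0] by (intro cSUP_least) auto

lemma variation_nonneg: "h \<in> X \<Longrightarrow> (\<And>k. 0 \<le> h k) \<Longrightarrow> 0 \<le> var h"
  using variation_ge[of h "\<lambda>k. 0"] const[of 0] by (simp add: U_zero)

lemma variation_bound: "(\<And>k. 0 \<le> h k) \<Longrightarrow> (\<And>k. h k \<le> M) \<Longrightarrow> var h \<le> K * M"
  by (rule variation_le) (auto intro!: U_bound intro: order_trans)

lemma variation_mono:
  assumes "h' \<in> X" "\<And>k. 0 \<le> h k" "\<And>k. h k \<le> h' k"
  shows "var h \<le> var h'"
  by (rule variation_le[OF assms(2)]) (use assms in \<open>auto intro!: variation_ge intro: order_trans\<close>)

text \<open>The Riesz decomposition property: truncating g at height h leaves a remainder below h'.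
  Subadditivity of the variation rests on it.\<close>

lemma clip:
  assumes "g \<in> X" "h \<in> X" "h' \<in> X" "\<And>k. 0 \<le> h k" "\<And>k. 0 \<le> h' k" "\<And>k. \<bar>g k\<bar> \<le> h k + h' k"
  obtains p q where "p \<in> X" "q \<in> X" "\<And>k. \<bar>p k\<bar> \<le> h k" "\<And>k. \<bar>q k\<bar> \<le> h' k" "g = (\<lambda>k. p k + q k)"
proof -
  define p where "p k = max ((-1) * h k) (min (g k) (h k))" for k
  have p: "p \<in> X" unfolding p_def using assms by (intro max min scale) auto
  show thesis
  proof (rule that[OF p])
    show "(\<lambda>k. g k - p k) \<in> X" using assms(1) p by (rule diff)
    show "\<bar>p k\<bar> \<le> h k" for k using assms(4)[of k] by (auto simp: p_def)
    show "\<bar>g k - p k\<bar> \<le> h' k" for k using assms(4-6)[of k] by (auto simp: p_def max_def min_def)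
  qed simp
qed

lemma variation_subadd:
  assumes "h \<in> X" "h' \<in> X" "\<And>k. 0 \<le> h k" "\<And>k. 0 \<le> h' k"
  shows "var (\<lambda>k. h k + h' k) \<le> var h + var h'"
proof (rule variation_le)
  fix g assume g: "g \<in> X" "\<And>k. \<bar>g k\<bar> \<le> h k + h' k"
  obtain p q where pq: "p \<in> X" "q \<in> X" "\<And>k. \<bar>p k\<bar> \<le> h k" "\<And>k. \<bar>q k\<bar> \<le> h' k" "g = (\<lambda>k. p k + q k)"
    using clip[OF g(1) assms g(2)] by metis
  have "norm (U g) \<le> norm (U p) + norm (U q)"
    unfolding pq(5) using pq by (simp add: U_add norm_triangle_ineq)
  also have "\<dots> \<le> var h + var h'" using pq assms by (intro add_mono variation_ge)
  finally show "norm (U g) \<le> var h + var h'" .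
qed (simp add: assms)

lemma submeasure_variation: "submeasure sets_in (\<lambda>A. var (indicat_real A))"
  unfolding submeasure_def
proof (intro conjI ballI impI)
  have "var (indicat_real {}) \<le> K * 0" by (rule variation_bound) auto
  moreover have "indicat_real {} = (\<lambda>k::nat. 0)" by (rule ext) simp
  then have "indicat_real {} \<in> X" using const[of 0] by simp
  ultimately show "var (indicat_real {}) = 0" using variation_nonneg[of "indicat_real {}"] by simp
  fix A B assume AB: "A \<in> sets_in" "B \<in> sets_in"
  show "var (indicat_real A) \<le> var (indicat_real B)" if "A \<subseteq> B"
    using AB that by (intro variation_mono) (auto simp: sets_in_def indicator_def)
  have "var (indicat_real (A \<union> B)) \<le> var (\<lambda>k. indicat_real A k + indicat_real B k)"
  proof (rule variation_mono)
    show "(\<lambda>k. indicat_real A k + indicat_real B k) \<in> X" using AB by (intro add) (auto simp: sets_in_def)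
  qed (auto simp: indicator_def)
  also have "\<dots> \<le> var (indicat_real A) + var (indicat_real B)"
    using AB by (intro variation_subadd) (auto simp: sets_in_def)
  finally show "var (indicat_real (A \<union> B)) \<le> var (indicat_real A) + var (indicat_real B)" .
qed

lemma composed_functional:
  assumes "linear \<phi>" "\<And>y. \<bar>\<phi> y\<bar> \<le> norm y"
  shows "bounded_operator X (\<lambda>f. \<phi> (U f) :: real) K"
proof
  show "norm (\<phi> (U f)) \<le> K * M" if "f \<in> X" "\<And>k. \<bar>f k\<bar> \<le> M" for f M
    using assms(2)[of "U f"] U_bound[OF that] by (simp add: order_trans)
qed (use assms(1) in \<open>auto simp: U_add U_scale linear_add linear_scale\<close>)

end

section \<open>Positive functionals, and the control of an operator by finitely many of them\<close>

definition cone_functional :: "(nat \<Rightarrow> real) set \<Rightarrow> ((nat \<Rightarrow> real) \<Rightarrow> real) \<Rightarrow> bool" where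
  "cone_functional X \<Lambda> \<longleftrightarrow>
     (\<forall>h\<in>X. (\<forall>k. 0 \<le> h k) \<longrightarrow> 0 \<le> \<Lambda> h) \<and>
     (\<forall>h\<in>X. \<forall>h'\<in>X. (\<forall>k. 0 \<le> h k) \<longrightarrow> (\<forall>k. 0 \<le> h' k) \<longrightarrow> \<Lambda> (\<lambda>k. h k + h' k) = \<Lambda> h + \<Lambda> h') \<and>
     (\<forall>c\<ge>0. \<forall>h\<in>X. (\<forall>k. 0 \<le> h k) \<longrightarrow> \<Lambda> (\<lambda>k. c * h k) = c * \<Lambda> h)"

text \<open>Superadditivity needs scalar values: for one of the signs in g + g' and g - g' the
  absolute values of U g and U g' add up.\<close>

lemma cone_functional_variation:
  fixes U :: "(nat \<Rightarrow> real) \<Rightarrow> real"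
  assumes "bounded_operator X U K"
  shows "cone_functional X (variation X U)"
proof -
  interpret bounded_operator X U K by fact
  have super: "var h + var h' \<le> var (\<lambda>k. h k + h' k)"
    if h: "h \<in> X" "h' \<in> X" "\<And>k. 0 \<le> h k" "\<And>k. 0 \<le> h' k" for h h'
  proof -
    have "var h \<le> var (\<lambda>k. h k + h' k) - var h'"
    proof (rule variation_le[OF h(3)])
      fix g assume g: "g \<in> X" "\<And>k. \<bar>g k\<bar> \<le> h k"
      have "var h' \<le> var (\<lambda>k. h k + h' k) - norm (U g)"
      proof (rule variation_le[OF h(4)])
        fix g' assume g': "g' \<in> X" "\<And>k. \<bar>g' k\<bar> \<le> h' k"
        have 1: "norm (U (\<lambda>k. g k + g' k)) \<le> var (\<lambda>k. h k + h' k)"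
          using g g' h by (intro variation_ge add) (auto intro: order_trans[OF abs_triangle_ineq] add_mono)
        have 2: "norm (U (\<lambda>k. g k - g' k)) \<le> var (\<lambda>k. h k + h' k)"
          using g g' h by (intro variation_ge add diff) (auto intro: order_trans[OF abs_triangle_ineq4] add_mono)
        from 1 2 show "norm (U g') \<le> var (\<lambda>k. h k + h' k) - norm (U g)"
          using g(1) g'(1) by (simp add: U_add U_diff abs_if split: if_splits)
      qed
      then show "norm (U g) \<le> var (\<lambda>k. h k + h' k) - var h'" by simp
    qed
    then show ?thesis by simp
  qed
  have scale_le: "var (\<lambda>k. c * h k) \<le> c * var h" if "c > 0" "h \<in> X" "\<And>k. 0 \<le> h k" for c h
  proof (rule variation_le)
    fix g assume g: "g \<in> X" "\<And>k. \<bar>g k\<bar> \<le> c * h k"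
    have "norm (U (\<lambda>k. (1 / c) * g k)) \<le> var h"
    proof (rule variation_ge[OF that(2) scale[OF g(1)]])
      show "\<bar>1 / c * g k\<bar> \<le> h k" for k
        using g(2)[of k] that(1) by (simp add: abs_mult field_simps)
    qed
    then show "norm (U g) \<le> c * var h"
      unfolding U_scale[OF g(1)] using that(1) by (simp add: field_simps)
  qed (use that in simp)
  have scale_eq: "var (\<lambda>k. c * h k) = c * var h" if "c \<ge> 0" "h \<in> X" "\<And>k. 0 \<le> h k" for c h
  proof (cases "c = 0")
    case True
    have "var (\<lambda>k. 0) \<le> K * 0" by (rule variation_bound) auto
    then have "var (\<lambda>k. 0) = 0" using variation_nonneg[OF const[of 0]] by simp
    then show ?thesis using True by simp
  next
    case False
    then have c: "c > 0" using that by simp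
    have "var h = var (\<lambda>k. (1 / c) * (c * h k))" using c by simp
    also have "\<dots> \<le> 1 / c * var (\<lambda>k. c * h k)" using c that by (intro scale_le scale) auto
    finally have "c * var h \<le> var (\<lambda>k. c * h k)" using c by (simp add: field_simps)
    then show ?thesis using scale_le[OF c that(2,3)] by simp
  qed
  show ?thesis
    unfolding cone_functional_def
    using variation_nonneg scale_eq by (auto intro!: antisym super variation_subadd)
qed

lemma cone_functional_sum:
  "(\<And>i. i \<in> I \<Longrightarrow> cone_functional X (\<Lambda> i)) \<Longrightarrow> cone_functional X (\<lambda>h. \<Sum>i\<in>I. \<Lambda> i h)"
  unfolding cone_functional_def by (auto intro!: sum_nonneg simp: sum.distrib sum_distrib_left)

lemma cone_functional_scale:
  "cone_functional X \<Lambda> \<Longrightarrow> a \<ge> 0 \<Longrightarrow> cone_functional X (\<lambda>h. a * \<Lambda> h)"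
  unfolding cone_functional_def by (auto simp: algebra_simps)

text \<open>If no finite set of functionals suffices, composites of U with norming functionals and
  sets can be chosen in turn, each set small for all earlier functionals and large for its own. This
  is the configuration that \<open>exhaustive_small\<close> rules out.\<close>

lemma (in bounded_operator) finitely_many_functionals_control:
  assumes exh: "exhaustive sets_in (\<lambda>A. var (indicat_real A))" and e: "e > 0"
  shows "\<exists>(F :: ((nat \<Rightarrow> real) \<Rightarrow> real) set) \<delta>. finite F \<and> (\<forall>\<nu>\<in>F. bounded_operator X \<nu> K) \<and> \<delta> > 0 \<and>
    (\<forall>A\<in>sets_in. (\<forall>\<nu>\<in>F. variation X \<nu> (indicat_real A) < \<delta>) \<longrightarrow> var (indicat_real A) < e)"
proof (rule ccontr)
  interpret ring_of_sets UNIV sets_in by (rule ring_sets_in)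
  \<comment> \<open>Domination by the norm of U keeps the variations of all candidates below the
    submeasure of U.\<close>
  define D where "D = {\<nu> :: (nat \<Rightarrow> real) \<Rightarrow> real. bounded_operator X \<nu> K \<and> (\<forall>f\<in>X. \<bar>\<nu> f\<bar> \<le> norm (U f))}"
  assume contr: "\<not> ?thesis"
  define P :: "(nat \<Rightarrow> ((nat \<Rightarrow> real) \<Rightarrow> real) \<times> nat set) \<Rightarrow> nat \<Rightarrow> ((nat \<Rightarrow> real) \<Rightarrow> real) \<times> nat set \<Rightarrow> bool"
    where "P f n r \<longleftrightarrow> fst r \<in> D \<and> snd r \<in> sets_in \<and>
      (\<forall>i<n. variation X (fst (f i)) (indicat_real (snd r)) \<le> (1/2) ^ n) \<and>
      e / 2 \<le> variation X (fst r) (indicat_real (snd r))" for f n r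
  have "\<exists>x. \<forall>n. P x n (x n)"
  proof (rule dependent_wellorder_choice)
    fix r and f g :: "nat \<Rightarrow> ((nat \<Rightarrow> real) \<Rightarrow> real) \<times> nat set" and n :: nat
    assume "\<And>y. y < n \<Longrightarrow> f y = g y"
    then show "P f n r = P g n r" by (simp add: P_def)
  next
    fix n and f :: "nat \<Rightarrow> ((nat \<Rightarrow> real) \<Rightarrow> real) \<times> nat set"
    assume f: "\<And>y. y < n \<Longrightarrow> P f y (f y)"
    define F where "F = (\<lambda>i. fst (f i)) ` {..<n}"
    have F: "finite F" "\<forall>\<nu>\<in>F. bounded_operator X \<nu> K" using f by (auto simp: F_def P_def D_def)
    \<comment> \<open>The earlier functionals with the threshold (1/2) ^ n are one of the pairs that
      fail to control e.\<close>
    have "\<exists>A\<in>sets_in. (\<forall>\<nu>\<in>F. variation X \<nu> (indicat_real A) < (1/2) ^ n) \<and> e \<le> var (indicat_real A)"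
    proof (rule ccontr)
      assume "\<not> ?thesis"
      then have "\<forall>A\<in>sets_in. (\<forall>\<nu>\<in>F. variation X \<nu> (indicat_real A) < (1/2) ^ n) \<longrightarrow> var (indicat_real A) < e"
        by (meson not_le)
      moreover have "(1/2::real) ^ n > 0" by simp
      ultimately show False using contr F by blast
    qed
    then obtain A where A: "A \<in> sets_in" "\<And>\<nu>. \<nu> \<in> F \<Longrightarrow> variation X \<nu> (indicat_real A) < (1/2) ^ n"
      "e \<le> var (indicat_real A)" by auto
    have "\<exists>g\<in>X. (\<forall>k. \<bar>g k\<bar> \<le> indicat_real A k) \<and> e / 2 \<le> norm (U g)"
    proof (rule ccontr)
      assume "\<not> ?thesis"
      then have *: "\<forall>g\<in>X. (\<forall>k. \<bar>g k\<bar> \<le> indicat_real A k) \<longrightarrow> norm (U g) < e / 2"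
        by (meson not_le)
      have "var (indicat_real A) \<le> e / 2"
      proof (rule variation_le)
        fix g assume "g \<in> X" "\<And>k. \<bar>g k\<bar> \<le> indicat_real A k"
        with * show "norm (U g) \<le> e / 2" by (meson less_imp_le)
      qed simp
      then show False using A(3) e by simp
    qed
    then obtain g where g: "g \<in> X" "\<And>k. \<bar>g k\<bar> \<le> indicat_real A k" "e / 2 \<le> norm (U g)" by blast
    obtain \<phi> :: "'f \<Rightarrow> real" where \<phi>: "linear \<phi>" "\<And>y. \<bar>\<phi> y\<bar> \<le> norm y" "\<phi> (U g) = norm (U g)"
      using norming_functional by blast
    define \<nu> where "\<nu> f = \<phi> (U f)" for f
    have bo: "bounded_operator X \<nu> K" unfolding \<nu>_def using \<phi>(1,2) by (rule composed_functional)
    then have \<nu>: "\<nu> \<in> D" using \<phi>(2) by (simp add: D_def \<nu>_def)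
    have "norm (\<nu> g) \<le> variation X \<nu> (indicat_real A)"
      using A(1) g(1,2) by (intro bounded_operator.variation_ge[OF bo]) (auto simp: sets_in_def)
    then have "e / 2 \<le> variation X \<nu> (indicat_real A)" using g(3) \<phi>(3) by (simp add: \<nu>_def)
    then have "P f n (\<nu>, A)"
      using A(1) A(2) \<nu> by (auto simp: P_def F_def intro: less_imp_le)
    then show "\<exists>r. P f n r" by blast
  qed
  then obtain x where x: "\<And>n. P x n (x n)" by blast
  define \<nu> where "\<nu> n = fst (x n)" for n
  define A where "A n = snd (x n)" for n
  have \<nu>: "\<nu> n \<in> D" and A: "A n \<in> sets_in" "e / 2 \<le> variation X (\<nu> n) (indicat_real (A n))"
    "i < n \<Longrightarrow> variation X (\<nu> i) (indicat_real (A n)) \<le> (1/2) ^ n" for i n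
    using x[of n] by (auto simp: P_def \<nu>_def A_def)
  have bo: "bounded_operator X (\<nu> n) K" for n using \<nu> by (simp add: D_def)
  have "\<exists>k. variation X (\<nu> k) (indicat_real (A k)) < e / 2"
  proof (rule exhaustive_small[OF submeasure_variation exh, of "\<lambda>k B. variation X (\<nu> k) (indicat_real B)"])
    show "submeasure sets_in (\<lambda>B. variation X (\<nu> k) (indicat_real B))" for k
      by (rule bounded_operator.submeasure_variation[OF bo])
    fix k B assume B: "B \<in> sets_in"
    then have BX: "indicat_real B \<in> X" by (simp add: sets_in_def)
    show "0 \<le> variation X (\<nu> k) (indicat_real B)"
      by (rule bounded_operator.variation_nonneg[OF bo BX]) simp
    show "variation X (\<nu> k) (indicat_real B) \<le> var (indicat_real B)"
    proof (rule bounded_operator.variation_le[OF bo])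
      fix g assume g: "g \<in> X" "\<And>k. \<bar>g k\<bar> \<le> indicat_real B k"
      have "norm (\<nu> k g) \<le> norm (U g)" using \<nu> g(1) by (simp add: D_def)
      also have "\<dots> \<le> var (indicat_real B)" using BX g by (rule variation_ge)
      finally show "norm (\<nu> k g) \<le> var (indicat_real B)" .
    qed simp
  qed (use A e in auto)
  then show False using A(2) by (meson not_less)
qed

text \<open>Chebyshev's inequality. An idempotent A cuts f near the level t. Inside A the modulus of
  f is at least t, so the bound on f^2 makes the controlling variations of A small; outside A the
  modulus is below 2 * t.\<close>

lemma (in bounded_operator) quadratic_control:
  assumes exh: "exhaustive sets_in (\<lambda>A. var (indicat_real A))" and e: "e > 0"
  obtains \<Lambda> where "cone_functional X \<Lambda>"
    "\<And>f. f \<in> X \<Longrightarrow> (\<And>k. \<bar>f k\<bar> \<le> 1) \<Longrightarrow> \<Lambda> (\<lambda>k. (f k)\<^sup>2) \<le> 1 \<Longrightarrow> norm (U f) \<le> e"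
proof -
  from finitely_many_functionals_control[OF exh half_gt_zero[OF e]]
  obtain F :: "((nat \<Rightarrow> real) \<Rightarrow> real) set" and \<delta> where *: "finite F \<and> (\<forall>\<nu>\<in>F. bounded_operator X \<nu> K) \<and> \<delta> > 0 \<and>
    (\<forall>A\<in>sets_in. (\<forall>\<nu>\<in>F. variation X \<nu> (indicat_real A) < \<delta>) \<longrightarrow> var (indicat_real A) < e / 2)"
    by (elim exE)
  then have F: "finite F" "\<nu> \<in> F \<Longrightarrow> bounded_operator X \<nu> K" and \<delta>: "\<delta> > 0" for \<nu> by auto
  have ctrl: "var (indicat_real A) < e / 2"
    if "A \<in> sets_in" "\<And>\<nu>. \<nu> \<in> F \<Longrightarrow> variation X \<nu> (indicat_real A) < \<delta>" for A
    using * that by blast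
  \<comment> \<open>The part of f outside A contributes at most K * 2 * t \<le> e / 2; the summand 1
    covers K = 0. The constant \<open>c\<close> below turns \<Lambda> (f^2) \<le> 1 into the bound
    \<delta> / 2 for each variation of A.\<close>
  define t where "t = e / (4 * (K + 1))"
  have t: "t > 0" "K * (2 * t) \<le> e / 2" using e K_nonneg by (auto simp: t_def field_simps)
  define c where "c = 2 / (t\<^sup>2 * \<delta>)"
  have c: "c > 0" using t \<delta> by (simp add: c_def)
  define \<Lambda> where "\<Lambda> h = c * (\<Sum>\<nu>\<in>F. variation X \<nu> h)" for h
  have cone: "cone_functional X (variation X \<nu>)" if "\<nu> \<in> F" for \<nu>
    using F(2)[OF that] by (rule cone_functional_variation)
  have "cone_functional X \<Lambda>"
    unfolding \<Lambda>_def using c cone by (intro cone_functional_scale cone_functional_sum) auto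
  moreover have "norm (U f) \<le> e" if f: "f \<in> X" "\<And>k. \<bar>f k\<bar> \<le> 1" "\<Lambda> (\<lambda>k. (f k)\<^sup>2) \<le> 1" for f
  proof -
    obtain A where A: "indicat_real A \<in> X" "{k. 2 * t \<le> \<bar>f k\<bar>} \<subseteq> A" "A \<subseteq> {k. t \<le> \<bar>f k\<bar>}"
      using zero_dim[OF f(1) t(1)] by blast
    have "var (indicat_real A) < e / 2"
    proof (rule ctrl)
      show "A \<in> sets_in" using A(1) by (simp add: sets_in_def)
      fix \<nu> assume \<nu>: "\<nu> \<in> F"
      interpret \<nu>: bounded_operator X \<nu> K using F(2)[OF \<nu>] .
      have nonneg: "0 \<le> variation X \<mu> (\<lambda>k. (f k)\<^sup>2)" if "\<mu> \<in> F" for \<mu>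
        using bounded_operator.variation_nonneg[OF F(2)[OF that] square[OF f(1)]] by simp
      have "t\<^sup>2 * variation X \<nu> (indicat_real A) = variation X \<nu> (\<lambda>k. t\<^sup>2 * indicat_real A k)"
        using cone[OF \<nu>] A(1) unfolding cone_functional_def by simp
      also have "\<dots> \<le> variation X \<nu> (\<lambda>k. (f k)\<^sup>2)"
      proof (rule \<nu>.variation_mono)
        show "t\<^sup>2 * indicat_real A k \<le> (f k)\<^sup>2" for k
          using A(3) t(1) by (auto simp: indicator_def abs_le_square_iff[symmetric])
      qed (use f square in auto)
      also have "\<dots> \<le> (\<Sum>\<nu>\<in>F. variation X \<nu> (\<lambda>k. (f k)\<^sup>2))"
        using F(1) \<nu> nonneg by (intro member_le_sum) auto
      also have "\<dots> \<le> 1 / c" using f(3) c by (simp add: \<Lambda>_def field_simps)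
      also have "\<dots> = t\<^sup>2 * (\<delta> / 2)" by (simp add: c_def)
      finally have "variation X \<nu> (indicat_real A) \<le> \<delta> / 2" using t by simp
      then show "variation X \<nu> (indicat_real A) < \<delta>" using \<delta> by simp
    qed
    moreover have "norm (U (\<lambda>k. f k * indicat_real A k)) \<le> var (indicat_real A)"
    proof (rule variation_ge[OF A(1) mult[OF f(1) A(1)]])
      show "\<bar>f k * indicat_real A k\<bar> \<le> indicat_real A k" for k
        using f(2)[of k] by (simp add: indicator_def)
    qed
    moreover have "norm (U (\<lambda>k. f k - f k * indicat_real A k)) \<le> K * (2 * t)"
    proof (rule U_bound)
      show "\<bar>f k - f k * indicat_real A k\<bar> \<le> 2 * t" for k
      proof (cases "k \<in> A")
        case False
        then have "\<not> 2 * t \<le> \<bar>f k\<bar>" using A(2) by blast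
        then show ?thesis using False by simp
      qed (use t in simp)
    qed (use A(1) f in \<open>intro diff mult\<close>)
    moreover have "U (\<lambda>k. f k * indicat_real A k + (f k - f k * indicat_real A k)) =
        U (\<lambda>k. f k * indicat_real A k) + U (\<lambda>k. f k - f k * indicat_real A k)"
      using A(1) f by (intro U_add diff mult)
    then have "norm (U f) \<le> norm (U (\<lambda>k. f k * indicat_real A k)) + norm (U (\<lambda>k. f k - f k * indicat_real A k))"
      by (simp add: norm_triangle_ineq)
    ultimately show ?thesis using t(2) by linarith
  qed
  ultimately show thesis by (rule that)
qed

subsection \<open>Fixed copies of sequence spaces\<close>

lemma isomorphism_onI:
  fixes f :: "'a::real_normed_vector \<Rightarrow> 'b::real_normed_vector"
  assumes S: "subspace S" and add: "\<And>x y. x \<in> S \<Longrightarrow> y \<in> S \<Longrightarrow> f (x + y) = f x + f y"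
    and scale: "\<And>a x. x \<in> S \<Longrightarrow> f (a *\<^sub>R x) = a *\<^sub>R f x"
    and K: "\<And>x. x \<in> S \<Longrightarrow> norm (f x) \<le> K * norm x"
    and c: "c > 0" "\<And>x. x \<in> S \<Longrightarrow> c * norm x \<le> norm (f x)" and R: "f ` S = R"
  shows "isomorphism_on S R f"
proof -
  have inj: "inj_on f S"
  proof (rule inj_onI)
    fix x y assume xy: "x \<in> S" "y \<in> S" "f x = f y"
    have "f (x + (-1) *\<^sub>R y) = f x + (-1) *\<^sub>R f y"
      by (simp only: add[OF xy(1) subspace_scale[OF S xy(2)]] scale[OF xy(2)])
    then have "f (x + (-1) *\<^sub>R y) = 0" using xy(3) by simp
    moreover have "x + (-1) *\<^sub>R y \<in> S" using S xy by (intro subspace_add subspace_scale)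
    ultimately have "c * norm (x - y) \<le> 0" using c(2)[of "x + (-1) *\<^sub>R y"] by simp
    then show "x = y" using c(1) by (simp add: mult_le_0_iff)
  qed
  have inv: "inv_into S f (f x) = x" if "x \<in> S" for x using inj that by (rule inv_into_f_f)
  have "operator_on R (inv_into S f)"
    unfolding operator_on_def R[symmetric] ball_simps(9)
  proof (intro conjI ballI allI)
    fix x y assume xy: "x \<in> S" "y \<in> S"
    then have "inv_into S f (f (x + y)) = x + y" using S by (intro inv subspace_add)
    then show "inv_into S f (f x + f y) = inv_into S f (f x) + inv_into S f (f y)"
      using xy by (simp add: inv add)
  next
    fix a x assume x: "x \<in> S"
    then have "inv_into S f (f (a *\<^sub>R x)) = a *\<^sub>R x" using S by (intro inv subspace_scale)
    then show "inv_into S f (a *\<^sub>R f x) = a *\<^sub>R inv_into S f (f x)" using x by (simp add: inv scale)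
  next
    show "\<exists>K. \<forall>x\<in>S. norm (inv_into S f (f x)) \<le> K * norm (f x)"
      using c by (intro exI[of _ "1 / c"]) (auto simp: inv field_simps)
  qed
  moreover have "operator_on S f" unfolding operator_on_def using add scale K by blast
  ultimately show ?thesis using inj R by (simp add: isomorphism_on_def bij_betw_def)
qed

lemma fixes_copy_ofI:
  fixes V :: "l_inf \<Rightarrow> 'e::banach" and T :: "'e \<Rightarrow> 'f::banach"
  assumes Z: "subspace Z" "closed Z" and add: "\<And>x y. x \<in> Z \<Longrightarrow> y \<in> Z \<Longrightarrow> V (x + y) = V x + V y"
    and scale: "\<And>a x. x \<in> Z \<Longrightarrow> V (a *\<^sub>R x) = a *\<^sub>R V x"
    and K: "\<And>x. x \<in> Z \<Longrightarrow> norm (V x) \<le> K * norm x"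
    and c: "c > 0" "\<And>x. x \<in> Z \<Longrightarrow> c * norm x \<le> norm (T (V x))" and T: "bounded_linear T"
  shows "fixes_copy_of Z T"
proof -
  interpret T: bounded_linear T by (rule T)
  obtain L where L: "L > 0" "\<And>y. norm (T y) \<le> norm y * L" using T.pos_bounded by blast
  have below: "c / L * norm x \<le> norm (V x)" if "x \<in> Z" for x
    using order_trans[OF c(2)[OF that] L(2)] L(1) by (simp add: field_simps)
  have K': "norm (V x) \<le> (\<bar>K\<bar> + 1) * norm x" if "x \<in> Z" for x
  proof -
    have "K * norm x \<le> (\<bar>K\<bar> + 1) * norm x" by (intro mult_right_mono) auto
    with K[OF that] show ?thesis by linarith
  qed
  have cL: "c / L > 0" using c L by simp
  have isoV: "isomorphism_on Z (V ` Z) V"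
    using Z(1) add scale K cL below by (rule isomorphism_onI) auto
  then have inv: "inv_into Z V (V x) = x" if "x \<in> Z" for x
    using that by (auto simp: isomorphism_on_def bij_betw_def inv_into_f_f)
  have sub: "subspace (V ` Z)"
    unfolding subspace_def
  proof (intro conjI ballI allI)
    have "V 0 = 0" using scale[of 0 0] Z(1) by (simp add: subspace_0)
    then show "0 \<in> V ` Z" using Z(1) subspace_0 by force
    fix u v assume "u \<in> V ` Z" "v \<in> V ` Z"
    then obtain x y where xy: "x \<in> Z" "y \<in> Z" "u = V x" "v = V y" by blast
    then have "u + v = V (x + y)" by (simp add: add)
    then show "u + v \<in> V ` Z" using xy Z(1) by (auto simp: subspace_add)
  next
    fix a u assume "u \<in> V ` Z"
    then obtain x where x: "x \<in> Z" "u = V x" by blast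
    then have "a *\<^sub>R u = V (a *\<^sub>R x)" by (simp add: scale)
    then show "a *\<^sub>R u \<in> V ` Z" using x Z(1) by (auto simp: subspace_scale)
  qed
  have Vdiff: "V (x - y) = V x - V y" if "x \<in> Z" "y \<in> Z" for x y
    using add[of x "(-1) *\<^sub>R y"] scale[of y "-1"] that Z(1) by (simp add: subspace_neg)
  have "closed (V ` Z)"
    unfolding closed_sequential_limits
  proof (intro allI impI, elim conjE)
    fix s l assume s: "\<forall>n. s n \<in> V ` Z" "s \<longlonglongrightarrow> l"
    have "\<forall>n. \<exists>x. x \<in> Z \<and> s n = V x" using s(1) by blast
    from choice[OF this] obtain x where x: "\<And>n. x n \<in> Z" "\<And>n. s n = V (x n)" by auto
    have "Cauchy x"
    proof (rule CauchyI)
      fix e :: real assume "e > 0"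
      then have "e * (c / L) > 0" using cL by (rule mult_pos_pos)
      then obtain M where M: "\<And>m n. m \<ge> M \<Longrightarrow> n \<ge> M \<Longrightarrow> norm (s m - s n) < e * (c / L)"
        using LIMSEQ_imp_Cauchy[OF s(2)] CauchyD by blast
      have "norm (x m - x n) < e" if "m \<ge> M" "n \<ge> M" for m n
      proof -
        have "c / L * norm (x m - x n) \<le> norm (V (x m - x n))" using x Z(1) by (intro below subspace_diff)
        also have "\<dots> = norm (s m - s n)" using x by (simp add: Vdiff)
        also have "\<dots> < e * (c / L)" using M that by blast
        finally have "c / L * norm (x m - x n) < c / L * e" by (simp add: mult.commute)
        then show ?thesis using cL by (simp only: mult_less_cancel_left_pos)
      qed
      then show "\<exists>M. \<forall>m\<ge>M. \<forall>n\<ge>M. norm (x m - x n) < e" by blast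
    qed
    then obtain z where z: "z \<in> Z" "x \<longlonglongrightarrow> z"
      using complete_l_inf[OF Z(2)] x(1) unfolding complete_def by blast
    have "s \<longlonglongrightarrow> V z"
    proof (rule LIM_zero_cancel, rule tendsto_norm_zero_cancel)
      have lim: "(\<lambda>n. (\<bar>K\<bar> + 1) * norm (x n - z)) \<longlonglongrightarrow> 0"
        using tendsto_mult_left[OF tendsto_norm_zero[OF LIM_zero[OF z(2)]], of "\<bar>K\<bar> + 1"] by simp
      show "(\<lambda>n. norm (s n - V z)) \<longlonglongrightarrow> 0"
      proof (rule tendsto_sandwich[OF _ _ tendsto_const lim])
        have "norm (s n - V z) \<le> (\<bar>K\<bar> + 1) * norm (x n - z)" for n
          using K'[of "x n - z"] x z(1) Z(1) by (simp add: Vdiff subspace_diff)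
        then show "\<forall>\<^sub>F n in sequentially. norm (s n - V z) \<le> (\<bar>K\<bar> + 1) * norm (x n - z)" by simp
      qed simp
    qed
    then show "l \<in> V ` Z" using s(2) LIMSEQ_unique z(1) by blast
  qed
  moreover have "isomorphism_on (V ` Z) Z (inv_into Z V)"
  proof (rule isomorphism_onI[OF sub])
    fix u v assume "u \<in> V ` Z" "v \<in> V ` Z"
    then show "inv_into Z V (u + v) = inv_into Z V u + inv_into Z V v"
      using isoV unfolding isomorphism_on_def operator_on_def by blast
  next
    fix a u assume "u \<in> V ` Z"
    then show "inv_into Z V (a *\<^sub>R u) = a *\<^sub>R inv_into Z V u"
      using isoV unfolding isomorphism_on_def operator_on_def by blast
  next
    fix u assume "u \<in> V ` Z"
    then obtain x where x: "x \<in> Z" "u = V x" by blast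
    then show "norm (inv_into Z V u) \<le> (L / c) * norm u"
      using below[of x] c L by (simp add: inv field_simps)
    have "norm u \<le> norm x * (\<bar>K\<bar> + 1)" using x K'[of x] by (simp add: mult.commute)
    then show "1 / (\<bar>K\<bar> + 1) * norm u \<le> norm (inv_into Z V u)"
      using x by (simp add: inv field_simps)
  next
    show "inv_into Z V ` V ` Z = Z" using inv by force
  qed simp
  moreover have "isomorphism_on (V ` Z) (T ` V ` Z) T"
  proof (rule isomorphism_onI[OF sub])
    show "norm (T u) \<le> L * norm u" for u using L(2)[of u] by (simp add: mult.commute)
    show "c / (\<bar>K\<bar> + 1) > 0" using c(1) by (simp add: divide_pos_pos)
    fix u assume "u \<in> V ` Z"
    then obtain x where x: "x \<in> Z" "u = V x" by blast
    have "c / (\<bar>K\<bar> + 1) * norm u \<le> c / (\<bar>K\<bar> + 1) * ((\<bar>K\<bar> + 1) * norm x)"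
      using K'[OF x(1)] c(1) x(2) by (intro mult_left_mono) auto
    also have "\<dots> = c * norm x" by (simp add: field_simps)
    also have "\<dots> \<le> norm (T u)" using c(2) x by simp
    finally show "c / (\<bar>K\<bar> + 1) * norm u \<le> norm (T u)" .
  qed (auto simp: T.add T.scaleR)
  ultimately show ?thesis
    using sub unfolding fixes_copy_of_def isomorphic_subspaces_def by blast
qed

text \<open>For disjoint A n supporting f n, this is the pointwise sum of all a n * f n, which
  exists even if the series does not converge uniformly. The chosen index depends on k and A alone,
  which makes the construction linear in a.\<close>

definition glue :: "(nat \<Rightarrow> nat set) \<Rightarrow> (nat \<Rightarrow> nat \<Rightarrow> real) \<Rightarrow> (nat \<Rightarrow> real) \<Rightarrow> nat \<Rightarrow> real" where
  "glue A f a k = (if \<exists>n. k \<in> A n then a (SOME n. k \<in> A n) * f (SOME n. k \<in> A n) k else 0)"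

lemma glue_eq:
  assumes "disjoint_family A" "k \<in> A n"
  shows "glue A f a k = a n * f n k"
proof -
  have "(SOME n. k \<in> A n) = n"
    using assms unfolding disjoint_family_on_def by (intro some_equality) blast+
  then show ?thesis using assms by (auto simp: glue_def)
qed

lemma glue_outside: "k \<notin> (\<Union>n. A n) \<Longrightarrow> glue A f a k = 0"
  by (auto simp: glue_def)

lemma glue_add: "glue A f (\<lambda>n. a n + b n) = (\<lambda>k. glue A f a k + glue A f b k)"
  by (auto simp: glue_def algebra_simps)

lemma glue_scale: "glue A f (\<lambda>n. c * a n) = (\<lambda>k. c * glue A f a k)"
  by (auto simp: glue_def algebra_simps)

lemma glue_le:
  assumes "\<And>n k. \<bar>f n k\<bar> \<le> indicat_real (A n) k" "\<And>n. \<bar>a n\<bar> \<le> M"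
  shows "\<bar>glue A f a k\<bar> \<le> M"
proof -
  have "\<bar>a n * f n k\<bar> \<le> M" for n
  proof -
    have "\<bar>f n k\<bar> \<le> 1" using assms(1)[of n k] by (cases "k \<in> A n") auto
    then have "\<bar>a n\<bar> * \<bar>f n k\<bar> \<le> \<bar>a n\<bar> * 1" by (intro mult_left_mono) auto
    then show ?thesis using assms(2)[of n] by (simp add: abs_mult)
  qed
  moreover have "M \<ge> 0" using assms(2)[of 0] by linarith
  ultimately show ?thesis by (auto simp: glue_def)
qed

lemma bcontfun_nat: "f \<in> bcontfun \<longleftrightarrow> (\<exists>M. \<forall>k. \<bar>f k\<bar> \<le> M)" for f :: "nat \<Rightarrow> real"
  unfolding bcontfun_def bounded_iff by (auto simp: continuous_on_discrete)

text \<open>What c_0 and l_inf share as spaces of coefficients. With \<open>spread\<close>, a glued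
  sum over a subsequence can be read as a glued sum over the whole sequence, with zeros in the other
  places.\<close>

locale sequence_space =
  fixes Z :: "l_inf set"
  assumes Z: "subspace Z" "closed Z" "c0_space \<subseteq> Z"
    and spread: "x \<in> Z \<Longrightarrow> strict_mono e \<Longrightarrow>
      \<exists>y\<in>Z. (\<forall>j\<in>J. apply_bcontfun y (e j) = apply_bcontfun x j) \<and> (\<forall>n. n \<notin> e ` J \<longrightarrow> apply_bcontfun y n = 0)"

text \<open>Disjoint sets on which T U stays large carry functions f n whose images are large at
  norming functionals. Rosenthal's lemma thins the sequence until, at each of these functionals, all
  other functions together contribute little; glued sums are then bounded below by the supremum of
  their coefficients.\<close>

theorem fixes_copy:
  fixes U :: "(nat \<Rightarrow> real) \<Rightarrow> 'e::banach" and T :: "'e \<Rightarrow> 'g::banach"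
  assumes U: "bounded_operator X U K" and T: "bounded_linear T" and TU: "bounded_operator X (\<lambda>f. T (U f)) L"
    and not_exh: "\<not> exhaustive (function_algebra.sets_in X) (\<lambda>A. variation X (\<lambda>f. T (U f)) (indicat_real A))"
    and Z: "sequence_space Z"
    and glue: "\<And>A f x. disjoint_family A \<Longrightarrow> (\<And>n. f n \<in> X) \<Longrightarrow>
      (\<And>n k. \<bar>f n k\<bar> \<le> indicat_real (A n) k) \<Longrightarrow> x \<in> Z \<Longrightarrow> glue A f (apply_bcontfun x) \<in> X"
  shows "fixes_copy_of Z T"
proof -
  interpret bounded_operator X U K by (rule U)
  interpret Z: sequence_space Z by (rule Z)
  interpret TU: bounded_operator X "\<lambda>f. T (U f)" L by (rule TU)
  interpret T: bounded_linear T by (rule T)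
  from not_exh have "\<exists>(A :: nat \<Rightarrow> nat set) \<delta>. \<delta> > 0 \<and> (range A \<subseteq> sets_in \<and> disjoint_family A) \<and>
      (\<forall>n. \<delta> \<le> TU.var (indicat_real (A n)))"
    unfolding exhaustive_def not_all not_imp not_ex not_less .
  then obtain A :: "nat \<Rightarrow> nat set" and \<delta> where \<delta>: "\<delta> > 0" and A: "range A \<subseteq> sets_in" "disjoint_family A"
    and "\<forall>n. \<delta> \<le> TU.var (indicat_real (A n))" by (elim exE conjE)
  then have large: "\<delta> \<le> TU.var (indicat_real (A n))" for n by simp
  have "\<exists>g\<in>X. (\<forall>k. \<bar>g k\<bar> \<le> indicat_real (A n) k) \<and> \<delta> / 2 \<le> norm (T (U g))" for n
  proof (rule ccontr)
    assume "\<not> ?thesis"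
    then have *: "\<forall>g\<in>X. (\<forall>k. \<bar>g k\<bar> \<le> indicat_real (A n) k) \<longrightarrow> norm (T (U g)) < \<delta> / 2"
      by (meson not_le)
    have "TU.var (indicat_real (A n)) \<le> \<delta> / 2"
    proof (rule TU.variation_le)
      fix g assume "g \<in> X" "\<And>k. \<bar>g k\<bar> \<le> indicat_real (A n) k"
      with * show "norm (T (U g)) \<le> \<delta> / 2" by (meson less_imp_le)
    qed simp
    then show False using large[of n] \<delta> by simp
  qed
  then have "\<forall>n. \<exists>g. g \<in> X \<and> (\<forall>k. \<bar>g k\<bar> \<le> indicat_real (A n) k) \<and> \<delta> / 2 \<le> norm (T (U g))" by blast
  from choice[OF this] obtain f where f: "\<And>n. f n \<in> X" "\<And>n k. \<bar>f n k\<bar> \<le> indicat_real (A n) k"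
    "\<And>n. \<delta> / 2 \<le> norm (T (U (f n)))" by auto
  have "\<forall>n. \<exists>\<phi> :: 'g \<Rightarrow> real. linear \<phi> \<and> (\<forall>y. \<bar>\<phi> y\<bar> \<le> norm y) \<and> \<phi> (T (U (f n))) = norm (T (U (f n)))"
    using norming_functional by metis
  from choice[OF this] obtain \<phi> :: "nat \<Rightarrow> 'g \<Rightarrow> real" where \<phi>: "\<And>n. linear (\<phi> n)"
    "\<And>n y. \<bar>\<phi> n y\<bar> \<le> norm y" "\<And>n. \<phi> n (T (U (f n))) = norm (T (U (f n)))" by auto
  define \<nu> where "\<nu> n g = \<phi> n (T (U g))" for n g
  have \<nu>: "bounded_operator X (\<nu> n) L" for n
    unfolding \<nu>_def using \<phi>(1,2) by (rule TU.composed_functional)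
  let ?g = "\<lambda>x. glue A f (apply_bcontfun x)"
  have gX: "?g x \<in> X" if "x \<in> Z" for x using A(2) f(1,2) that by (rule glue)
  have g_le: "\<bar>?g x k\<bar> \<le> norm x" for x k
    using f(2) norm_bounded[of x] by (intro glue_le) auto
  have \<nu>g_le: "\<bar>\<nu> n (?g x)\<bar> \<le> L * norm x" if "x \<in> Z" for n x
    using bounded_operator.U_bound[OF \<nu> gX[OF that] g_le] by simp
  have g_add: "?g (x + y) = (\<lambda>k. ?g x k + ?g y k)" and g_diff: "?g (x - y) = (\<lambda>k. ?g x k - ?g y k)"
    and g_scale: "?g (a *\<^sub>R x) = (\<lambda>k. a * ?g x k)" for x y a
    using glue_add[of A f "apply_bcontfun x" "apply_bcontfun y"]
      glue_add[of A f "apply_bcontfun x" "\<lambda>n. (-1) * apply_bcontfun y n"]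
      glue_scale[of A f "-1" "apply_bcontfun y"] glue_scale[of A f a "apply_bcontfun x"]
    by simp_all
  define B where "B M = {x \<in> Z. norm x \<le> 1 \<and> (\<forall>n. n \<notin> M \<longrightarrow> apply_bcontfun x n = 0)}" for M
  \<comment> \<open>A supremum over coefficient sequences and not a sum over n: for l_inf the value
    of \<nu> k at a glued function is not determined by its values at the single f n.\<close>
  define m where "m k M = (SUP x\<in>B M. \<bar>\<nu> k (?g x)\<bar>)" for k M
  have B0: "0 \<in> B M" for M using Z.Z(1) by (simp add: B_def subspace_0)
  have \<nu>B: "\<bar>\<nu> k (?g x)\<bar> \<le> L" if "x \<in> B M" for k x M
  proof -
    have "L * norm x \<le> L * 1" using that TU.K_nonneg by (intro mult_left_mono) (auto simp: B_def)
    then show ?thesis using \<nu>g_le[of x k] that by (simp add: B_def)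
  qed
  have bddB: "bdd_above ((\<lambda>x. \<bar>\<nu> k (?g x)\<bar>) ` B M)" for k M
    using \<nu>B by (intro bdd_aboveI[of _ L]) auto
  have m_ge: "\<bar>\<nu> k (?g x)\<bar> \<le> m k M" if "x \<in> B M" for x k M
    unfolding m_def using that bddB by (rule cSUP_upper)
  have m_le: "m k M \<le> r" if "\<And>x. x \<in> B M \<Longrightarrow> \<bar>\<nu> k (?g x)\<bar> \<le> r" for k M r
    unfolding m_def using B0[of M] that by (intro cSUP_least) auto
  \<comment> \<open>For disjoint supports x + y and x - y both stay in the unit ball, and for one of
    the signs the absolute values add up.\<close>
  have super: "m k M + m k N \<le> m k (M \<union> N)" if MN: "M \<inter> N = {}" for k M N
  proof -
    interpret \<nu>: bounded_operator X "\<nu> k" L by (rule \<nu>)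
    have "m k M \<le> m k (M \<union> N) - m k N"
    proof (rule m_le)
      fix x assume x: "x \<in> B M"
      have "m k N \<le> m k (M \<union> N) - \<bar>\<nu> k (?g x)\<bar>"
      proof (rule m_le)
        fix y assume y: "y \<in> B N"
        have xy: "x \<in> Z" "y \<in> Z" using x y by (auto simp: B_def)
        have "norm (apply_bcontfun x n) \<le> 1" "norm (apply_bcontfun y n) \<le> 1" for n
          using x y norm_bounded[of x n] norm_bounded[of y n] by (auto simp: B_def)
        moreover have "apply_bcontfun x n = 0 \<or> apply_bcontfun y n = 0" for n
          using x y MN by (auto simp: B_def)
        ultimately have "norm (apply_bcontfun (x + y) n) \<le> 1" "norm (apply_bcontfun (x - y) n) \<le> 1" for n
          by (metis add.right_neutral add_0 diff_0_right diff_0 norm_minus_cancel plus_bcontfun.rep_eq minus_bcontfun.rep_eq)+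
        then have "norm (x + y) \<le> 1" "norm (x - y) \<le> 1" by (auto intro: norm_bound)
        then have "x + y \<in> B (M \<union> N)" "x - y \<in> B (M \<union> N)"
          using x y Z.Z(1) by (auto simp: B_def subspace_add subspace_diff)
        then have "\<bar>\<nu> k (?g (x + y))\<bar> \<le> m k (M \<union> N)" "\<bar>\<nu> k (?g (x - y))\<bar> \<le> m k (M \<union> N)"
          using m_ge[of "x + y" "M \<union> N" k] m_ge[of "x - y" "M \<union> N" k] by blast+
        then show "\<bar>\<nu> k (?g y)\<bar> \<le> m k (M \<union> N) - \<bar>\<nu> k (?g x)\<bar>"
          unfolding g_add g_diff using xy gX
          by (simp add: \<nu>.U_add \<nu>.U_diff abs_if split: if_splits)
      qed
      then show "\<bar>\<nu> k (?g x)\<bar> \<le> m k (M \<union> N) - m k N" by simp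
    qed
    then show ?thesis by simp
  qed
  have m_nonneg: "0 \<le> m k M" for k M
    using order_trans[OF abs_ge_zero m_ge[OF B0]] .
  have m_bound: "m k UNIV \<le> L" for k by (rule m_le) (rule \<nu>B)
  \<comment> \<open>The tolerance \<delta> / 4 is half of the lower bound \<delta> / 2 for the
    diagonal values \<nu> k (f k).\<close>
  obtain M where M: "infinite M" "\<And>k. k \<in> M \<Longrightarrow> m k (M - {k}) < \<delta> / 4"
    using rosenthal_disjointness[of m L "\<delta> / 4"] m_nonneg super m_bound \<delta> by (metis divide_pos_pos zero_less_numeral)
  define e where "e = enumerate M"
  have e: "strict_mono e" "range e = M"
    using M(1) by (auto simp: e_def strict_mono_enumerate range_enumerate)
  then have inj: "e i = e j \<longleftrightarrow> i = j" for i j by (simp add: strict_mono_eq)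
  have Ae: "disjoint_family (\<lambda>j. A (e j))"
    using A(2) by (auto simp: disjoint_family_on_def inj)
  let ?h = "\<lambda>x. glue (\<lambda>j. A (e j)) (\<lambda>j. f (e j)) (apply_bcontfun x)"
  have hX: "?h x \<in> X" if "x \<in> Z" for x using Ae f(1,2) that by (rule glue)
  have h_le: "\<bar>?h x k\<bar> \<le> norm x" for x k
    using f(2) norm_bounded[of x] by (intro glue_le) auto
  have h_add: "?h (x + y) = (\<lambda>k. ?h x k + ?h y k)" and h_scale: "?h (a *\<^sub>R x) = (\<lambda>k. a * ?h x k)" for x y a
    using glue_add[of "\<lambda>j. A (e j)" "\<lambda>j. f (e j)" "apply_bcontfun x" "apply_bcontfun y"]
      glue_scale[of "\<lambda>j. A (e j)" "\<lambda>j. f (e j)" a "apply_bcontfun x"]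
    by simp_all
  have lower: "\<delta> / 4 * norm x \<le> norm (T (U (?h x)))" if x: "x \<in> Z" for x
  proof (cases "x = 0")
    case False
    then have nx: "norm x > 0" by simp
    have "norm (apply_bcontfun x j) \<le> (norm (T (U (?h x))) + \<delta> / 4 * norm x) * (2 / \<delta>)" for j
    proof -
      define k where "k = e j"
      obtain y where y: "y \<in> Z" "\<forall>i\<in>- {j}. apply_bcontfun y (e i) = apply_bcontfun x i"
        "\<forall>n. n \<notin> e ` (- {j}) \<longrightarrow> apply_bcontfun y n = 0"
        using Z.spread[OF x e(1)] by blast
      have ek: "e ` (- {j}) = M - {k}" unfolding e(2)[symmetric] k_def using inj by auto
      have "norm (apply_bcontfun y n) \<le> norm x" for n
      proof (cases "n \<in> e ` (- {j})")
        case True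
        then obtain i where "i \<in> - {j}" "n = e i" by blast
        then show ?thesis using y(2) norm_bounded[of x i] by simp
      qed (use y(3) in simp)
      then have ny: "norm y \<le> norm x" by (rule norm_bound)
      \<comment> \<open>The k-th function is split off. The other coefficients are moved to the
        original indices and vanish at k, so that the bound for M - {k} applies to them.\<close>
      have split: "?h x = (\<lambda>n. apply_bcontfun x j * f k n + ?g y n)"
      proof
        fix n
        have "?g y n = apply_bcontfun y i * f i n" if "n \<in> A i" for i
          using A(2) that by (rule glue_eq)
        moreover have "?h x n = apply_bcontfun x i * f (e i) n" if "n \<in> A (e i)" for i
          using Ae that by (rule glue_eq)
        moreover have "f k n = 0" if "n \<notin> A k" using f(2)[of k n] that by simp
        moreover have "n \<notin> A i" if "n \<in> A i'" "i \<noteq> i'" for i i'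
          using A(2) that unfolding disjoint_family_on_def by blast
        moreover have "?h x n = 0" if "\<And>i. n \<notin> A (e i)" using that by (intro glue_outside) auto
        moreover have "?g y n = 0" if "\<And>i. n \<notin> A i" using that by (intro glue_outside) auto
        ultimately have facts: "\<And>i. n \<in> A i \<Longrightarrow> ?g y n = apply_bcontfun y i * f i n"
          "\<And>i. n \<in> A (e i) \<Longrightarrow> ?h x n = apply_bcontfun x i * f (e i) n"
          "n \<notin> A k \<Longrightarrow> f k n = 0" "\<And>i i'. n \<in> A i' \<Longrightarrow> i \<noteq> i' \<Longrightarrow> n \<notin> A i"
          "(\<And>i. n \<notin> A (e i)) \<Longrightarrow> ?h x n = 0" "(\<And>i. n \<notin> A i) \<Longrightarrow> ?g y n = 0" by blast+
        show "?h x n = apply_bcontfun x j * f k n + ?g y n"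
        proof (cases "\<exists>i. n \<in> A i")
          case True
          then obtain i where i: "n \<in> A i" by blast
          show ?thesis
          proof (cases "i \<in> M")
            case True
            then obtain i' where i': "i = e i'" using e(2) by blast
            show ?thesis
            proof (cases "i' = j")
              case True
              have "k \<notin> e ` (- {j})" using ek by blast
              then have "apply_bcontfun y k = 0" using y(3) by blast
              then show ?thesis using True facts(1)[OF i] facts(2)[of j] i i' by (simp add: k_def)
            next
              case False
              then have "n \<notin> A k" using facts(4)[OF i, of k] i' inj by (auto simp: k_def)
              then show ?thesis using facts(1)[OF i] facts(2)[of i'] facts(3) y(2) i i' False by simp
            qed
          next
            case False
            then have "i \<notin> e ` (- {j})" using e(2) by auto
            then have "apply_bcontfun y i = 0" using y(3) by blast
            moreover have "n \<notin> A (e i')" for i' using facts(4)[OF i, of "e i'"] False e(2) by blast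
            ultimately show ?thesis using facts(1)[OF i] facts(3) facts(5) by (simp add: k_def)
          qed
        next
          case False
          then show ?thesis using facts(3,5,6) by simp
        qed
      qed
      interpret \<nu>: bounded_operator X "\<nu> k" L by (rule \<nu>)
      have "(1 / norm x) *\<^sub>R y \<in> B (M - {k})"
        using y ny nx Z.Z(1) ek by (auto simp: B_def subspace_scale divide_simps)
      then have "\<bar>\<nu> k (?g ((1 / norm x) *\<^sub>R y))\<bar> \<le> m k (M - {k})" by (rule m_ge)
      also have "\<dots> \<le> \<delta> / 4" using M(2)[of k] e(2) by (auto simp: k_def intro: less_imp_le)
      finally have "\<bar>\<nu> k (?g y)\<bar> \<le> \<delta> / 4 * norm x"
        unfolding g_scale \<nu>.U_scale[OF gX[OF y(1)]] using nx by (simp add: abs_mult field_simps)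
      moreover have "\<nu> k (?h x) = apply_bcontfun x j * \<nu> k (f k) + \<nu> k (?g y)"
        unfolding split using f(1) gX[OF y(1)] by (simp add: \<nu>.U_add \<nu>.U_scale scale)
      moreover have "\<bar>\<nu> k (?h x)\<bar> \<le> norm (T (U (?h x)))" unfolding \<nu>_def by (rule \<phi>(2))
      moreover have "\<bar>apply_bcontfun x j\<bar> * (\<delta> / 2) \<le> \<bar>apply_bcontfun x j * \<nu> k (f k)\<bar>"
        unfolding abs_mult using f(3)[of k] \<phi>(3)[of k] by (intro mult_left_mono) (auto simp: \<nu>_def)
      ultimately have "\<bar>apply_bcontfun x j\<bar> * (\<delta> / 2) \<le> norm (T (U (?h x))) + \<delta> / 4 * norm x"
        by linarith
      then show ?thesis using \<delta> by (simp add: field_simps)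
    qed
    \<comment> \<open>The supremum over j comes first; then \<delta> / 4 * norm x is absorbed by the
      left-hand side \<delta> / 2 * norm x.\<close>
    then have "norm x \<le> (norm (T (U (?h x))) + \<delta> / 4 * norm x) * (2 / \<delta>)" by (rule norm_bound)
    then show ?thesis using \<delta> by (simp add: field_simps)
  qed simp
  show ?thesis
  proof (rule fixes_copy_ofI[OF Z.Z(1,2), of "\<lambda>x. U (?h x)"])
    show "U (?h (x + y)) = U (?h x) + U (?h y)" if "x \<in> Z" "y \<in> Z" for x y
      unfolding h_add using that by (intro U_add hX)
    show "U (?h (a *\<^sub>R x)) = a *\<^sub>R U (?h x)" if "x \<in> Z" for a x
      unfolding h_scale using that by (intro U_scale hX)
    show "norm (U (?h x)) \<le> K * norm x" if "x \<in> Z" for x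
      using hX[OF that] h_le by (rule U_bound)
    show "\<delta> / 4 > 0" using \<delta> by simp
  qed (use lower T in auto)
qed

subsection \<open>Exhaustive operators\<close>

lemma cone_functionalD:
  assumes "cone_functional X \<Lambda>" "h \<in> X" "\<And>k. 0 \<le> h k"
  shows "0 \<le> \<Lambda> h" "c \<ge> 0 \<Longrightarrow> \<Lambda> (\<lambda>k. c * h k) = c * \<Lambda> h"
    "h' \<in> X \<Longrightarrow> (\<And>k. 0 \<le> h' k) \<Longrightarrow> \<Lambda> (\<lambda>k. h k + h' k) = \<Lambda> h + \<Lambda> h'"
  using assms unfolding cone_functional_def by blast+

text \<open>An inner product built from \<Lambda> has integrands of both signs, so \<Lambda> is
  extended from the cone to differences of positive functions; \<open>key\<close> says that the
  choice of the difference is immaterial.\<close>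

lemma (in function_algebra) cone_functional_linear_extension:
  assumes "cone_functional X \<Lambda>"
  obtains L where "\<And>f g. f \<in> X \<Longrightarrow> g \<in> X \<Longrightarrow> L (\<lambda>k. f k + g k) = L f + L g"
    "\<And>a f. f \<in> X \<Longrightarrow> L (\<lambda>k. a * f k) = a * L f"
    "\<And>h. h \<in> X \<Longrightarrow> (\<And>k. 0 \<le> h k) \<Longrightarrow> L h = \<Lambda> h"
proof -
  have add\<Lambda>: "\<Lambda> (\<lambda>k. h k + h' k) = \<Lambda> h + \<Lambda> h'"
    if "h \<in> X" "h' \<in> X" "\<And>k. 0 \<le> h k" "\<And>k. 0 \<le> h' k" for h h'
    using assms that unfolding cone_functional_def by blast
  have scale\<Lambda>: "\<Lambda> (\<lambda>k. c * h k) = c * \<Lambda> h" if "c \<ge> 0" "h \<in> X" "\<And>k. 0 \<le> h k" for c h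
    using assms that unfolding cone_functional_def by blast
  define p where "p f k = max (f k) 0" for f :: "nat \<Rightarrow> real" and k
  define n where "n f k = max (- f k) 0" for f :: "nat \<Rightarrow> real" and k
  have pn: "p f \<in> X" "n f \<in> X" "0 \<le> p f k" "0 \<le> n f k" "p f k - n f k = f k" if "f \<in> X" for f k
    using max[OF that const[of 0]] max[OF scale[OF that, of "-1"] const[of 0]]
    by (auto simp: p_def[abs_def] n_def[abs_def])
  define L where "L f = \<Lambda> (p f) - \<Lambda> (n f)" for f
  have key: "L f = \<Lambda> u - \<Lambda> v"
    if "u \<in> X" "v \<in> X" "\<And>k. 0 \<le> u k" "\<And>k. 0 \<le> v k" "f \<in> X" "\<And>k. f k = u k - v k" for f u v
  proof -
    have "p f k + v k = n f k + u k" for k using pn(5)[OF that(5), of k] that(6)[of k] by simp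
    then have "\<Lambda> (\<lambda>k. p f k + v k) = \<Lambda> (\<lambda>k. n f k + u k)" by presburger
    then have "\<Lambda> (p f) + \<Lambda> v = \<Lambda> (n f) + \<Lambda> u"
      using add\<Lambda>[OF pn(1)[OF that(5)] that(2) pn(3)[OF that(5)] that(4)]
        add\<Lambda>[OF pn(2)[OF that(5)] that(1) pn(4)[OF that(5)] that(3)] by simp
    then show ?thesis by (simp add: L_def)
  qed
  show thesis
  proof (rule that[of L])
    fix f g assume fg: "f \<in> X" "g \<in> X"
    have "L (\<lambda>k. f k + g k) = \<Lambda> (\<lambda>k. p f k + p g k) - \<Lambda> (\<lambda>k. n f k + n g k)"
    proof (rule key)
      show "f k + g k = p f k + p g k - (n f k + n g k)" for k
        using pn(5)[OF fg(1), of k] pn(5)[OF fg(2), of k] by simp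
    qed (use fg pn in \<open>auto intro!: add add_nonneg_nonneg\<close>)
    then show "L (\<lambda>k. f k + g k) = L f + L g" using fg pn by (simp add: L_def add\<Lambda>)
  next
    fix a f assume f: "f \<in> X"
    show "L (\<lambda>k. a * f k) = a * L f"
    proof (cases "a \<ge> 0")
      case True
      have "L (\<lambda>k. a * f k) = \<Lambda> (\<lambda>k. a * p f k) - \<Lambda> (\<lambda>k. a * n f k)"
      proof (rule key)
        show "a * f k = a * p f k - a * n f k" for k
          using pn(5)[OF f, of k] by (simp add: right_diff_distrib[symmetric])
      qed (use f pn True in \<open>auto intro!: scale\<close>)
      then show ?thesis using f pn True by (simp add: L_def scale\<Lambda> algebra_simps)
    next
      case False
      have "L (\<lambda>k. a * f k) = \<Lambda> (\<lambda>k. (- a) * n f k) - \<Lambda> (\<lambda>k. (- a) * p f k)"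
      proof (rule key)
        show "a * f k = (- a) * n f k - (- a) * p f k" for k
        proof -
          have "(- a) * n f k - (- a) * p f k = a * (p f k - n f k)" by (simp add: algebra_simps)
          then show ?thesis using pn(5)[OF f, of k] by simp
        qed
        show "0 \<le> (- a) * n f k" "0 \<le> (- a) * p f k" for k
          using False pn(3,4)[OF f, of k] by (simp_all add: mult_nonpos_nonneg)
        show "(\<lambda>k. (- a) * n f k) \<in> X" "(\<lambda>k. (- a) * p f k) \<in> X" "(\<lambda>k. a * f k) \<in> X"
          using scale[OF pn(2)[OF f], of "- a"] scale[OF pn(1)[OF f], of "- a"] scale[OF f, of a] by simp_all
      qed
      also have "\<dots> = (- a) * \<Lambda> (n f) - (- a) * \<Lambda> (p f)"
        using False pn[OF f] by (subst (1 2) scale\<Lambda>) auto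
      finally show ?thesis by (simp add: L_def algebra_simps)
    qed
  next
    fix h assume h: "h \<in> X" "\<And>k. 0 \<le> h k"
    have "\<Lambda> (\<lambda>k. 0) = 0" using scale\<Lambda>[of 0 "\<lambda>k. 0"] const[of 0] by simp
    moreover have "L h = \<Lambda> h - \<Lambda> (\<lambda>k. 0)" using h const by (intro key) auto
    ultimately show "L h = \<Lambda> h" by simp
  qed
qed

lemma (in function_algebra) cone_functional_mono:
  assumes "cone_functional X \<Lambda>" "h \<in> X" "h' \<in> X" "\<And>k. 0 \<le> h k" "\<And>k. h k \<le> h' k"
  shows "\<Lambda> h \<le> \<Lambda> h'"
proof -
  have d: "(\<lambda>k. h' k - h k) \<in> X" using assms(2,3) by (intro diff)
  have "\<Lambda> (\<lambda>k. h k + (h' k - h k)) = \<Lambda> h + \<Lambda> (\<lambda>k. h' k - h k)"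
    using assms by (intro cone_functionalD(3)[OF assms(1,2,4) d]) auto
  moreover have "0 \<le> \<Lambda> (\<lambda>k. h' k - h k)" using assms by (intro cone_functionalD(1)[OF assms(1) d]) auto
  ultimately show ?thesis by simp
qed

lemma span_range_mono_finite:
  assumes "finite B" "B \<subseteq> span (range (e :: nat \<Rightarrow> 'a::real_vector))"
  shows "\<exists>N. B \<subseteq> span (e ` {..<N})"
  using assms
proof (induction B)
  case (insert b B)
  then obtain N where N: "B \<subseteq> span (e ` {..<N})" by auto
  obtain t where t: "finite t" "t \<subseteq> range e" "b \<in> span t"
    using insert.prems unfolding span_explicit by (auto intro!: span_sum span_scale span_base)
  then obtain I where I: "finite I" "t = e ` I" using finite_subset_image by metis
  then obtain N' where "I \<subseteq> {..<N'}" using finite_nat_iff_bounded by blast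
  then have "t \<subseteq> e ` {..<max N N'}" using I(2) by auto
  then have "b \<in> span (e ` {..<max N N'})" using t(3) span_mono by blast
  moreover have "span (e ` {..<N}) \<subseteq> span (e ` {..<max N N'})" by (intro span_mono image_mono) auto
  ultimately show ?case using N by blast
qed simp

lemma infinite_dimensional_sequence:
  assumes "infinite_dimensional TYPE('e::real_vector)"
  obtains e :: "nat \<Rightarrow> 'e::real_vector" where "\<not> finite_dim_subspace (span (range e))"
proof -
  have out: "\<exists>x. x \<notin> span B" if "finite B" for B :: "'e set"
  proof (rule ccontr)
    assume "\<not> ?thesis"
    then have "UNIV = span B" by blast
    then have "finite_dim_subspace (UNIV :: 'e set)"
      using that unfolding finite_dim_subspace_def by (intro conjI subspace_UNIV exI[of _ B])
    then show False using assms unfolding infinite_dimensional_def by blast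
  qed
  have "\<exists>e :: nat \<Rightarrow> 'e. \<forall>n. e n \<notin> span (e ` {..<n})"
  proof (rule dependent_wellorder_choice)
    fix r and f g :: "nat \<Rightarrow> 'e" and n :: nat assume "\<And>y. y < n \<Longrightarrow> f y = g y"
    then have "f ` {..<n} = g ` {..<n}" by (intro image_cong) auto
    then show "(r \<notin> span (f ` {..<n})) = (r \<notin> span (g ` {..<n}))" by simp
  qed (use out in auto)
  then obtain e :: "nat \<Rightarrow> 'e" where e: "\<And>n. e n \<notin> span (e ` {..<n})" by blast
  have "\<not> finite_dim_subspace (span (range e))"
  proof
    assume "finite_dim_subspace (span (range e))"
    then obtain B where B: "finite B" "span (range e) = span B" unfolding finite_dim_subspace_def by blast
    then have "B \<subseteq> span (range e)" using span_superset by blast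
    then obtain N where "B \<subseteq> span (e ` {..<N})" using span_range_mono_finite[OF B(1)] by blast
    then have "span B \<subseteq> span (e ` {..<N})" by (rule span_minimal) simp
    then have "e N \<in> span (e ` {..<N})" using B(2) span_base[of "e N" "range e"] by blast
    then show False using e by blast
  qed
  then show thesis by (rule that)
qed

text \<open>The data attached to one sequence e: the map v \<mapsto> (\<psi> k v) embeds its span
  isometrically into X, and S is a left inverse of this embedding defined on all of X.\<close>

locale embedded_span = bounded_operator X S K
  for X and S :: "(nat \<Rightarrow> real) \<Rightarrow> 'e::banach" and K +
  fixes e :: "nat \<Rightarrow> 'e" and \<psi> :: "nat \<Rightarrow> 'e \<Rightarrow> real"
  assumes \<psi>_linear: "linear (\<psi> k)" and \<psi>_le: "\<bar>\<psi> k v\<bar> \<le> norm v"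
    and norming: "v \<in> span (range e) \<Longrightarrow> (\<And>k. \<bar>\<psi> k v\<bar> \<le> c) \<Longrightarrow> norm v \<le> c"
    and \<psi>_in: "v \<in> span (range e) \<Longrightarrow> (\<lambda>k. \<psi> k v) \<in> X"
    and S_\<psi>: "v \<in> span (range e) \<Longrightarrow> S (\<lambda>k. \<psi> k v) = v"
begin

lemma \<psi>_simps: "\<psi> k (u + v) = \<psi> k u + \<psi> k v" "\<psi> k (u - v) = \<psi> k u - \<psi> k v" "\<psi> k (a *\<^sub>R u) = a * \<psi> k u"
  using \<psi>_linear[of k] by (simp_all add: linear_add linear_diff linear_scale)

text \<open>Two convex combinations that almost minimise a quadratic functional over far-out convex
  hulls are close with respect to it, by the parallelogram identity.\<close>

lemma close_convex_combinations:
  fixes T :: "'e \<Rightarrow> 'f::banach"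
  assumes T: "bounded_linear T" and TS: "bounded_operator X (\<lambda>f. T (S f)) L"
    and exh: "exhaustive sets_in (\<lambda>A. variation X (\<lambda>f. T (S f)) (indicat_real A))"
    and e: "\<And>n. norm (e n) \<le> 1" and \<theta>: "\<theta> > 0"
  shows "\<exists>N. \<exists>u\<in>convex hull ((\<lambda>n. T (e n)) ` {..<N}). \<exists>v\<in>convex hull ((\<lambda>n. T (e n)) ` {N..}). norm (u - v) < \<theta>"
proof -
  interpret T: bounded_linear T by (rule T)
  interpret TS: bounded_operator X "\<lambda>f. T (S f)" L by (rule TS)
  obtain \<Lambda> where \<Lambda>: "cone_functional X \<Lambda>"
    and ctrl: "\<And>f. f \<in> X \<Longrightarrow> (\<And>k. \<bar>f k\<bar> \<le> 1) \<Longrightarrow> \<Lambda> (\<lambda>k. (f k)\<^sup>2) \<le> 1 \<Longrightarrow> norm (T (S f)) \<le> \<theta> / 4"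
    using TS.quadratic_control[OF exh, of "\<theta> / 4"] \<theta> by auto
  define q where "q v = \<Lambda> (\<lambda>k. (\<psi> k v)\<^sup>2)" for v
  define C where "C N = convex hull (e ` {N..})" for N
  have C_span: "C N \<subseteq> span (range e)" for N
    unfolding C_def by (intro hull_minimal subspace_imp_convex subspace_span) (auto intro: span_base)
  have C_ball: "norm v \<le> 1" if "v \<in> C N" for v N
  proof -
    have "C N \<subseteq> cball 0 1" unfolding C_def using e by (intro hull_minimal convex_cball) auto
    then show ?thesis using that by auto
  qed
  have C_ne: "C N \<noteq> {}" for N by (simp add: C_def)
  have C_mono: "C N \<subseteq> C M" if "M \<le> N" for M N
    unfolding C_def using that by (intro hull_mono image_mono) auto
  have sq: "(\<lambda>k. (\<psi> k v)\<^sup>2) \<in> X" if "v \<in> span (range e)" for v using \<psi>_in[OF that] by (rule square)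
  have q0: "0 \<le> q v" if "v \<in> C N" for v N
    unfolding q_def using that C_span by (intro cone_functionalD(1)[OF \<Lambda> sq]) auto
  have q1: "q v \<le> \<Lambda> (\<lambda>k. 1)" if "v \<in> C N" for v N
    unfolding q_def
  proof (rule cone_functional_mono[OF \<Lambda> sq const])
    show "v \<in> span (range e)" using that C_span by blast
    show "(\<psi> k v)\<^sup>2 \<le> 1" for k
      using order_trans[OF \<psi>_le C_ball[OF that]] by (simp add: abs_square_le_1)
  qed simp
  define d where "d N = (INF v\<in>C N. q v)" for N
  have d_le: "d N \<le> q v" if "v \<in> C N" for v N
    unfolding d_def using that q0 by (intro cINF_lower bdd_belowI[of _ 0]) auto
  have d_bound: "d N \<le> \<Lambda> (\<lambda>k. 1)" for N
  proof -
    obtain v where "v \<in> C N" using C_ne[of N] by blast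
    then show ?thesis using d_le[of v N] q1[of v N] by simp
  qed
  \<comment> \<open>The hulls C N shrink, so the infima increase to D. Beyond some N all values of q
    exceed D - 1/2 up to equality, while every hull has a point with value at most D + 1/2.\<close>
  define D where "D = (SUP N. d N)"
  have bddD: "bdd_above (range d)" using d_bound by (intro bdd_aboveI[of _ "\<Lambda> (\<lambda>k. 1)"]) auto
  have dD: "d N \<le> D" for N unfolding D_def using bddD by (intro cSUP_upper) auto
  have near: "\<exists>v\<in>C N. q v \<le> D + 1/2" for N
  proof (rule ccontr)
    assume "\<not> ?thesis"
    then have "D + 1/2 \<le> d N" unfolding d_def using C_ne by (intro cINF_greatest) (auto simp: not_le less_imp_le)
    then show False using dD[of N] by simp
  qed
  have "\<exists>N. D - 1/2 \<le> d N"
  proof (rule ccontr)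
    assume "\<not> ?thesis"
    then have "D \<le> D - 1/2" unfolding D_def by (intro cSUP_least) (auto simp: not_le less_imp_le)
    then show False by simp
  qed
  then obtain N where N: "D - 1/2 \<le> d N" by blast
  obtain v where v: "v \<in> C N" "q v \<le> D + 1/2" using near by blast
  \<comment> \<open>Only finitely many e n occur in v, and N' lies beyond them; hence v comes from
    an initial segment and v' from the matching tail.\<close>
  obtain N' where N': "N \<le> N'" "v \<in> convex hull (e ` {..<N'})"
  proof -
    obtain t where t: "finite t" "t \<subseteq> e ` {N..}" "v \<in> convex hull t"
      using v(1) unfolding C_def convex_hull_explicit[of "e ` {N..}"] by (auto simp: convex_hull_finite)
    then obtain I where I: "finite I" "t = e ` I" using finite_subset_image by metis
    then obtain N' where "I \<subseteq> {..<N'}" using finite_nat_iff_bounded by blast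
    then have "t \<subseteq> e ` {..<max N N'}" using I(2) by auto
    then have "v \<in> convex hull (e ` {..<max N N'})" using t(3) hull_mono by blast
    then show thesis using that[of "max N N'"] by simp
  qed
  obtain v' where v': "v' \<in> C N'" "q v' \<le> D + 1/2" using near by blast
  have vv: "v \<in> span (range e)" "v' \<in> span (range e)" using v v' C_span by blast+
  have "(1/2) *\<^sub>R v + (1/2) *\<^sub>R v' \<in> C N"
    using v(1) v'(1) C_mono[OF N'(1)] convexD[of "C N" v v' "1/2" "1/2"] by (auto simp: C_def)
  then have "D - 1/2 \<le> q ((1/2) *\<^sub>R v + (1/2) *\<^sub>R v')" using N d_le by (meson order_trans)
  \<comment> \<open>A fixed tolerance of 1/2 is enough: for half the difference the parallelogram
    identity gives q w \<le> 1, which is what \<open>ctrl\<close> asks for, and \<theta> enters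
    through \<open>ctrl\<close> only.\<close>
  define w where "w = (1/2) *\<^sub>R v - (1/2) *\<^sub>R v'"
  have w: "w \<in> span (range e)" unfolding w_def using vv by (intro span_diff span_scale)
  have "q ((1/2) *\<^sub>R v + (1/2) *\<^sub>R v') + q w = (1/2) * q v + (1/2) * q v'"
  proof -
    let ?a = "(1/2) *\<^sub>R v + (1/2) *\<^sub>R v'"
    have a: "?a \<in> span (range e)" using vv by (intro span_add span_scale)
    have "(\<psi> k ?a)\<^sup>2 + (\<psi> k w)\<^sup>2 = (1/2) * (\<psi> k v)\<^sup>2 + (1/2) * (\<psi> k v')\<^sup>2" for k
      unfolding w_def \<psi>_simps by (simp add: power2_eq_square field_simps)
    then have "\<Lambda> (\<lambda>k. (\<psi> k ?a)\<^sup>2 + (\<psi> k w)\<^sup>2) = \<Lambda> (\<lambda>k. (1/2) * (\<psi> k v)\<^sup>2 + (1/2) * (\<psi> k v')\<^sup>2)"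
      by presburger
    moreover have "\<Lambda> (\<lambda>k. (\<psi> k ?a)\<^sup>2 + (\<psi> k w)\<^sup>2) = q ?a + q w"
      unfolding q_def by (rule cone_functionalD(3)[OF \<Lambda> sq[OF a] _ sq[OF w]]) auto
    moreover have "\<Lambda> (\<lambda>k. (1/2) * (\<psi> k v)\<^sup>2 + (1/2) * (\<psi> k v')\<^sup>2) =
        \<Lambda> (\<lambda>k. (1/2) * (\<psi> k v)\<^sup>2) + \<Lambda> (\<lambda>k. (1/2) * (\<psi> k v')\<^sup>2)"
      by (rule cone_functionalD(3)[OF \<Lambda> scale[OF sq[OF vv(1)]] _ scale[OF sq[OF vv(2)]]]) auto
    moreover have half: "\<Lambda> (\<lambda>k. (1/2) * (\<psi> k u)\<^sup>2) = (1/2) * q u" if "u \<in> span (range e)" for u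
      unfolding q_def by (rule cone_functionalD(2)[OF \<Lambda> sq[OF that]]) auto
    ultimately show ?thesis by (simp only: half[OF vv(1)] half[OF vv(2)])
  qed
  then have "q w \<le> 1" using v(2) v'(2) \<open>D - 1/2 \<le> q ((1/2) *\<^sub>R v + (1/2) *\<^sub>R v')\<close> by linarith
  moreover have "norm w \<le> 1"
  proof -
    have "norm w \<le> norm ((1/2) *\<^sub>R v) + norm ((1/2) *\<^sub>R v')" unfolding w_def by (rule norm_triangle_ineq4)
    then show ?thesis using C_ball[OF v(1)] C_ball[OF v'(1)] by simp
  qed
  then have "\<bar>\<psi> k w\<bar> \<le> 1" for k using order_trans[OF \<psi>_le] by blast
  ultimately have "norm (T (S (\<lambda>k. \<psi> k w))) \<le> \<theta> / 4"
    using \<psi>_in[OF w] unfolding q_def by (intro ctrl) auto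
  then have "norm (T w) \<le> \<theta> / 4" by (simp add: S_\<psi>[OF w])
  moreover have "T v - T v' = 2 *\<^sub>R T w" by (simp add: w_def T.diff T.scaleR scaleR_diff_right)
  ultimately have close: "norm (T v - T v') < \<theta>" using \<theta> by simp
  have hull: "T ` (convex hull (e ` I)) = convex hull ((\<lambda>n. T (e n)) ` I)" for I
    using convex_hull_linear_image[OF T.linear_axioms, of "e ` I"] by (simp add: image_image)
  have "T v \<in> convex hull ((\<lambda>n. T (e n)) ` {..<N'})" using N'(2) hull by blast
  moreover have "T v' \<in> convex hull ((\<lambda>n. T (e n)) ` {N'..})" using v'(1) hull unfolding C_def by blast
  ultimately show ?thesis using close by blast
qed

text \<open>If \<open>S\<close> is exhaustive then a quadratic functional dominates the norm of the span, which is
  therefore a Hilbert space inside a space of bounded functions. For \<open>n\<close> orthonormal vectors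
  the sum of the squares is bounded by 1 pointwise, so \<open>n\<close> is at most the value of the functional at 1.\<close>

lemma exhaustive_imp_finite_dim:
  assumes exh: "exhaustive sets_in (\<lambda>A. variation X S (indicat_real A))"
  shows "finite_dim_subspace (span (range e))"
proof (rule ccontr)
  assume inf: "\<not> finite_dim_subspace (span (range e))"
  let ?Y = "span (range e)"
  obtain \<Lambda> where \<Lambda>: "cone_functional X \<Lambda>"
    and ctrl: "\<And>f. f \<in> X \<Longrightarrow> (\<And>k. \<bar>f k\<bar> \<le> 1) \<Longrightarrow> \<Lambda> (\<lambda>k. (f k)\<^sup>2) \<le> 1 \<Longrightarrow> norm (S f) \<le> 1/2"
    by (rule quadratic_control[OF exh, of "1/2"]) auto
  obtain L where L_add: "\<And>f g. f \<in> X \<Longrightarrow> g \<in> X \<Longrightarrow> L (\<lambda>k. f k + g k) = L f + L g"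
    and L_scale: "\<And>a f. f \<in> X \<Longrightarrow> L (\<lambda>k. a * f k) = a * L f"
    and L: "\<And>h. h \<in> X \<Longrightarrow> (\<And>k. 0 \<le> h k) \<Longrightarrow> L h = \<Lambda> h"
    by (rule cone_functional_linear_extension[OF \<Lambda>]) blast
  define ip where "ip u v = L (\<lambda>k. \<psi> k u * \<psi> k v)" for u v
  have prod_in: "(\<lambda>k. \<psi> k u * \<psi> k v) \<in> X" if "u \<in> ?Y" "v \<in> ?Y" for u v
    using \<psi>_in[OF that(1)] \<psi>_in[OF that(2)] by (rule mult)
  have ip_sym: "ip u v = ip v u" for u v by (simp add: ip_def mult.commute)
  have ip_add: "ip (u + v) w = ip u w + ip v w" if "u \<in> ?Y" "v \<in> ?Y" "w \<in> ?Y" for u v w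
    using L_add[OF prod_in[OF that(1,3)] prod_in[OF that(2,3)]] by (simp add: ip_def \<psi>_simps distrib_right)
  have ip_scale: "ip (a *\<^sub>R u) w = a * ip u w" if "u \<in> ?Y" "w \<in> ?Y" for a u w
    using L_scale[OF prod_in[OF that], of a] by (simp add: ip_def \<psi>_simps mult.assoc)
  have ip_diff: "ip (u - v) w = ip u w - ip v w" if "u \<in> ?Y" "v \<in> ?Y" "w \<in> ?Y" for u v w
    using ip_add[OF that(1) span_scale[OF that(2), of "-1"] that(3)] ip_scale[OF that(2,3), of "-1"] by simp
  have ip_sum: "ip (\<Sum>i\<in>I. a i *\<^sub>R v i) w = (\<Sum>i\<in>I. a i * ip (v i) w)"
    if "finite I" "\<And>i. i \<in> I \<Longrightarrow> v i \<in> ?Y" "w \<in> ?Y" for I :: "nat set" and a v w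
    using that
  proof (induction I)
    case empty
    then show ?case using ip_scale[OF span_zero[of "range e"], of w 0] by simp
  next
    case (insert i I)
    have "(\<Sum>i\<in>I. a i *\<^sub>R v i) \<in> ?Y" using insert by (intro span_sum span_scale) auto
    then show ?case using insert by (simp add: ip_add ip_scale span_scale)
  qed
  \<comment> \<open>A unit vector w with ip w w \<le> 1 would meet the hypotheses of
    \<open>ctrl\<close> and so have norm at most 1/2, because S recovers it from its image.\<close>
  have ip_ge: "(norm v)\<^sup>2 \<le> ip v v" if v: "v \<in> ?Y" for v
  proof (cases "v = 0")
    case True
    then show ?thesis using ip_scale[OF span_zero[of "range e"] span_zero[of "range e"], of 0] by simp
  next
    case False
    define w where "w = (1 / norm v) *\<^sub>R v"
    have w: "w \<in> ?Y" "norm w = 1" using v False by (auto simp: w_def span_scale)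
    have "\<not> ip w w \<le> 1"
    proof
      assume "ip w w \<le> 1"
      then have "\<Lambda> (\<lambda>k. (\<psi> k w)\<^sup>2) \<le> 1"
        using L[OF square[OF \<psi>_in[OF w(1)]]] by (simp add: ip_def power2_eq_square)
      then have "norm (S (\<lambda>k. \<psi> k w)) \<le> 1/2"
        using \<psi>_in[OF w(1)] \<psi>_le[of _ w] w(2) by (intro ctrl) auto
      then show False using S_\<psi>[OF w(1)] w(2) by simp
    qed
    moreover have "ip v v = (norm v)\<^sup>2 * ip w w"
    proof -
      have "v = norm v *\<^sub>R w" using False by (simp add: w_def)
      then have "ip v v = ip (norm v *\<^sub>R w) (norm v *\<^sub>R w)" by simp
      also have "\<dots> = norm v * (norm v * ip w w)"
        using w(1) by (simp add: ip_scale span_scale ip_sym[of w "norm v *\<^sub>R w"])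
      finally show ?thesis by (simp add: power2_eq_square)
    qed
    ultimately show ?thesis using False by simp
  qed
  have orthonormal: "\<exists>v :: nat \<Rightarrow> 'e. (\<forall>i<n. v i \<in> ?Y) \<and> (\<forall>i<n. \<forall>j<n. ip (v i) (v j) = (if i = j then 1 else 0))" for n
  proof (induction n)
    case (Suc n)
    then obtain v :: "nat \<Rightarrow> 'e" where v: "\<And>i. i < n \<Longrightarrow> v i \<in> ?Y"
      "\<And>i j. i < n \<Longrightarrow> j < n \<Longrightarrow> ip (v i) (v j) = (if i = j then 1 else 0)" by blast
    have sub: "span (v ` {..<n}) \<subseteq> ?Y" using v(1) by (intro span_minimal) auto
    have "span (v ` {..<n}) \<noteq> ?Y"
    proof
      assume eq: "span (v ` {..<n}) = ?Y"
      have "finite (v ` {..<n})" by simp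
      then have "finite_dim_subspace ?Y" unfolding finite_dim_subspace_def using eq by (metis subspace_span)
      with inf show False by blast
    qed
    then obtain y where y: "y \<in> ?Y" "y \<notin> span (v ` {..<n})" using sub by blast
    define z where "z = y - (\<Sum>i<n. ip y (v i) *\<^sub>R v i)"
    have s: "(\<Sum>i<n. ip y (v i) *\<^sub>R v i) \<in> span (v ` {..<n})" by (intro span_sum span_scale span_base) auto
    have z: "z \<in> ?Y" unfolding z_def using y(1) s sub by (intro span_diff) auto
    have "z \<noteq> 0" using y(2) s by (auto simp: z_def)
    then have zz: "ip z z > 0" using ip_ge[OF z] by (meson less_le_trans zero_less_norm_iff zero_less_power)
    have orth: "ip z (v j) = 0" if j: "j < n" for j
    proof -
      have "ip z (v j) = ip y (v j) - (\<Sum>i<n. ip y (v i) * ip (v i) (v j))"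
      proof -
        have "ip (\<Sum>i<n. ip y (v i) *\<^sub>R v i) (v j) = (\<Sum>i<n. ip y (v i) * ip (v i) (v j))"
          using v(1) j by (intro ip_sum) auto
        moreover have "ip z (v j) = ip y (v j) - ip (\<Sum>i<n. ip y (v i) *\<^sub>R v i) (v j)"
          unfolding z_def using y(1) v(1)[OF j] s sub by (intro ip_diff) auto
        ultimately show ?thesis by simp
      qed
      also have "(\<Sum>i<n. ip y (v i) * ip (v i) (v j)) = (\<Sum>i<n. if i = j then ip y (v i) else 0)"
        using v(2) j by (intro sum.cong) auto
      also have "\<dots> = ip y (v j)" using j by simp
      finally show ?thesis by simp
    qed
    define c where "c = 1 / sqrt (ip z z)"
    define v' where "v' = v(n := c *\<^sub>R z)"
    have cz: "c *\<^sub>R z \<in> ?Y" using z by (rule span_scale)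
    have n1: "ip (c *\<^sub>R z) (c *\<^sub>R z) = 1"
    proof -
      have "ip (c *\<^sub>R z) (c *\<^sub>R z) = c * (c * ip z z)"
        using ip_scale[OF z cz, of c] ip_scale[OF z z, of c] ip_sym[of z "c *\<^sub>R z"] by simp
      also have "\<dots> = (c * c) * ip z z" by simp
      also have "c * c = 1 / ip z z" using zz by (simp add: c_def)
      also have "1 / ip z z * ip z z = 1" using zz by simp
      finally show ?thesis .
    qed
    have n0: "ip (c *\<^sub>R z) (v j) = 0" "ip (v j) (c *\<^sub>R z) = 0" if "j < n" for j
      using ip_scale[OF z v(1)[OF that], of c] orth[OF that] ip_sym[of "v j"] by auto
    have "v' i \<in> ?Y" if "i < Suc n" for i using that v(1) cz by (auto simp: v'_def less_Suc_eq)
    moreover have "ip (v' i) (v' j) = (if i = j then 1 else 0)" if "i < Suc n" "j < Suc n" for i j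
      using that v(2) n1 n0 by (auto simp: v'_def less_Suc_eq)
    ultimately show ?case by blast
  qed simp
  have "real n \<le> \<Lambda> (\<lambda>k. 1)" for n
  proof -
    obtain v :: "nat \<Rightarrow> 'e" where v: "\<And>i. i < n \<Longrightarrow> v i \<in> ?Y"
      "\<And>i j. i < n \<Longrightarrow> j < n \<Longrightarrow> ip (v i) (v j) = (if i = j then 1 else 0)"
      using orthonormal[of n] by blast
    have sq: "(\<lambda>k. (\<psi> k (v i))\<^sup>2) \<in> X" if "i < n" for i using \<psi>_in[OF v(1)[OF that]] by (rule square)
    \<comment> \<open>Put u = \<Sum> \<psi> k (v i) v i. The sum s equals both \<psi> k u and ip u
      u, so s \<le> norm u \<le> sqrt s and therefore s \<le> 1.\<close>
    have le1: "(\<Sum>i<n. (\<psi> k (v i))\<^sup>2) \<le> 1" for k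
    proof -
      define u where "u = (\<Sum>i<n. \<psi> k (v i) *\<^sub>R v i)"
      define s where "s = (\<Sum>i<n. (\<psi> k (v i))\<^sup>2)"
      have u: "u \<in> ?Y" unfolding u_def using v(1) by (intro span_sum span_scale) auto
      have uv: "ip u (v j) = \<psi> k (v j)" if j: "j < n" for j
      proof -
        have "ip u (v j) = (\<Sum>i<n. \<psi> k (v i) * ip (v i) (v j))"
          unfolding u_def using v(1) j by (intro ip_sum) auto
        also have "\<dots> = (\<Sum>i<n. if i = j then \<psi> k (v i) else 0)" using v(2) j by (intro sum.cong) auto
        finally show ?thesis using j by simp
      qed
      have "ip u u = (\<Sum>i<n. \<psi> k (v i) * ip (v i) u)"
        using ip_sum[of "{..<n}" v u "\<lambda>i. \<psi> k (v i)"] v(1) u by (simp add: u_def)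
      also have "\<dots> = s" unfolding s_def using uv ip_sym[of "v _" u] by (intro sum.cong) (auto simp: power2_eq_square)
      finally have "(norm u)\<^sup>2 \<le> s" using ip_ge[OF u] by simp
      moreover have "\<psi> k u = s"
        unfolding u_def s_def linear_sum[OF \<psi>_linear] \<psi>_simps by (simp add: power2_eq_square)
      then have "s \<le> norm u" using \<psi>_le[of k u] by simp
      moreover have "0 \<le> s" unfolding s_def by (intro sum_nonneg) auto
      ultimately have "s\<^sup>2 \<le> s" by (meson order_trans power_mono)
      then show ?thesis unfolding s_def[symmetric]
        by (metis \<open>0 \<le> s\<close> mult_le_cancel_left_pos mult.right_neutral order_le_less power2_eq_square zero_le_one)
    qed
    have sum_in: "m \<le> n \<Longrightarrow> (\<lambda>k. \<Sum>i<m. (\<psi> k (v i))\<^sup>2) \<in> X" for m using sq by (intro sum) auto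
    have "m \<le> n \<Longrightarrow> L (\<lambda>k. \<Sum>i<m. (\<psi> k (v i))\<^sup>2) = real m" for m
    proof (induction m)
      case 0
      then show ?case using L_scale[OF const[of 0], of 0] by simp
    next
      case (Suc m)
      have "L (\<lambda>k. (\<Sum>i<m. (\<psi> k (v i))\<^sup>2) + (\<psi> k (v m))\<^sup>2) = real m + L (\<lambda>k. (\<psi> k (v m))\<^sup>2)"
        using L_add[OF sum_in[of m] sq[of m]] Suc by simp
      also have "L (\<lambda>k. (\<psi> k (v m))\<^sup>2) = ip (v m) (v m)" by (simp add: ip_def power2_eq_square)
      also have "\<dots> = 1" using v(2)[of m m] Suc.prems by simp
      finally show ?case by simp
    qed
    then have "real n = L (\<lambda>k. \<Sum>i<n. (\<psi> k (v i))\<^sup>2)" by simp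
    also have "\<dots> = \<Lambda> (\<lambda>k. \<Sum>i<n. (\<psi> k (v i))\<^sup>2)" using sum_in by (intro L sum_nonneg) auto
    also have "\<dots> \<le> \<Lambda> (\<lambda>k. 1)"
      using sum_in le1 by (intro cone_functional_mono[OF \<Lambda>] const sum_nonneg) auto
    finally show ?thesis .
  qed
  then show False using reals_Archimedean2 not_le by metis
qed

end

section \<open>Consequences of embedding every sequence of E\<close>

definition glues :: "(nat \<Rightarrow> real) set \<Rightarrow> l_inf set \<Rightarrow> bool" where
  "glues X Z \<longleftrightarrow> (\<forall>A f x. disjoint_family A \<longrightarrow> (\<forall>n. f n \<in> X) \<longrightarrow>
     (\<forall>n k. \<bar>f n k\<bar> \<le> indicat_real (A n) k) \<longrightarrow> x \<in> Z \<longrightarrow> glue A f (apply_bcontfun x) \<in> X)"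

text \<open>Algebra and operator may change with the sequence; the coefficient space Z, which
  decides the kind of copy, is common to all.\<close>

definition embeds_sequences :: "'e::banach itself \<Rightarrow> l_inf set \<Rightarrow> bool" where
  "embeds_sequences _ Z \<longleftrightarrow>
     (\<forall>e :: nat \<Rightarrow> 'e. \<exists>X S K \<psi>. embedded_span X S K e \<psi> \<and> glues X Z)"

lemma bounded_operator_compose:
  fixes S :: "(nat \<Rightarrow> real) \<Rightarrow> 'e::real_normed_vector" and T :: "'e \<Rightarrow> 'f::real_normed_vector"
  assumes S: "bounded_operator X S K" and T: "bounded_linear T"
  shows "\<exists>L. bounded_operator X (\<lambda>f. T (S f)) L"
proof -
  interpret bounded_operator X S K by (rule S)
  interpret T: bounded_linear T by (rule T)
  obtain B where B: "B > 0" "\<And>y. norm (T y) \<le> norm y * B" using T.pos_bounded by blast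
  have "bounded_operator X (\<lambda>f. T (S f)) (K * B)"
  proof
    show "norm (T (S f)) \<le> K * B * M" if f: "f \<in> X" "\<And>k. \<bar>f k\<bar> \<le> M" for f M
    proof -
      have "norm (T (S f)) \<le> norm (S f) * B" by (rule B(2))
      also have "\<dots> \<le> (K * M) * B" using U_bound[OF f] B(1) by (intro mult_right_mono) auto
      finally show ?thesis by (simp add: mult_ac)
    qed
  qed (simp_all add: U_add U_scale T.add T.scaleR)
  then show ?thesis by blast
qed

text \<open>The criterion for weak compactness concerns one sequence T (e n) at a time, so the
  embedding of that particular e can be used. Failure of exhaustiveness for it would produce a fixed
  copy.\<close>

lemma property_V:
  fixes T :: "'e::banach \<Rightarrow> 'f::banach"
  assumes E: "embeds_sequences TYPE('e) Z" and Z: "sequence_space Z" and T: "bounded_linear T"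
  shows "weakly_compact_operator T \<or> fixes_copy_of Z T"
proof (rule disjCI)
  assume not_fix: "\<not> fixes_copy_of Z T"
  have "compactin weak_topology (weak_topology closure_of (T ` cball 0 1))"
  proof (rule weakly_compact_criterion)
    show "bounded (T ` cball 0 1)" using bounded_cball T by (rule bounded_linear_image)
    fix x :: "nat \<Rightarrow> 'f" and \<theta> :: real assume x: "\<And>n. x n \<in> T ` cball 0 1" and \<theta>: "\<theta> > 0"
    have "\<forall>n. \<exists>y. norm y \<le> 1 \<and> x n = T y"
    proof
      fix n
      obtain y where "y \<in> cball 0 1" "x n = T y" using x[of n] by (rule imageE)
      then show "\<exists>y. norm y \<le> 1 \<and> x n = T y" by auto
    qed
    from choice[OF this] obtain e where e: "\<And>n. norm (e n) \<le> 1" "\<And>n. x n = T (e n)" by auto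
    obtain X S K \<psi> where emb: "embedded_span X S K e \<psi>" and gl: "glues X Z"
      using E unfolding embeds_sequences_def by blast
    interpret embedded_span X S K e \<psi> by (rule emb)
    obtain L where L: "bounded_operator X (\<lambda>f. T (S f)) L"
      using bounded_operator_compose[OF bounded_operator_axioms T] by blast
    have "exhaustive sets_in (\<lambda>A. variation X (\<lambda>f. T (S f)) (indicat_real A))"
    proof (rule ccontr)
      assume "\<not> ?thesis"
      then have "fixes_copy_of Z T"
        using gl unfolding glues_def by (intro fixes_copy[OF bounded_operator_axioms T L _ Z]) blast+
      with not_fix show False by blast
    qed
    from close_convex_combinations[OF T L this e(1) \<theta>]
    show "\<exists>N. \<exists>u\<in>convex hull (x ` {..<N}). \<exists>v\<in>convex hull (x ` {N..}). norm (u - v) < \<theta>"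
      using e(2) by simp
  qed
  then show "weakly_compact_operator T" using T by (simp add: weakly_compact_operator_def)
qed

lemma infinite_dimensional_fixes_copy:
  assumes E: "embeds_sequences TYPE('e::banach) Z" and Z: "sequence_space Z"
    and inf: "infinite_dimensional TYPE('e)"
  shows "fixes_copy_of Z (\<lambda>x::'e. x)"
proof -
  obtain e :: "nat \<Rightarrow> 'e" where e: "\<not> finite_dim_subspace (span (range e))"
    using infinite_dimensional_sequence[OF inf] .
  obtain X S K \<psi> where emb: "embedded_span X S K e \<psi>" and gl: "glues X Z"
    using E unfolding embeds_sequences_def by blast
  interpret embedded_span X S K e \<psi> by (rule emb)
  have "\<not> exhaustive sets_in (\<lambda>A. variation X S (indicat_real A))" using exhaustive_imp_finite_dim e by blast
  then show ?thesis
    using gl bounded_operator_axioms unfolding glues_def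
    by (intro fixes_copy[OF bounded_operator_axioms bounded_linear_ident _ _ Z, of K]) simp_all
qed

subsection \<open>Embeddings into algebras of bounded sequences\<close>

lemma dense_rational_combinations:
  fixes e :: "nat \<Rightarrow> 'a::real_normed_vector"
  obtains d :: "nat \<Rightarrow> 'a" where "range d \<subseteq> span (range e)" "span (range e) \<subseteq> closure (range d)"
proof -
  define s where "s l = sum_list (map (\<lambda>(i, r). of_rat r *\<^sub>R e i) l)" for l :: "(nat \<times> rat) list"
  define d where "d k = s (from_nat k)" for k
  have range: "range d = range s"
    by (auto simp: d_def image_def) (metis from_nat_to_nat)
  have "s l \<in> span (range e)" for l
  proof (induction l)
    case (Cons x l)
    obtain i r where "x = (i, r)" by (cases x)
    then show ?case using span_add[OF span_scale[OF span_base[of "e i" "range e"]] Cons.IH, of "of_rat r"] by (simp add: s_def)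
  qed (simp add: s_def span_zero)
  then have "range d \<subseteq> span (range e)" unfolding range by blast
  moreover have "\<exists>l. norm (v - s l) < \<epsilon>" if "v \<in> span (range e)" "\<epsilon> > 0" for v \<epsilon>
    using that
  proof (induction v arbitrary: \<epsilon> rule: span_induct_alt)
    case base
    then show ?case by (intro exI[of _ "[]"]) (simp add: s_def)
  next
    case (step a x y)
    obtain i where i: "x = e i" using step(1) by blast
    obtain l where l: "norm (y - s l) < \<epsilon> / 2" using step(2)[of "\<epsilon> / 2"] step(3) by auto
    define \<eta> where "\<eta> = \<epsilon> / 2 / (norm (e i) + 1)"
    have pos: "norm (e i) + 1 > 0" by (simp add: add_nonneg_pos)
    have \<eta>: "\<eta> > 0" using step(3) pos by (simp add: \<eta>_def)
    then have "a - \<eta> < a" by simp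
    from of_rat_dense[OF this] obtain r where r: "a - \<eta> < of_rat r" "of_rat r < a" by blast
    have "norm (a *\<^sub>R x + y - s ((i, r) # l)) = norm ((a - of_rat r) *\<^sub>R e i + (y - s l))"
      by (simp add: s_def i algebra_simps)
    also have "\<dots> \<le> \<bar>a - of_rat r\<bar> * norm (e i) + norm (y - s l)"
      using norm_triangle_ineq[of "(a - of_rat r) *\<^sub>R e i"] by simp
    also have "\<dots> \<le> \<eta> * (norm (e i) + 1) + norm (y - s l)"
      using r by (intro add_right_mono mult_mono) auto
    also have "\<eta> * (norm (e i) + 1) = \<epsilon> / 2" unfolding \<eta>_def using pos by (intro nonzero_eq_divide_eq[THEN iffD1]) auto
    finally show ?case using l by (intro exI[of _ "(i, r) # l"]) simp
  qed
  then have "span (range e) \<subseteq> closure (range d)"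
    unfolding range closure_approachable subset_iff by (auto simp: dist_norm norm_minus_commute)
  ultimately show thesis by (rule that)
qed

text \<open>Functionals that norm the points of a dense sequence are jointly norming on the closure:
  if d k is close to v, then \<psi> k v is close to norm v.\<close>

lemma norming_sequence:
  fixes e :: "nat \<Rightarrow> 'a::real_normed_vector"
  shows "\<exists>(d :: nat \<Rightarrow> 'a) (\<psi> :: nat \<Rightarrow> 'a \<Rightarrow> real).
    range d \<subseteq> span (range e) \<and> span (range e) \<subseteq> closure (range d) \<and>
    (\<forall>k. linear (\<psi> k)) \<and> (\<forall>k v. \<bar>\<psi> k v\<bar> \<le> norm v) \<and>
    (\<forall>v\<in>closure (range d). \<forall>c. (\<forall>k. \<bar>\<psi> k v\<bar> \<le> c) \<longrightarrow> norm v \<le> c)"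
proof -
  obtain d :: "nat \<Rightarrow> 'a" where d: "range d \<subseteq> span (range e)" "span (range e) \<subseteq> closure (range d)"
    using dense_rational_combinations[of e] by blast
  have "\<forall>k. \<exists>\<phi> :: 'a \<Rightarrow> real. linear \<phi> \<and> (\<forall>y. \<bar>\<phi> y\<bar> \<le> norm y) \<and> \<phi> (d k) = norm (d k)"
    using norming_functional by metis
  from choice[OF this] obtain \<psi> :: "nat \<Rightarrow> 'a \<Rightarrow> real" where \<psi>: "\<And>k. linear (\<psi> k)"
    "\<And>k v. \<bar>\<psi> k v\<bar> \<le> norm v" "\<And>k. \<psi> k (d k) = norm (d k)" by auto
  show ?thesis
  proof (intro exI[of _ d] exI[of _ \<psi>] conjI d allI ballI impI \<psi>(1,2))
    fix v c assume v: "v \<in> closure (range d)" "\<forall>k. \<bar>\<psi> k v\<bar> \<le> c"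
    show "norm v \<le> c"
    proof (rule field_le_epsilon)
      fix \<epsilon> :: real assume "\<epsilon> > 0"
      then have "\<epsilon> / 2 > 0" by simp
      then obtain k where k: "norm (d k - v) < \<epsilon> / 2"
        using v(1) unfolding closure_approachable dist_norm by blast
      have "norm v \<le> norm (d k) + norm (d k - v)" by (metis norm_triangle_sub norm_minus_commute add.commute)
      moreover have "norm (d k) = \<psi> k v + \<psi> k (d k - v)" using \<psi>(3) by (simp add: linear_diff[OF \<psi>(1)])
      moreover have "\<psi> k (d k - v) \<le> norm (d k - v)" using \<psi>(2)[of k "d k - v"] by simp
      moreover have "\<psi> k v \<le> c" using v(2)[rule_format, of k] by simp
      ultimately show "norm v \<le> c + \<epsilon>" using k by linarith
    qed
  qed
qed

lemma closure_subspace: "subspace S \<Longrightarrow> subspace (closure S)" for S :: "'a::real_normed_vector set"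
proof -
  assume S: "subspace S"
  show ?thesis
  proof (rule subspaceI)
    show "0 \<in> closure S" using subspace_0[OF S] closure_subset by blast
  next
    fix x y assume "x \<in> closure S" "y \<in> closure S"
    then obtain f g where f: "\<forall>n. f n \<in> S" "f \<longlonglongrightarrow> x" and g: "\<forall>n. g n \<in> S" "g \<longlonglongrightarrow> y"
      unfolding closure_sequential by (elim exE conjE)
    have "(\<lambda>n. f n + g n) \<longlonglongrightarrow> x + y" using f(2) g(2) by (rule tendsto_add)
    moreover have "\<forall>n. f n + g n \<in> S" using f(1) g(1) S by (simp add: subspace_add)
    ultimately show "x + y \<in> closure S" unfolding closure_sequential by (intro exI[of _ "\<lambda>n. f n + g n"] conjI)
  next
    fix c x assume "x \<in> closure S"
    then obtain f where f: "\<forall>n. f n \<in> S" "f \<longlonglongrightarrow> x" unfolding closure_sequential by (elim exE conjE)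
    have "(\<lambda>n. c *\<^sub>R f n) \<longlonglongrightarrow> c *\<^sub>R x" using tendsto_const f(2) by (rule tendsto_scaleR)
    moreover have "\<forall>n. c *\<^sub>R f n \<in> S" using f(1) S by (simp add: subspace_scale)
    ultimately show "c *\<^sub>R x \<in> closure S" unfolding closure_sequential by (intro exI[of _ "\<lambda>n. c *\<^sub>R f n"] conjI)
  qed
qed

lemma apply_Bcontfun: "\<forall>k. \<bar>f k\<bar> \<le> M \<Longrightarrow> apply_bcontfun (Bcontfun f) = f" for f :: "nat \<Rightarrow> real"
  by (intro Bcontfun_inverse) (auto simp: bcontfun_nat)

text \<open>The hypothesis \<open>extend\<close> stands for either of the two extension properties.\<close>

lemma embedding:
  fixes e d :: "nat \<Rightarrow> 'e::banach"
  assumes X: "function_algebra X"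
    and d: "range d \<subseteq> span (range e)" "span (range e) \<subseteq> closure (range d)"
    and \<psi>: "\<And>k. linear (\<psi> k)" "\<And>k v. \<bar>\<psi> k v\<bar> \<le> norm v"
      "\<And>v c. v \<in> closure (range d) \<Longrightarrow> (\<And>k. \<bar>\<psi> k v\<bar> \<le> c) \<Longrightarrow> norm v \<le> c"
    and e: "\<And>i. (\<lambda>k. \<psi> k (e i)) \<in> X"
    and extend: "\<And>Xb Y D (t :: l_inf \<Rightarrow> 'e). Xb = {x. apply_bcontfun x \<in> X} \<Longrightarrow> subspace Xb \<Longrightarrow> closed Xb \<Longrightarrow>
      subspace Y \<Longrightarrow> closed Y \<Longrightarrow> Y \<subseteq> Xb \<Longrightarrow> countable D \<Longrightarrow> D \<subseteq> Y \<Longrightarrow> Y \<subseteq> closure D \<Longrightarrow>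
      operator_on Y t \<Longrightarrow> \<exists>T. operator_on Xb T \<and> (\<forall>y\<in>Y. T y = t y)"
  shows "\<exists>S K. embedded_span X S K e \<psi>"
proof -
  interpret function_algebra X by (rule X)
  note \<psi>_simps = linear_add[OF \<psi>(1)] linear_scale[OF \<psi>(1)] linear_diff[OF \<psi>(1)]
  \<comment> \<open>Operators extend from closed subspaces, so the embedding is inverted on the
    closure of the span.\<close>
  define W where "W = closure (range d)"
  have W: "W = closure (span (range e))"
    unfolding W_def using d by (meson closure_minimal closure_mono closed_closure subset_antisym)
  have subW: "subspace W" unfolding W by (intro closure_subspace subspace_span)
  have spanW: "span (range e) \<subseteq> W" unfolding W by (rule closure_subset)
  have span_in: "(\<lambda>k. \<psi> k v) \<in> X" if "v \<in> span (range e)" for v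
    using that
  proof (induction rule: span_induct_alt)
    case base
    then show ?case using const[of 0] \<psi>_simps(2)[of _ 0 0] by simp
  next
    case (step a x y)
    then obtain i where "x = e i" by blast
    then show ?case using add[OF scale[OF e[of i], of a] step(2)] by (simp add: \<psi>_simps)
  qed
  have W_in: "(\<lambda>k. \<psi> k v) \<in> X" if v: "v \<in> W" for v
  proof (rule limit)
    fix \<epsilon> :: real assume "\<epsilon> > 0"
    then obtain u where u: "u \<in> span (range e)" "norm (u - v) < \<epsilon>"
      using v unfolding W closure_approachable dist_norm by blast
    have "\<bar>\<psi> k v - \<psi> k u\<bar> \<le> \<epsilon>" for k
      using \<psi>(2)[of k "u - v"] u(2) by (simp add: \<psi>_simps abs_minus_commute)
    then show "\<exists>g\<in>X. \<forall>k. \<bar>\<psi> k v - g k\<bar> \<le> \<epsilon>" by (intro bexI[OF _ span_in[OF u(1)]] allI)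
  qed
  define J where "J v = (Bcontfun (\<lambda>k. \<psi> k v) :: l_inf)" for v
  have J: "apply_bcontfun (J v) k = \<psi> k v" for v k
    unfolding J_def using apply_Bcontfun[of "\<lambda>k. \<psi> k v" "norm v"] \<psi>(2) by simp
  have J_le: "norm (J v) \<le> norm v" for v by (rule norm_bound) (simp add: J \<psi>(2))
  have J_ge: "norm v \<le> norm (J v)" if "v \<in> W" for v
    using \<psi>(3)[of v "norm (J v)"] that norm_bounded[of "J v"] by (simp add: W_def J)
  have J_add: "J (u + v) = J u + J v" and J_scale: "J (a *\<^sub>R v) = a *\<^sub>R J v" for u v a
    by (auto intro!: bcontfun_eqI simp: J \<psi>_simps)
  have J_bl: "bounded_linear J"
    using J_add J_scale J_le by (intro bounded_linear_intro[where K = 1]) auto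
  have J_diff: "J (u - v) = J u - J v" for u v using J_bl by (rule linear_simps(2))
  have J_inj: "u = v" if "u \<in> W" "v \<in> W" "J u = J v" for u v
    using J_ge[of "u - v"] that subW by (simp add: J_diff subspace_diff)
  have inv: "inv_into W J (J v) = v" if "v \<in> W" for v
    using J_inj that by (intro inv_into_f_f inj_onI) auto
  define Xb where "Xb = {x. apply_bcontfun x \<in> X}"
  define Y where "Y = J ` W"
  define D where "D = J ` range d"
  have "\<exists>T. operator_on Xb T \<and> (\<forall>y\<in>Y. T y = inv_into W J y)"
  proof (rule extend[OF Xb_def, of Y D])
    show "subspace Xb"
      unfolding subspace_def Xb_def using const[of 0] add scale by auto
    show "closed Xb"
      unfolding closed_sequential_limits
    proof (intro allI impI, elim conjE)
      fix x :: "nat \<Rightarrow> l_inf" and l assume x: "\<forall>n. x n \<in> Xb" "x \<longlonglongrightarrow> l"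
      have "apply_bcontfun l \<in> X"
      proof (rule limit)
        fix \<epsilon> :: real assume "\<epsilon> > 0"
        then obtain n where n: "norm (x n - l) < \<epsilon>" using LIMSEQ_D[OF x(2)] by blast
        have "\<bar>apply_bcontfun l k - apply_bcontfun (x n) k\<bar> \<le> \<epsilon>" for k
          using norm_bounded[of "x n - l" k] n by (simp add: abs_minus_commute)
        then show "\<exists>g\<in>X. \<forall>k. \<bar>apply_bcontfun l k - g k\<bar> \<le> \<epsilon>" using x(1) unfolding Xb_def by blast
      qed
      then show "l \<in> Xb" by (simp add: Xb_def)
    qed
    show "subspace Y" unfolding Y_def using bounded_linear.linear[OF J_bl] subW by (rule linear_subspace_image)
    have "complete Y" unfolding Y_def
    proof (rule complete_isometric_image[OF zero_less_one subW J_bl])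
      show "complete W" unfolding W_def by (simp add: complete_eq_closed)
    qed (use J_ge in simp)
    then show "closed Y" by (rule complete_imp_closed)
    show "Y \<subseteq> Xb"
    proof
      fix y assume "y \<in> Y"
      then obtain v where "v \<in> W" "y = J v" unfolding Y_def by blast
      moreover have "apply_bcontfun (J v) = (\<lambda>k. \<psi> k v)" using J by blast
      ultimately show "y \<in> Xb" using W_in by (simp add: Xb_def)
    qed
    show "countable D" unfolding D_def by (intro countable_image countableI_type)
    show "D \<subseteq> Y" unfolding D_def Y_def W_def by (intro image_mono closure_subset)
    show "Y \<subseteq> closure D" unfolding D_def Y_def W_def
      using linear_continuous_on[OF J_bl] closed_closure closure_subset by (rule image_closure_subset)
    show "operator_on Y (inv_into W J)"
      unfolding operator_on_def Y_def ball_simps(9)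
    proof (intro conjI ballI allI)
      fix u v assume "u \<in> W" "v \<in> W"
      then show "inv_into W J (J u + J v) = inv_into W J (J u) + inv_into W J (J v)"
        using inv[of "u + v"] subW by (simp add: inv J_add subspace_add)
    next
      fix a v assume "v \<in> W"
      then show "inv_into W J (a *\<^sub>R J v) = a *\<^sub>R inv_into W J (J v)"
        using inv[of "a *\<^sub>R v"] subW by (simp add: inv J_scale subspace_scale)
    next
      show "\<exists>K. \<forall>v\<in>W. norm (inv_into W J (J v)) \<le> K * norm (J v)"
        using J_ge by (intro exI[of _ 1]) (simp add: inv)
    qed
  qed
  then obtain T where T: "operator_on Xb T" "\<And>v. v \<in> W \<Longrightarrow> T (J v) = v"
    using inv unfolding Y_def by auto
  define S where "S f = T (Bcontfun f)" for f
  have Bin: "Bcontfun f \<in> Xb" "apply_bcontfun (Bcontfun f) = f" if "f \<in> X" for f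
  proof -
    show "apply_bcontfun (Bcontfun f) = f" using bdd[OF that] apply_Bcontfun by blast
    then show "Bcontfun f \<in> Xb" using that by (simp add: Xb_def)
  qed
  obtain K where K: "\<And>x. x \<in> Xb \<Longrightarrow> norm (T x) \<le> K * norm x"
    using T(1) unfolding operator_on_def by blast
  have "bounded_operator X S \<bar>K\<bar>"
  proof
    fix f g assume fg: "f \<in> X" "g \<in> X"
    have "Bcontfun (\<lambda>k. f k + g k) = Bcontfun f + Bcontfun g"
      using fg by (intro bcontfun_eqI) (simp add: Bin add)
    then show "S (\<lambda>k. f k + g k) = S f + S g"
      using T(1) Bin fg unfolding S_def operator_on_def by simp
  next
    fix a f assume f: "f \<in> X"
    have "Bcontfun (\<lambda>k. a * f k) = a *\<^sub>R Bcontfun f"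
      using f by (intro bcontfun_eqI) (simp add: Bin scale)
    then show "S (\<lambda>k. a * f k) = a *\<^sub>R S f"
      using T(1) Bin f unfolding S_def operator_on_def by simp
  next
    fix f M assume f: "f \<in> X" "\<And>k. \<bar>f k\<bar> \<le> M"
    have "norm (Bcontfun f) \<le> M" using f by (intro norm_bound) (simp add: Bin)
    then have "\<bar>K\<bar> * norm (Bcontfun f) \<le> \<bar>K\<bar> * M" by (intro mult_left_mono) auto
    moreover have "K * norm (Bcontfun f) \<le> \<bar>K\<bar> * norm (Bcontfun f)" by (intro mult_right_mono) auto
    ultimately show "norm (S f) \<le> \<bar>K\<bar> * M" using K[OF Bin(1)[OF f(1)]] unfolding S_def by linarith
  qed
  then have "embedded_span X S \<bar>K\<bar> e \<psi>"
  proof (intro embedded_span.intro embedded_span_axioms.intro)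
    fix v assume v: "v \<in> span (range e)"
    show "norm v \<le> c" if "\<And>k. \<bar>\<psi> k v\<bar> \<le> c" for c using v spanW that by (intro \<psi>(3)) (auto simp: W_def)
    show "(\<lambda>k. \<psi> k v) \<in> X" using v by (rule span_in)
    show "S (\<lambda>k. \<psi> k v) = v" unfolding S_def J_def[symmetric] using v spanW by (intro T(2)) auto
  qed (use \<psi> in auto)
  then show ?thesis by blast
qed

section \<open>The two algebras: all bounded functions, and label functions\<close>

definition bounded_functions :: "(nat \<Rightarrow> real) set" where
  "bounded_functions = {f. \<exists>M. \<forall>k. \<bar>f k\<bar> \<le> M}"

lemma function_algebra_bounded_functions: "function_algebra bounded_functions"
proof
  fix f g assume fg: "f \<in> bounded_functions" "g \<in> bounded_functions"
  then obtain M N where M: "\<And>k. \<bar>f k\<bar> \<le> M" and N: "\<And>k. \<bar>g k\<bar> \<le> N" unfolding bounded_functions_def by blast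
  have "\<bar>f k + g k\<bar> \<le> M + N" for k using M[of k] N[of k] by linarith
  then show "(\<lambda>k. f k + g k) \<in> bounded_functions" unfolding bounded_functions_def by blast
  have "\<bar>f k * g k\<bar> \<le> M * N" for k
    unfolding abs_mult using M[of k] N[of k] by (intro mult_mono) auto
  then show "(\<lambda>k. f k * g k) \<in> bounded_functions" unfolding bounded_functions_def by blast
next
  fix f assume lim: "\<And>e. e > 0 \<Longrightarrow> \<exists>g\<in>bounded_functions. \<forall>k. \<bar>f k - g k\<bar> \<le> e"
  obtain g where g: "g \<in> bounded_functions" "\<And>k. \<bar>f k - g k\<bar> \<le> 1" using lim[of 1] by auto
  then obtain M where M: "\<And>k. \<bar>g k\<bar> \<le> M" unfolding bounded_functions_def by blast
  have "\<bar>f k\<bar> \<le> M + 1" for k using M[of k] g(2)[of k] by linarith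
  then show "f \<in> bounded_functions" unfolding bounded_functions_def by blast
next
  fix f :: "nat \<Rightarrow> real" and t :: real assume "t > 0"
  have "indicat_real {k. t \<le> \<bar>f k\<bar>} \<in> bounded_functions"
    unfolding bounded_functions_def by (auto intro!: exI[of _ 1] simp: indicator_def)
  then show "\<exists>A. indicat_real A \<in> bounded_functions \<and> {k. 2 * t \<le> \<bar>f k\<bar>} \<subseteq> A \<and> A \<subseteq> {k. t \<le> \<bar>f k\<bar>}"
    using \<open>t > 0\<close> by (intro exI[of _ "{k. t \<le> \<bar>f k\<bar>}"]) auto
qed (auto simp: bounded_functions_def)

text \<open>A separable closed subalgebra of the bounded functions that is generated by its idempotents;
  it plays the role of \<open>C(K)\<close> for a metrizable totally disconnected compact \<open>K\<close>.\<close>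

definition label_functions :: "(nat \<Rightarrow> nat \<Rightarrow> int) \<Rightarrow> (nat \<Rightarrow> real) set" where
  "label_functions g =
     {f. \<forall>\<epsilon>>0. \<exists>n. \<forall>k l. (\<forall>p<n. g p k = g p l) \<longrightarrow> \<bar>f k - f l\<bar> \<le> \<epsilon>}"

text \<open>The fibres of \<open>labels g n\<close> are the cells of a partition of the natural
  numbers that is refined as n grows and is finite when each g p has finite range.\<close>

definition labels :: "(nat \<Rightarrow> nat \<Rightarrow> int) \<Rightarrow> nat \<Rightarrow> nat \<Rightarrow> int list" where
  "labels g n k = map (\<lambda>p. g p k) [0..<n]"

lemma labels_eq_iff: "labels g n k = labels g n l \<longleftrightarrow> (\<forall>p<n. g p k = g p l)"
  by (auto simp: labels_def)

lemma finite_labels: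
  assumes "\<And>p. finite (range (g p))"
  shows "finite (range (labels g n))"
proof (rule finite_subset)
  show "range (labels g n) \<subseteq> {xs. set xs \<subseteq> (\<Union>p<n. range (g p)) \<and> length xs = n}"
    by (auto simp: labels_def) blast
  show "finite {xs. set xs \<subseteq> (\<Union>p<n. range (g p)) \<and> length xs = n}"
    using assms by (intro finite_lists_length_eq) auto
qed

lemma label_functionsD:
  assumes "f \<in> label_functions g" "\<epsilon> > 0"
  shows "\<exists>n. \<forall>m\<ge>n. \<forall>k l. labels g m k = labels g m l \<longrightarrow> \<bar>f k - f l\<bar> \<le> \<epsilon>"
proof -
  obtain n where n: "\<And>k l. (\<forall>p<n. g p k = g p l) \<Longrightarrow> \<bar>f k - f l\<bar> \<le> \<epsilon>"
    using assms unfolding label_functions_def by blast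
  show ?thesis using n unfolding labels_eq_iff by (intro exI[of _ n]) auto
qed

lemma label_functionsI:
  assumes "\<And>\<epsilon>. \<epsilon> > 0 \<Longrightarrow> \<exists>n. \<forall>k l. labels g n k = labels g n l \<longrightarrow> \<bar>f k - f l\<bar> \<le> \<epsilon>"
  shows "f \<in> label_functions g"
  using assms unfolding label_functions_def labels_eq_iff by blast

text \<open>On each of finitely many label classes f varies by at most 1, so its values at
  representatives bound it.\<close>

lemma label_functions_bounded:
  assumes fin: "\<And>p. finite (range (g p))" and f: "f \<in> label_functions g"
  shows "\<exists>M. \<forall>k. \<bar>f k\<bar> \<le> M"
proof -
  obtain n where n: "\<And>k l m. m \<ge> n \<Longrightarrow> labels g m k = labels g m l \<Longrightarrow> \<bar>f k - f l\<bar> \<le> 1"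
    using label_functionsD[OF f zero_less_one] by blast
  define r where "r c = (SOME k. labels g n k = c)" for c
  have r: "labels g n (r (labels g n k)) = labels g n k" for k unfolding r_def by (rule someI) simp
  have "finite ((\<lambda>c. \<bar>f (r c)\<bar>) ` range (labels g n))" using finite_labels[OF fin] by simp
  then have 1: "\<bar>f (r (labels g n k))\<bar> \<le> Max ((\<lambda>c. \<bar>f (r c)\<bar>) ` range (labels g n))" for k by (intro Max_ge) auto
  have 2: "\<bar>f k - f (r (labels g n k))\<bar> \<le> 1" for k using n[of n k] r[of k] by simp
  have "\<bar>f k\<bar> \<le> Max ((\<lambda>c. \<bar>f (r c)\<bar>) ` range (labels g n)) + 1" for k
    using 1[of k] 2[of k] by linarith
  then show ?thesis by blast
qed

lemma function_algebra_label_functions: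
  assumes fin: "\<And>p. finite (range (g p))"
  shows "function_algebra (label_functions g)"
proof
  fix f assume "f \<in> label_functions g"
  then show "\<exists>M. \<forall>k. \<bar>f k\<bar> \<le> M" by (rule label_functions_bounded[OF fin])
  show "(\<lambda>k. \<bar>f k\<bar>) \<in> label_functions g"
  proof (rule label_functionsI)
    fix \<epsilon> :: real assume "\<epsilon> > 0"
    then obtain n where n: "\<And>k l m. m \<ge> n \<Longrightarrow> labels g m k = labels g m l \<Longrightarrow> \<bar>f k - f l\<bar> \<le> \<epsilon>"
      using label_functionsD[OF \<open>f \<in> label_functions g\<close>] by blast
    have "\<bar>\<bar>f k\<bar> - \<bar>f l\<bar>\<bar> \<le> \<epsilon>" if "labels g n k = labels g n l" for k l
      using order_trans[OF abs_triangle_ineq3 n[OF order_refl that]] .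
    then show "\<exists>n. \<forall>k l. labels g n k = labels g n l \<longrightarrow> \<bar>\<bar>f k\<bar> - \<bar>f l\<bar>\<bar> \<le> \<epsilon>" by blast
  qed
next
  show "(\<lambda>k. a) \<in> label_functions g" for a by (simp add: label_functions_def)
next
  fix f h assume fh: "f \<in> label_functions g" "h \<in> label_functions g"
  show "(\<lambda>k. f k + h k) \<in> label_functions g"
  proof (rule label_functionsI)
    fix \<epsilon> :: real assume "\<epsilon> > 0"
    then have \<epsilon>: "\<epsilon> / 2 > 0" by simp
    obtain n where n: "\<And>k l m. m \<ge> n \<Longrightarrow> labels g m k = labels g m l \<Longrightarrow> \<bar>f k - f l\<bar> \<le> \<epsilon> / 2"
      using label_functionsD[OF fh(1) \<epsilon>] by blast
    obtain n' where n': "\<And>k l m. m \<ge> n' \<Longrightarrow> labels g m k = labels g m l \<Longrightarrow> \<bar>h k - h l\<bar> \<le> \<epsilon> / 2"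
      using label_functionsD[OF fh(2) \<epsilon>] by blast
    have "\<bar>f k + h k - (f l + h l)\<bar> \<le> \<epsilon>" if "labels g (max n n') k = labels g (max n n') l" for k l
    proof -
      have "\<bar>f k - f l\<bar> \<le> \<epsilon> / 2" "\<bar>h k - h l\<bar> \<le> \<epsilon> / 2" using n[OF _ that] n'[OF _ that] by auto
      then show ?thesis by linarith
    qed
    then show "\<exists>n. \<forall>k l. labels g n k = labels g n l \<longrightarrow> \<bar>f k + h k - (f l + h l)\<bar> \<le> \<epsilon>" by blast
  qed
  obtain M where M: "\<And>k. \<bar>f k\<bar> \<le> M" using label_functions_bounded[OF fin fh(1)] by blast
  obtain N where N: "\<And>k. \<bar>h k\<bar> \<le> N" using label_functions_bounded[OF fin fh(2)] by blast
  show "(\<lambda>k. f k * h k) \<in> label_functions g"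
  proof (rule label_functionsI)
    fix \<epsilon> :: real assume \<epsilon>: "\<epsilon> > 0"
    define C where "C = \<bar>M\<bar> + \<bar>N\<bar> + 1"
    have C: "C > 0" "\<bar>f k\<bar> \<le> C" "\<bar>h k\<bar> \<le> C" for k using M[of k] N[of k] by (auto simp: C_def)
    have \<epsilon>': "\<epsilon> / (2 * C) > 0" using \<epsilon> C by simp
    obtain n where n: "\<And>k l m. m \<ge> n \<Longrightarrow> labels g m k = labels g m l \<Longrightarrow> \<bar>f k - f l\<bar> \<le> \<epsilon> / (2 * C)"
      using label_functionsD[OF fh(1) \<epsilon>'] by blast
    obtain n' where n': "\<And>k l m. m \<ge> n' \<Longrightarrow> labels g m k = labels g m l \<Longrightarrow> \<bar>h k - h l\<bar> \<le> \<epsilon> / (2 * C)"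
      using label_functionsD[OF fh(2) \<epsilon>'] by blast
    have "\<bar>f k * h k - f l * h l\<bar> \<le> \<epsilon>" if "labels g (max n n') k = labels g (max n n') l" for k l
    proof -
      have "f k * h k - f l * h l = (f k - f l) * h k + f l * (h k - h l)" by (simp add: algebra_simps)
      also have "\<bar>\<dots>\<bar> \<le> \<bar>(f k - f l) * h k\<bar> + \<bar>f l * (h k - h l)\<bar>" by (rule abs_triangle_ineq)
      also have "\<dots> = \<bar>f k - f l\<bar> * \<bar>h k\<bar> + \<bar>f l\<bar> * \<bar>h k - h l\<bar>" by (simp only: abs_mult)
      also have "\<dots> \<le> \<epsilon> / (2 * C) * C + C * (\<epsilon> / (2 * C))"
        using n[OF _ that] n'[OF _ that] C \<epsilon>' by (intro add_mono mult_mono) auto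
      also have "\<dots> = \<epsilon>" using C(1) by simp
      finally show ?thesis .
    qed
    then show "\<exists>n. \<forall>k l. labels g n k = labels g n l \<longrightarrow> \<bar>f k * h k - f l * h l\<bar> \<le> \<epsilon>" by blast
  qed
next
  fix f assume lim: "\<And>e. e > 0 \<Longrightarrow> \<exists>h\<in>label_functions g. \<forall>k. \<bar>f k - h k\<bar> \<le> e"
  show "f \<in> label_functions g"
  proof (rule label_functionsI)
    fix \<epsilon> :: real assume "\<epsilon> > 0"
    then have \<epsilon>: "\<epsilon> / 3 > 0" by simp
    obtain h where h: "h \<in> label_functions g" "\<And>k. \<bar>f k - h k\<bar> \<le> \<epsilon> / 3" using lim[OF \<epsilon>] by blast
    obtain n where n: "\<And>k l m. m \<ge> n \<Longrightarrow> labels g m k = labels g m l \<Longrightarrow> \<bar>h k - h l\<bar> \<le> \<epsilon> / 3"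
      using label_functionsD[OF h(1) \<epsilon>] by blast
    have "\<bar>f k - f l\<bar> \<le> \<epsilon>" if "labels g n k = labels g n l" for k l
      using n[OF order_refl that] h(2)[of k] h(2)[of l] by linarith
    then show "\<exists>n. \<forall>k l. labels g n k = labels g n l \<longrightarrow> \<bar>f k - f l\<bar> \<le> \<epsilon>" by blast
  qed
next
  fix f and t :: real assume f: "f \<in> label_functions g" and t: "t > 0"
  from label_functionsD[OF f t]
  obtain n where *: "\<forall>m\<ge>n. \<forall>k l. labels g m k = labels g m l \<longrightarrow> \<bar>f k - f l\<bar> \<le> t" by (elim exE)
  have n: "\<bar>f k - f l\<bar> \<le> t" if "labels g n k = labels g n l" for k l
    using *[rule_format, OF order_refl that] .
  \<comment> \<open>The union of the label classes that meet the upper level set; as f varies by at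
    most t on a class, it stays inside the lower level set.\<close>
  define A where "A = {k. \<exists>l. labels g n k = labels g n l \<and> 2 * t \<le> \<bar>f l\<bar>}"
  have "\<bar>indicat_real A k - indicat_real A l\<bar> \<le> 0" if "labels g n k = labels g n l" for k l
  proof -
    have "k \<in> A \<longleftrightarrow> l \<in> A" unfolding A_def mem_Collect_eq that ..
    then show ?thesis by (simp add: indicator_def)
  qed
  then have "indicat_real A \<in> label_functions g"
    by (intro label_functionsI exI[of _ n] allI impI) (meson less_imp_le order_trans)
  moreover have "{k. 2 * t \<le> \<bar>f k\<bar>} \<subseteq> A" by (auto simp: A_def)
  moreover have "t \<le> \<bar>f k\<bar>" if kA: "k \<in> A" for k
  proof -
    obtain l where "labels g n k = labels g n l" "2 * t \<le> \<bar>f l\<bar>"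
      using kA unfolding A_def by blast
    then show ?thesis using n[of k l] by simp
  qed
  then have "A \<subseteq> {k. t \<le> \<bar>f k\<bar>}" by blast
  ultimately show "\<exists>A. indicat_real A \<in> label_functions g \<and> {k. 2 * t \<le> \<bar>f k\<bar>} \<subseteq> A \<and> A \<subseteq> {k. t \<le> \<bar>f k\<bar>}"
    by (intro exI[of _ A] conjI)
qed

text \<open>Functions with rational values that are constant on the classes of finitely many labels
  are dense; association lists code them and form a countable type.\<close>

lemma label_functions_separable:
  assumes fin: "\<And>p. finite (range (g p))"
  shows "\<exists>D :: l_inf set. countable D \<and> D \<subseteq> {x. apply_bcontfun x \<in> label_functions g} \<and>
    {x. apply_bcontfun x \<in> label_functions g} \<subseteq> closure D"
proof -
  define s where "s = (\<lambda>(n, al :: (int list \<times> rat) list) k.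
     case map_of al (labels g n k) of None \<Rightarrow> 0 :: real | Some q \<Rightarrow> of_rat q)"
  define D where "D = range (\<lambda>z. Bcontfun (s z) :: l_inf)"
  have s_in: "s z \<in> label_functions g" for z
    by (rule label_functionsI, rule exI[of _ "fst z"]) (simp add: s_def case_prod_beta)
  have s_eq: "apply_bcontfun (Bcontfun (s z)) = s z" for z
    using label_functions_bounded[OF fin s_in[of z]] apply_Bcontfun by blast
  have "x \<in> closure D" if x: "apply_bcontfun x \<in> label_functions g" for x
    unfolding closure_approachable
  proof (intro allI impI)
    fix \<epsilon> :: real assume \<epsilon>: "\<epsilon> > 0"
    then have \<epsilon>3: "\<epsilon> / 3 > 0" by simp
    let ?f = "apply_bcontfun x"
    obtain n where n: "\<And>k l m. m \<ge> n \<Longrightarrow> labels g m k = labels g m l \<Longrightarrow> \<bar>?f k - ?f l\<bar> \<le> \<epsilon> / 3"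
      using label_functionsD[OF x \<epsilon>3] by blast
    define r where "r c = (SOME k. labels g n k = c)" for c
    have r: "labels g n (r (labels g n k)) = labels g n k" for k unfolding r_def by (rule someI) simp
    have "\<forall>c. \<exists>q. \<bar>?f (r c) - of_rat q\<bar> \<le> \<epsilon> / 3"
    proof
      fix c
      have "?f (r c) < ?f (r c) + \<epsilon> / 3" using \<epsilon> by simp
      from of_rat_dense[OF this] obtain q where "?f (r c) < of_rat q" "of_rat q < ?f (r c) + \<epsilon> / 3" by blast
      then show "\<exists>q. \<bar>?f (r c) - of_rat q\<bar> \<le> \<epsilon> / 3" by (intro exI[of _ q]) simp
    qed
    from choice[OF this] obtain q where q: "\<And>c. \<bar>?f (r c) - of_rat (q c)\<bar> \<le> \<epsilon> / 3" by blast
    obtain cs where cs: "set cs = range (labels g n)" using finite_list[OF finite_labels[where g = g and n = n, OF fin]] by blast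
    define z where "z = (n, map (\<lambda>c. (c, q c)) cs)"
    have sz: "s z k = of_rat (q (labels g n k))" for k
      by (simp add: s_def z_def map_of_map_restrict cs)
    have "norm (apply_bcontfun (Bcontfun (s z) - x) k) \<le> 2 * \<epsilon> / 3" for k
    proof -
      have "\<bar>?f (r (labels g n k)) - ?f k\<bar> \<le> \<epsilon> / 3" using n[OF order_refl r] .
      with q[of "labels g n k"] have "\<bar>of_rat (q (labels g n k)) - ?f k\<bar> \<le> 2 * \<epsilon> / 3" by linarith
      then show ?thesis by (simp add: s_eq sz)
    qed
    then have "norm (Bcontfun (s z) - x) \<le> 2 * \<epsilon> / 3" by (rule norm_bound)
    then have "dist (Bcontfun (s z)) x < \<epsilon>" using \<epsilon> by (simp add: dist_norm)
    then show "\<exists>y\<in>D. dist y x < \<epsilon>" unfolding D_def by blast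
  qed
  moreover have "countable D" unfolding D_def by simp
  moreover have "D \<subseteq> {x. apply_bcontfun x \<in> label_functions g}" using s_in s_eq by (auto simp: D_def)
  ultimately show ?thesis by blast
qed

text \<open>The algebra is made to measure for e: its labels record the coordinate functions of all
  e i to any precision, and also single points, whose isolation allows chosen coordinates to be kept
  exactly in the L_inf argument.\<close>

lemma separable_embedding:
  fixes e :: "nat \<Rightarrow> 'e::banach"
  assumes extend: "\<And>X Y D D' (t :: l_inf \<Rightarrow> 'e). subspace X \<Longrightarrow> closed X \<Longrightarrow> countable D' \<Longrightarrow> D' \<subseteq> X \<Longrightarrow> X \<subseteq> closure D' \<Longrightarrow>
      subspace Y \<Longrightarrow> closed Y \<Longrightarrow> Y \<subseteq> X \<Longrightarrow> countable D \<Longrightarrow> D \<subseteq> Y \<Longrightarrow> Y \<subseteq> closure D \<Longrightarrow>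
      operator_on Y t \<Longrightarrow> \<exists>T. operator_on X T \<and> (\<forall>y\<in>Y. T y = t y)"
  shows "\<exists>g S K \<psi>. (\<forall>p. finite (range (g p))) \<and> (\<forall>i. \<exists>p. \<forall>k. g p k = (if k = i then 1 else 0)) \<and>
    embedded_span (label_functions g) S K e \<psi>"
proof -
  obtain d :: "nat \<Rightarrow> 'e" and \<psi> :: "nat \<Rightarrow> 'e \<Rightarrow> real"
    where d: "range d \<subseteq> span (range e)" "span (range e) \<subseteq> closure (range d)"
    and \<psi>': "\<forall>k. linear (\<psi> k)" "\<forall>k v. \<bar>\<psi> k v\<bar> \<le> norm v"
      "\<forall>v\<in>closure (range d). \<forall>c. (\<forall>k. \<bar>\<psi> k v\<bar> \<le> c) \<longrightarrow> norm v \<le> c"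
    using norming_sequence[of e] by (elim exE conjE)
  have \<psi>: "linear (\<psi> k)" "\<bar>\<psi> k v\<bar> \<le> norm v"
    "v \<in> closure (range d) \<Longrightarrow> (\<And>k. \<bar>\<psi> k v\<bar> \<le> c) \<Longrightarrow> norm v \<le> c" for k v c
    using \<psi>' by auto
  \<comment> \<open>The label (i, 0) isolates the point i; for j > 0 the label (i, j) determines
    \<psi> k (e i) up to 1 / j.\<close>
  define g where "g p k = (let (i, j) = prod_decode p in
      if j = 0 then (if k = i then 1 else 0) else \<lfloor>real j * \<psi> k (e i)\<rfloor>)" for p k
  have fin: "finite (range (g p))" for p
  proof -
    obtain i j where ij: "prod_decode p = (i, j)" by (cases "prod_decode p")
    define M where "M = real j * norm (e i)"
    have "\<bar>real j * \<psi> k (e i)\<bar> \<le> M" for k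
      unfolding M_def abs_mult using \<psi>(2) by (simp add: mult_left_mono)
    then have "- M \<le> real j * \<psi> k (e i)" "real j * \<psi> k (e i) \<le> M" for k by (simp_all add: abs_le_iff minus_le_iff)
    then have "\<lfloor>- M\<rfloor> \<le> \<lfloor>real j * \<psi> k (e i)\<rfloor>" "\<lfloor>real j * \<psi> k (e i)\<rfloor> \<le> \<lfloor>M\<rfloor>" for k by (auto intro: floor_mono)
    then have "range (g p) \<subseteq> {0, 1} \<union> {\<lfloor>- M\<rfloor>..\<lfloor>M\<rfloor>}" by (auto simp: g_def ij)
    then show ?thesis by (rule finite_subset) simp
  qed
  have point: "\<exists>p. \<forall>k. g p k = (if k = i then 1 else 0)" for i
    by (rule exI[of _ "prod_encode (i, 0)"]) (simp add: g_def)
  have e_in: "(\<lambda>k. \<psi> k (e i)) \<in> label_functions g" for i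
  proof (rule label_functionsI)
    fix \<epsilon> :: real assume "\<epsilon> > 0"
    then obtain j where j: "inverse (Suc j) < \<epsilon>" using reals_Archimedean by blast
    define p where "p = prod_encode (i, Suc j)"
    have "\<bar>\<psi> k (e i) - \<psi> l (e i)\<bar> \<le> \<epsilon>" if "labels g (Suc p) k = labels g (Suc p) l" for k l
    proof -
      have "g p k = g p l" using that unfolding labels_eq_iff by simp
      then have "\<lfloor>real (Suc j) * \<psi> k (e i)\<rfloor> = \<lfloor>real (Suc j) * \<psi> l (e i)\<rfloor>" by (simp add: g_def p_def)
      then have "\<bar>real (Suc j) * \<psi> k (e i) - real (Suc j) * \<psi> l (e i)\<bar> < 1" by linarith
      then have "real (Suc j) * \<bar>\<psi> k (e i) - \<psi> l (e i)\<bar> < 1"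
        by (simp only: right_diff_distrib[symmetric] abs_mult abs_of_nat)
      then have "\<bar>\<psi> k (e i) - \<psi> l (e i)\<bar> < inverse (Suc j)" by (simp add: field_simps del: of_nat_Suc)
      with j show ?thesis by linarith
    qed
    then show "\<exists>n. \<forall>k l. labels g n k = labels g n l \<longrightarrow> \<bar>\<psi> k (e i) - \<psi> l (e i)\<bar> \<le> \<epsilon>" by blast
  qed
  obtain D' :: "l_inf set" where D': "countable D'" "D' \<subseteq> {x. apply_bcontfun x \<in> label_functions g}"
    "{x. apply_bcontfun x \<in> label_functions g} \<subseteq> closure D'"
    using label_functions_separable[of g, OF fin] by (elim exE conjE)
  have "\<exists>S K. embedded_span (label_functions g) S K e \<psi>"
  proof (rule embedding[OF function_algebra_label_functions[OF fin] d \<psi> e_in])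
    fix Xb Y D :: "l_inf set" and t :: "l_inf \<Rightarrow> 'e"
    assume Xb: "Xb = {x. apply_bcontfun x \<in> label_functions g}" "subspace Xb" "closed Xb"
      and Y: "subspace Y" "closed Y" "Y \<subseteq> Xb" "countable D" "D \<subseteq> Y" "Y \<subseteq> closure D" "operator_on Y t"
    show "\<exists>T. operator_on Xb T \<and> (\<forall>y\<in>Y. T y = t y)"
      by (rule extend[OF Xb(2,3) D'[folded Xb(1)] Y])
  qed
  then obtain S K where "embedded_span (label_functions g) S K e \<psi>" by (elim exE)
  then show ?thesis using fin point by (intro exI[of _ g] exI[of _ S] exI[of _ K] exI[of _ \<psi>] conjI allI)
qed

text \<open>As the supports are disjoint, the glued sum beyond N is bounded by the supremum of the
  coefficients beyond N. These tend to 0, so the sum is a uniform limit of finite sums.\<close>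

lemma (in function_algebra) glues_c0: "glues X c0_space"
  unfolding glues_def
proof (intro allI impI)
  fix A :: "nat \<Rightarrow> nat set" and f x assume A: "disjoint_family A" and f: "\<forall>n. f n \<in> X" "\<forall>n k. \<bar>f n k\<bar> \<le> indicat_real (A n) k"
    and x: "x \<in> c0_space"
  let ?a = "apply_bcontfun x"
  show "glue A f ?a \<in> X"
  proof (rule limit)
    fix \<epsilon> :: real assume \<epsilon>: "\<epsilon> > 0"
    have "?a \<longlonglongrightarrow> 0" using x by (simp add: c0_space_def)
    then obtain N where N: "\<And>n. n \<ge> N \<Longrightarrow> \<bar>?a n\<bar> < \<epsilon>" using LIMSEQ_D[OF _ \<epsilon>, of ?a 0] by auto
    have "(\<lambda>k. \<Sum>n<N. ?a n * f n k) \<in> X" using f(1) by (intro sum scale) auto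
    moreover have "\<bar>glue A f ?a k - (\<Sum>n<N. ?a n * f n k)\<bar> \<le> \<epsilon>" for k
    proof (cases "\<exists>n. k \<in> A n")
      case False
      then have "f n k = 0" for n using f(2)[rule_format, of n k] by simp
      then show ?thesis using False \<epsilon> by (simp add: glue_outside)
    next
      case True
      then obtain m where m: "k \<in> A m" by blast
      have "f n k = 0" if "n \<noteq> m" for n
      proof -
        have "k \<notin> A n" using A m that unfolding disjoint_family_on_def by blast
        then show ?thesis using f(2)[rule_format, of n k] by simp
      qed
      then have "(\<Sum>n<N. ?a n * f n k) = (\<Sum>n<N. if n = m then ?a m * f m k else 0)" by (intro sum.cong) auto
      also have "\<dots> = (if m < N then ?a m * f m k else 0)" by simp
      finally have eq: "(\<Sum>n<N. ?a n * f n k) = (if m < N then ?a m * f m k else 0)" .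
      have "\<bar>f m k\<bar> \<le> 1" using f(2)[rule_format, of m k] m by simp
      then have "\<bar>?a m * f m k\<bar> \<le> \<bar>?a m\<bar>" by (simp add: abs_mult mult_left_le)
      then show ?thesis unfolding eq glue_eq[OF A m] using N[of m] \<epsilon> by auto
    qed
    ultimately show "\<exists>g\<in>X. \<forall>k. \<bar>glue A f ?a k - g k\<bar> \<le> \<epsilon>"
      by (intro bexI[of _ "\<lambda>k. \<Sum>n<N. ?a n * f n k"] allI)
  qed
qed

lemma glues_bounded_functions: "glues bounded_functions UNIV"
  unfolding glues_def bounded_functions_def
proof (intro allI impI CollectI)
  fix A :: "nat \<Rightarrow> nat set" and f and x :: l_inf assume "\<forall>n k. \<bar>f n k\<bar> \<le> indicat_real (A n) k"
  then have "\<bar>glue A f (apply_bcontfun x) k\<bar> \<le> norm x" for k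
    using norm_bounded[of x] by (intro glue_le) auto
  then show "\<exists>M. \<forall>k. \<bar>glue A f (apply_bcontfun x) k\<bar> \<le> M" by blast
qed

lemma spread_sequence:
  fixes x :: l_inf and e :: "nat \<Rightarrow> nat"
  assumes "strict_mono e"
  shows "\<exists>y :: l_inf. (\<forall>j\<in>J. apply_bcontfun y (e j) = apply_bcontfun x j) \<and>
    (\<forall>n. n \<notin> e ` J \<longrightarrow> apply_bcontfun y n = 0)"
proof -
  define f where "f n = (if n \<in> e ` J then apply_bcontfun x (inv e n) else 0)" for n
  have "\<forall>n. \<bar>f n\<bar> \<le> norm x" using norm_bounded[of x] by (auto simp: f_def)
  then have "apply_bcontfun (Bcontfun f) = f" by (rule apply_Bcontfun)
  moreover have "inv e (e j) = j" for j using assms by (simp add: strict_mono_imp_inj_on)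
  ultimately show ?thesis by (intro exI[of _ "Bcontfun f"]) (auto simp: f_def)
qed

lemma sequence_space_UNIV: "sequence_space UNIV"
proof
  fix x :: l_inf and J and e :: "nat \<Rightarrow> nat" assume e: "strict_mono e"
  from spread_sequence[OF e] show "\<exists>y\<in>UNIV. (\<forall>j\<in>J. apply_bcontfun y (e j) = apply_bcontfun x j) \<and>
      (\<forall>n. n \<notin> e ` J \<longrightarrow> apply_bcontfun y n = 0)" by simp
qed (auto simp: subspace_UNIV)

lemma sequence_space_c0: "sequence_space c0_space"
proof
  show "subspace c0_space"
    unfolding subspace_def c0_space_def
    by (auto intro: tendsto_add_zero tendsto_mult_right_zero)
  show "closed c0_space"
    unfolding closed_sequential_limits
  proof (intro allI impI, elim conjE)
    fix x :: "nat \<Rightarrow> l_inf" and l assume x: "\<forall>n. x n \<in> c0_space" "x \<longlonglongrightarrow> l"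
    have "apply_bcontfun l \<longlonglongrightarrow> 0"
    proof (rule LIMSEQ_I)
      fix r :: real assume "r > 0"
      then have r: "r / 2 > 0" by simp
      obtain n where n: "norm (x n - l) < r / 2" using LIMSEQ_D[OF x(2) r] by blast
      have "apply_bcontfun (x n) \<longlonglongrightarrow> 0" using x(1) by (simp add: c0_space_def)
      then obtain N where N: "\<And>k. k \<ge> N \<Longrightarrow> \<bar>apply_bcontfun (x n) k\<bar> < r / 2"
        using LIMSEQ_D[OF _ r, of "apply_bcontfun (x n)" 0] by auto
      have "norm (apply_bcontfun l k - 0) < r" if "k \<ge> N" for k
        using N[OF that] norm_bounded[of "x n - l" k] n by simp
      then show "\<exists>N. \<forall>k\<ge>N. norm (apply_bcontfun l k - 0) < r" by blast
    qed
    then show "l \<in> c0_space" by (simp add: c0_space_def)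
  qed
next
  fix x J and e :: "nat \<Rightarrow> nat" assume x: "x \<in> c0_space" and e: "strict_mono e"
  obtain y :: l_inf where y: "\<forall>j\<in>J. apply_bcontfun y (e j) = apply_bcontfun x j"
    "\<forall>n. n \<notin> e ` J \<longrightarrow> apply_bcontfun y n = 0" using spread_sequence[OF e, of J x] by (elim exE conjE)
  have x0: "apply_bcontfun x \<longlonglongrightarrow> 0" using x by (simp add: c0_space_def)
  have "apply_bcontfun y \<longlonglongrightarrow> 0"
  proof (rule LIMSEQ_I)
    fix r :: real assume r: "r > 0"
    obtain N where N: "\<And>k. k \<ge> N \<Longrightarrow> \<bar>apply_bcontfun x k\<bar> < r" using LIMSEQ_D[OF x0 r] by auto
    have "norm (apply_bcontfun y n - 0) < r" if "n \<ge> e N" for n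
    proof (cases "n \<in> e ` J")
      case True
      then obtain j where j: "j \<in> J" "n = e j" by blast
      then have "N \<le> j" using that strict_mono_less_eq[OF e] by simp
      then show ?thesis using N[of j] y(1) j by simp
    qed (use y(2) r in simp)
    then show "\<exists>N. \<forall>k\<ge>N. norm (apply_bcontfun y k - 0) < r" by blast
  qed
  then show "\<exists>y\<in>c0_space. (\<forall>j\<in>J. apply_bcontfun y (e j) = apply_bcontfun x j) \<and>
      (\<forall>n. n \<notin> e ` J \<longrightarrow> apply_bcontfun y n = 0)"
    using y by (intro bexI[of _ y]) (auto simp: c0_space_def)
qed simp

subsection \<open>Finite-dimensional sup-normed subspaces\<close>

text \<open>The estimates bound the map a \<mapsto> \<Sum> a i s i on the N-dimensional sup-normed
  space by K and its inverse by 1 / c. The lower one also makes the vectors independent, so that the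
  span has dimension N.\<close>

lemma banach_mazur_dist_span:
  fixes s :: "nat \<Rightarrow> 'e::banach"
  assumes c: "c > 0" "\<And>a i. i < N \<Longrightarrow> c * \<bar>a i\<bar> \<le> norm (\<Sum>i<N. a i *\<^sub>R s i)"
    and K: "K \<ge> 0" "\<And>a M. (\<And>i. i < N \<Longrightarrow> \<bar>a i\<bar> \<le> M) \<Longrightarrow> M \<ge> 0 \<Longrightarrow> norm (\<Sum>i<N. a i *\<^sub>R s i) \<le> K * M"
  shows "finite_dim_subspace (span (s ` {..<N}))"
    and "banach_mazur_dist (span (s ` {..<N})) (l_inf_dim (dim (span (s ` {..<N})))) \<le> ereal (K / c)"
proof -
  let ?F = "span (s ` {..<N})"
  have "finite (s ` {..<N})" by simp
  then show fin: "finite_dim_subspace ?F"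
    unfolding finite_dim_subspace_def by (intro conjI subspace_span exI[of _ "s ` {..<N}"]) auto
  have zero: "a i = 0" if "(\<Sum>i<N. a i *\<^sub>R s i) = 0" "i < N" for a i
    using c(2)[OF that(2), of a] that(1) c(1) by (simp add: mult_le_0_iff)
  have inj: "inj_on s {..<N}"
  proof (rule inj_onI, rule ccontr)
    fix i j assume ij: "i \<in> {..<N}" "j \<in> {..<N}" "s i = s j" "i \<noteq> j"
    define a where "a k = (if k = i then 1 else if k = j then -1 else 0 :: real)" for k
    have "(\<Sum>k<N. a k *\<^sub>R s k) = (\<Sum>k\<in>{i, j}. a k *\<^sub>R s k)"
      using ij by (intro sum.mono_neutral_right) (auto simp: a_def)
    also have "\<dots> = 0" using ij by (simp add: a_def)
    finally have "a i = 0" using ij by (intro zero) auto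
    then show False by (simp add: a_def)
  qed
  have "independent (s ` {..<N})"
  proof (rule ccontr)
    assume "\<not> independent (s ` {..<N})"
    then obtain u v where u: "v \<in> s ` {..<N}" "u v \<noteq> 0" "(\<Sum>v\<in>s ` {..<N}. u v *\<^sub>R v) = 0"
      using dependent_finite[of "s ` {..<N}"] by auto
    then have "(\<Sum>i<N. u (s i) *\<^sub>R s i) = 0" by (simp add: sum.reindex[OF inj])
    then show False using zero[of "\<lambda>i. u (s i)"] u by auto
  qed
  then have dim: "dim ?F = N"
    using dim_span_eq_card_independent[of "s ` {..<N}"] card_image[OF inj] by simp
  define g where "g x = (\<Sum>i<N. apply_bcontfun x i *\<^sub>R s i)" for x :: l_inf
  let ?Z = "l_inf_dim N"
  have subZ: "subspace ?Z" by (auto simp: subspace_def l_inf_dim_def)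
  have g_add: "g (x + y) = g x + g y" and g_scale: "g (a *\<^sub>R x) = a *\<^sub>R g x" for x y a
    by (simp_all add: g_def scaleR_add_left sum.distrib scaleR_sum_right)
  have g_le: "norm (g x) \<le> K * norm x" for x
    unfolding g_def using norm_bounded[of x] by (intro K(2)) auto
  have g_ge: "c * norm x \<le> norm (g x)" if x: "x \<in> ?Z" for x
  proof -
    have "norm (apply_bcontfun x i) \<le> norm (g x) / c" for i
    proof (cases "i < N")
      case True
      then show ?thesis using c(2)[OF True, of "apply_bcontfun x"] c(1) by (simp add: g_def field_simps)
    next
      case False
      then show ?thesis using x c(1) by (simp add: l_inf_dim_def)
    qed
    then have "norm x \<le> norm (g x) / c" by (rule norm_bound)
    then show ?thesis using c(1) by (simp add: field_simps)
  qed
  have coef: "\<exists>x\<in>?Z. \<forall>i<N. apply_bcontfun x i = a i" for a :: "nat \<Rightarrow> real"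
  proof -
    define f where "f i = (if i < N then a i else 0)" for i
    have "\<bar>f i\<bar> \<le> (\<Sum>i<N. \<bar>a i\<bar>)" for i
      by (cases "i < N") (auto simp: f_def intro: member_le_sum sum_nonneg)
    then have "apply_bcontfun (Bcontfun f) = f" by (intro apply_Bcontfun) blast
    then show ?thesis by (intro bexI[of _ "Bcontfun f"]) (auto simp: f_def l_inf_dim_def)
  qed
  have img: "g ` ?Z = ?F"
  proof
    show "g ` ?Z \<subseteq> ?F"
    proof (rule image_subsetI)
      show "g x \<in> ?F" for x unfolding g_def by (intro span_sum span_scale span_base) auto
    qed
    have "linear g" by (rule linearI) (simp_all only: g_add g_scale)
    then have "subspace (g ` ?Z)" using subZ by (rule linear_subspace_image)
    moreover have "s j \<in> g ` ?Z" if "j < N" for j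
    proof -
      obtain x where x: "x \<in> ?Z" "\<forall>i<N. apply_bcontfun x i = (if i = j then 1 else 0)" 
        using coef[of "\<lambda>i. if i = j then 1 else 0"] by blast
      have "g x = (\<Sum>i<N. if i = j then s i else 0)" unfolding g_def using x(2) by (intro sum.cong) auto
      then have "g x = s j" using that by simp
      then show ?thesis using x(1) by (intro image_eqI[of _ _ x]) simp_all
    qed
    ultimately show "?F \<subseteq> g ` ?Z" by (intro span_minimal) auto
  qed
  have iso: "isomorphism_on ?Z ?F g"
    by (rule isomorphism_onI[OF subZ g_add g_scale g_le c(1) g_ge img])
  then have inv: "inv_into ?Z g (g x) = x" if "x \<in> ?Z" for x
    using that by (auto simp: isomorphism_on_def bij_betw_def inv_into_f_f)
  define f where "f = inv_into ?Z g"
  have f_le: "norm (f v) \<le> (1 / c) * norm v" if v: "v \<in> ?F" for v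
  proof -
    obtain x where "x \<in> ?Z" "v = g x" using v unfolding img[symmetric] by blast
    then show ?thesis using g_ge[of x] c(1) by (simp add: f_def inv field_simps)
  qed
  have Kpos: "K + 1 > 0" using K(1) by simp
  have isof: "isomorphism_on ?F ?Z f"
  proof (rule isomorphism_onI[OF subspace_span])
    show "f (u + v) = f u + f v" if "u \<in> ?F" "v \<in> ?F" for u v
      using iso that unfolding isomorphism_on_def operator_on_def f_def by blast
    show "f (a *\<^sub>R u) = a *\<^sub>R f u" if "u \<in> ?F" for a u
      using iso that unfolding isomorphism_on_def operator_on_def f_def by blast
    show "norm (f v) \<le> (1 / c) * norm v" if "v \<in> ?F" for v using that by (rule f_le)
    show "1 / (K + 1) > 0" using Kpos by simp
    show "1 / (K + 1) * norm v \<le> norm (f v)" if v: "v \<in> ?F" for v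
    proof -
      obtain x where x: "x \<in> ?Z" "v = g x" using v unfolding img[symmetric] by blast
      have "norm x * (K + 1) = K * norm x + norm x" by (simp add: algebra_simps)
      with g_le[of x] norm_ge_zero[of x] have "norm v \<le> norm x * (K + 1)" unfolding x(2) by linarith
      then show ?thesis using x Kpos by (simp add: f_def inv field_simps)
    qed
    show "f ` ?F = ?Z" unfolding img[symmetric] using inv by (force simp: f_def)
  qed
  have finv: "inv_into ?F f x = g x" if "x \<in> ?Z" for x
  proof -
    have "inj_on f ?F" using isof by (simp add: isomorphism_on_def bij_betw_def)
    moreover have "g x \<in> ?F" using that img by blast
    ultimately have "inv_into ?F f (f (g x)) = g x" by (rule inv_into_f_f)
    then show ?thesis using that by (simp add: f_def inv)
  qed
  have 1: "onorm_on ?F f \<le> 1 / c"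
    unfolding onorm_on_def
  proof (rule cSUP_least)
    show "{x \<in> ?F. norm x \<le> 1} \<noteq> {}" using span_zero by force
    fix v assume "v \<in> {x \<in> ?F. norm x \<le> 1}"
    then have "norm (f v) \<le> (1 / c) * norm v" "norm v \<le> 1" using f_le by auto
    moreover have "(1 / c) * norm v \<le> (1 / c) * 1" using c(1) calculation(2) by (intro mult_left_mono) auto
    ultimately show "norm (f v) \<le> 1 / c" by simp
  qed
  have le_K: "norm (inv_into ?F f x) \<le> K" if "x \<in> ?Z" "norm x \<le> 1" for x
  proof -
    have "K * norm x \<le> K * 1" using K(1) that(2) by (intro mult_left_mono) auto
    then show ?thesis using g_le[of x] finv[OF that(1)] by simp
  qed
  have 2: "onorm_on ?Z (inv_into ?F f) \<le> K"
    unfolding onorm_on_def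
  proof (rule cSUP_least)
    show "{x \<in> ?Z. norm x \<le> 1} \<noteq> {}" using subspace_0[OF subZ] by force
  qed (use le_K in auto)
  have 3: "0 \<le> onorm_on ?Z (inv_into ?F f)"
    unfolding onorm_on_def
  proof (rule cSUP_upper2)
    show "0 \<in> {x \<in> ?Z. norm x \<le> 1}" using subspace_0[OF subZ] by simp
    show "bdd_above ((\<lambda>x. norm (inv_into ?F f x)) ` {x \<in> ?Z. norm x \<le> 1})"
      using le_K by (intro bdd_aboveI[of _ K]) auto
  qed simp
  have "onorm_on ?F f * onorm_on ?Z (inv_into ?F f) \<le> 1 / c * K"
    using 1 2 3 c(1) by (intro mult_mono) auto
  then have "ereal (onorm_on ?F f * onorm_on ?Z (inv_into ?F f)) \<le> ereal (K / c)" by simp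
  moreover have "banach_mazur_dist ?F ?Z \<le> ereal (onorm_on ?F f * onorm_on ?Z (inv_into ?F f))"
    unfolding banach_mazur_dist_def using isof by (intro INF_lower) simp
  ultimately show "banach_mazur_dist ?F (l_inf_dim (dim ?F)) \<le> ereal (K / c)"
    unfolding dim by (rule order_trans[rotated])
qed

text \<open>Finitely many \<psi> k allow the points of a finite-dimensional space to be
  reconstructed linearly. By induction there is such a projection P onto span B; adding the rank-one
  term (\<psi> k (v - P v) / \<psi> k z) z makes it fix b as well.\<close>

lemma reproducing_vectors:
  fixes B :: "'e::real_vector set" and \<psi> :: "nat \<Rightarrow> 'e \<Rightarrow> real"
  assumes "finite B" and \<psi>: "\<And>k. linear (\<psi> k)"
    and sep: "\<And>v. v \<in> span B \<Longrightarrow> (\<And>k. \<psi> k v = 0) \<Longrightarrow> v = 0"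
  shows "\<exists>m h. (\<forall>i<m. h i \<in> span B) \<and> (\<forall>v\<in>span B. (\<Sum>i<m. \<psi> i v *\<^sub>R h i) = v)"
  using assms(1) sep
proof (induction B)
  case empty
  then show ?case by (intro exI[of _ 0]) simp
next
  case (insert b B)
  have sub: "span B \<subseteq> span (insert b B)" by (intro span_mono) auto
  have "\<exists>m h. (\<forall>i<m. h i \<in> span B) \<and> (\<forall>v\<in>span B. (\<Sum>i<m. \<psi> i v *\<^sub>R h i) = v)"
    using sub insert.prems by (intro insert.IH) blast
  then obtain m h where h: "\<And>i. i < m \<Longrightarrow> h i \<in> span B" "\<And>v. v \<in> span B \<Longrightarrow> (\<Sum>i<m. \<psi> i v *\<^sub>R h i) = v"
    by blast
  define P where "P v = (\<Sum>i<m. \<psi> i v *\<^sub>R h i)" for v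
  have P_in: "P v \<in> span B" for v unfolding P_def using h(1) by (intro span_sum span_scale) auto
  have PB: "P v = v" if "v \<in> span B" for v unfolding P_def using that by (rule h(2))
  define z where "z = b - P b"
  have z: "z \<in> span (insert b B)"
    unfolding z_def using sub P_in by (intro span_diff) (auto intro: span_base)
  show ?case
  proof (cases "z = 0")
    case True
    then have "b \<in> span B" using P_in[of b] by (simp add: z_def)
    then have "span (insert b B) = span B" by (rule span_redundant)
    then show ?thesis using h by (intro exI[of _ m] exI[of _ h]) simp
  next
    case False
    then obtain k where k: "\<psi> k z \<noteq> 0" using insert.prems[OF z] by blast
    \<comment> \<open>The coefficient of \<psi> i v in the corrected projection, whose formula is
      recovered in \<open>Q\<close>.\<close>
    define h' where "h' i = (if i < m then h i - (\<psi> k (h i) / \<psi> k z) *\<^sub>R z else 0) +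
        (if i = k then (1 / \<psi> k z) *\<^sub>R z else 0)" for i
    define m' where "m' = max m (Suc k)"
    define Q where "Q v = (\<Sum>i<m'. \<psi> i v *\<^sub>R h' i)" for v
    have Q: "Q v = P v + ((\<psi> k v - \<psi> k (P v)) / \<psi> k z) *\<^sub>R z" for v
    proof -
      have "Q v = (\<Sum>i<m'. \<psi> i v *\<^sub>R (if i < m then h i - (\<psi> k (h i) / \<psi> k z) *\<^sub>R z else 0)) +
          (\<Sum>i<m'. \<psi> i v *\<^sub>R (if i = k then (1 / \<psi> k z) *\<^sub>R z else 0))"
        unfolding Q_def h'_def by (simp add: scaleR_add_right sum.distrib)
      also have "(\<Sum>i<m'. \<psi> i v *\<^sub>R (if i < m then h i - (\<psi> k (h i) / \<psi> k z) *\<^sub>R z else 0)) =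
          (\<Sum>i<m. \<psi> i v *\<^sub>R (h i - (\<psi> k (h i) / \<psi> k z) *\<^sub>R z))"
        by (rule sum.mono_neutral_cong_right) (auto simp: m'_def)
      also have "\<dots> = P v - (\<psi> k (P v) / \<psi> k z) *\<^sub>R z"
        unfolding P_def linear_sum[OF \<psi>] linear_scale[OF \<psi>]
        by (simp add: scaleR_diff_right sum_subtractf scaleR_sum_left sum_divide_distrib)
      also have "(\<Sum>i<m'. \<psi> i v *\<^sub>R (if i = k then (1 / \<psi> k z) *\<^sub>R z else 0)) =
          (\<Sum>i<m'. if i = k then (\<psi> k v / \<psi> k z) *\<^sub>R z else 0)"
        by (intro sum.cong) auto
      also have "\<dots> = (\<psi> k v / \<psi> k z) *\<^sub>R z" by (simp add: m'_def less_max_iff_disj)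
      finally show ?thesis by (simp add: diff_divide_distrib scaleR_diff_left)
    qed
    have linQ: "linear Q"
      unfolding Q_def using \<psi> by (intro linearI) (simp_all add: linear_add linear_scale scaleR_add_left sum.distrib scaleR_sum_right)
    have "Q v = v" if "v \<in> span (insert b B)" for v
    proof (rule linear_eq_on[OF linQ linear_id that, unfolded id_apply])
      fix x assume x: "x \<in> insert b B"
      show "Q x = x"
      proof (cases "x = b")
        case True
        have "\<psi> k b - \<psi> k (P b) = \<psi> k z" by (simp add: z_def linear_diff[OF \<psi>])
        then have "Q b = P b + z" using k by (simp add: Q)
        then show ?thesis using True by (simp add: z_def)
      next
        case False
        then have "P x = x" using x by (intro PB span_base) auto
        then show ?thesis by (simp add: Q)
      qed
    qed
    moreover have "h' i \<in> span (insert b B)" for i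
      unfolding h'_def using h(1) sub z by (auto intro!: span_add span_diff span_scale span_zero)
    ultimately show ?thesis unfolding Q_def by (intro exI[of _ m'] exI[of _ h']) blast
  qed
qed

text \<open>The whole space serves as F for every G, so its distance to the sup-normed space only
  has to be finite. Coordinates in a basis are bounded by means of finitely many functionals of norm
  at most 1.\<close>

lemma finite_dim_L_inf:
  assumes "\<not> infinite_dimensional TYPE('e::banach)"
  shows "L_inf_space TYPE('e)"
proof -
  obtain B0 :: "'e set" where B0: "finite B0" "UNIV = span B0"
    using assms unfolding infinite_dimensional_def finite_dim_subspace_def by blast
  obtain B where B: "B \<subseteq> B0" "independent B" "B0 \<subseteq> span B"
    using maximal_independent_subset[of B0] by metis
  have finB: "finite B" using B(1) B0(1) finite_subset by blast
  have spanB: "span B = UNIV" using span_minimal[OF B(3) subspace_span] B0(2) by blast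
  define N where "N = card B"
  obtain s where s: "bij_betw s {..<N} B"
    using ex_bij_betw_nat_finite[OF finB] by (auto simp: N_def atLeast0LessThan)
  then have sB: "s ` {..<N} = B" "inj_on s {..<N}" by (auto simp: bij_betw_def)
  obtain e :: "nat \<Rightarrow> 'e" where e: "range e = insert 0 B"
    using range_from_nat_into[of "insert 0 B"] finB by (metis countable_finite finite_insert insert_not_empty)
  obtain d :: "nat \<Rightarrow> 'e" and \<psi> :: "nat \<Rightarrow> 'e \<Rightarrow> real"
    where d: "range d \<subseteq> span (range e)" "span (range e) \<subseteq> closure (range d)"
    and \<psi>: "\<forall>k. linear (\<psi> k)" "\<forall>k v. \<bar>\<psi> k v\<bar> \<le> norm v"
      "\<forall>v\<in>closure (range d). \<forall>c. (\<forall>k. \<bar>\<psi> k v\<bar> \<le> c) \<longrightarrow> norm v \<le> c"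
    using norming_sequence[of e] by (elim exE conjE)
  have "span (range e) = UNIV" using spanB by (simp add: e span_insert_0)
  then have cl: "closure (range d) = UNIV" using d(2) by blast
  have "v = 0" if "\<And>k. \<psi> k v = 0" for v
  proof -
    have "norm v \<le> 0" using \<psi>(3)[rule_format, of v 0] cl that by simp
    then show ?thesis by simp
  qed
  then obtain m h where h: "\<And>v. (\<Sum>i<m. \<psi> i v *\<^sub>R h i) = v"
    using reproducing_vectors[OF finB, of \<psi>] \<psi>(1) spanB by auto
  define C where "C = 1 + (\<Sum>i<m. \<Sum>b\<in>B. \<bar>representation B (h i) b\<bar>)"
  have C: "C > 0" unfolding C_def by (intro add_pos_nonneg sum_nonneg) auto
  have lower: "(1 / C) * \<bar>a j\<bar> \<le> norm (\<Sum>i<N. a i *\<^sub>R s i)" if j: "j < N" for a j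
  proof -
    define v where "v = (\<Sum>i<N. a i *\<^sub>R s i)"
    have sj: "s j \<in> B" using j sB(1) by blast
    have rs: "representation B (s i) (s j) = (if i = j then 1 else 0)" if "i < N" for i
      using representation_basis[OF B(2), of "s i"] that sB j by (auto simp: inj_on_def)
    have "representation B v (s j) = (\<Sum>i<N. a i * representation B (s i) (s j))"
      unfolding v_def using spanB by (simp add: representation_sum[OF B(2)] representation_scale[OF B(2)])
    also have "\<dots> = (\<Sum>i<N. if i = j then a j else 0)" using rs by (intro sum.cong) auto
    finally have "a j = representation B v (s j)" using j by simp
    also have "\<dots> = representation B (\<Sum>i<m. \<psi> i v *\<^sub>R h i) (s j)" by (simp add: h)
    also have "\<dots> = (\<Sum>i<m. \<psi> i v * representation B (h i) (s j))"
      using spanB by (simp add: representation_sum[OF B(2)] representation_scale[OF B(2)])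
    finally have "\<bar>a j\<bar> \<le> (\<Sum>i<m. \<bar>\<psi> i v * representation B (h i) (s j)\<bar>)" by (simp add: sum_abs)
    also have "\<dots> \<le> (\<Sum>i<m. norm v * (\<Sum>b\<in>B. \<bar>representation B (h i) b\<bar>))"
      unfolding abs_mult using \<psi>(2) finB sj
      by (intro sum_mono mult_mono) (auto intro!: member_le_sum[of "s j" B "\<lambda>b. \<bar>representation B (h _) b\<bar>"] sum_nonneg)
    also have "\<dots> \<le> norm v * C" unfolding C_def by (simp add: sum_distrib_left[symmetric] distrib_left)
    finally show ?thesis using C by (simp add: v_def field_simps)
  qed
  define K where "K = (\<Sum>i<N. norm (s i))"
  have K: "K \<ge> 0" unfolding K_def by (intro sum_nonneg) auto
  have upper: "norm (\<Sum>i<N. a i *\<^sub>R s i) \<le> K * M" if "\<And>i. i < N \<Longrightarrow> \<bar>a i\<bar> \<le> M" for a M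
  proof -
    have "norm (\<Sum>i<N. a i *\<^sub>R s i) \<le> (\<Sum>i<N. \<bar>a i\<bar> * norm (s i))" by (rule sum_norm_le) simp
    also have "\<dots> \<le> (\<Sum>i<N. M * norm (s i))" using that by (intro sum_mono mult_right_mono) auto
    finally show ?thesis by (simp add: K_def sum_distrib_left mult.commute)
  qed
  have C': "1 / C > 0" using C by simp
  note F = banach_mazur_dist_span[OF C' lower K upper]
  define lam where "lam = max 1 (K / (1 / C))"
  have "banach_mazur_dist (UNIV :: 'e set) (l_inf_dim (dim (UNIV :: 'e set))) \<le> ereal lam"
  proof -
    have "K / (1 / C) \<le> lam" unfolding lam_def by (rule max.cobounded2)
    then have "ereal (K / (1 / C)) \<le> ereal lam" by simp
    then show ?thesis using F(2) unfolding sB(1) spanB by (rule order_trans[rotated])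
  qed
  moreover have "finite_dim_subspace (UNIV :: 'e set)" using F(1) unfolding sB(1) spanB by simp
  moreover have "1 \<le> lam" by (simp add: lam_def)
  ultimately show ?thesis unfolding L_inf_space_def by (intro exI[of _ lam] conjI allI impI exI[of _ UNIV]) auto
qed

text \<open>Two combinations with disjoint supports, both annihilated by the earlier functionals,
  have a nontrivial combination that the new functional annihilates too. The freedom in p provides
  the second one, supported beyond the first.\<close>

lemma kernel_combination:
  fixes w :: "nat \<Rightarrow> 'e::real_vector"
  assumes "finite \<Phi>" "\<forall>\<phi>\<in>\<Phi>. linear (\<phi> :: 'e \<Rightarrow> real)"
  shows "\<exists>L \<beta>. (\<forall>j. \<beta> j \<noteq> 0 \<longrightarrow> p \<le> j \<and> j < L) \<and> (\<exists>j. \<beta> j \<noteq> 0) \<and>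
    (\<forall>\<phi>\<in>\<Phi>. \<phi> (\<Sum>j<L. \<beta> j *\<^sub>R w j) = 0)"
  using assms
proof (induction \<Phi> arbitrary: p)
  case empty
  show ?case by (intro exI[of _ "Suc p"] exI[of _ "\<lambda>j. if j = p then 1 else 0"]) auto
next
  case (insert \<phi> \<Phi>)
  have lin: "linear \<phi>" and lin': "\<forall>\<phi>'\<in>\<Phi>. linear \<phi>'" using insert.prems by auto
  obtain L \<beta> where "(\<forall>j. \<beta> j \<noteq> 0 \<longrightarrow> p \<le> j \<and> j < L) \<and> (\<exists>j. \<beta> j \<noteq> 0) \<and>
    (\<forall>\<phi>\<in>\<Phi>. \<phi> (\<Sum>j<L. \<beta> j *\<^sub>R w j) = 0)" using insert.IH[OF lin', of p] by (elim exE)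
  then have \<beta>: "\<forall>j. \<beta> j \<noteq> 0 \<longrightarrow> p \<le> j \<and> j < L" "\<exists>j. \<beta> j \<noteq> 0"
    "\<forall>\<phi>\<in>\<Phi>. \<phi> (\<Sum>j<L. \<beta> j *\<^sub>R w j) = 0" by simp_all
  obtain L' \<beta>' where "(\<forall>j. \<beta>' j \<noteq> 0 \<longrightarrow> max p L \<le> j \<and> j < L') \<and> (\<exists>j. \<beta>' j \<noteq> 0) \<and>
    (\<forall>\<phi>\<in>\<Phi>. \<phi> (\<Sum>j<L'. \<beta>' j *\<^sub>R w j) = 0)" using insert.IH[OF lin', of "max p L"] by (elim exE)
  then have \<beta>': "\<forall>j. \<beta>' j \<noteq> 0 \<longrightarrow> max p L \<le> j \<and> j < L'" "\<exists>j. \<beta>' j \<noteq> 0"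
    "\<forall>\<phi>\<in>\<Phi>. \<phi> (\<Sum>j<L'. \<beta>' j *\<^sub>R w j) = 0" by simp_all
  define x where "x = (\<Sum>j<L. \<beta> j *\<^sub>R w j)"
  define x' where "x' = (\<Sum>j<L'. \<beta>' j *\<^sub>R w j)"
  show ?case
  proof (cases "\<phi> x = 0")
    case True
    then have "\<forall>\<phi>'\<in>insert \<phi> \<Phi>. \<phi>' (\<Sum>j<L. \<beta> j *\<^sub>R w j) = 0" using \<beta>(3) by (simp add: x_def)
    with \<beta>(1,2) show ?thesis by (rule_tac x = L in exI, rule_tac x = \<beta> in exI) (intro conjI)
  next
    case False
    define \<gamma> where "\<gamma> j = \<phi> x' * \<beta> j - \<phi> x * \<beta>' j" for j
    obtain j where j: "\<beta>' j \<noteq> 0" using \<beta>'(2) by blast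
    then have "L \<le> j" "j < L'" using \<beta>'(1) by (auto dest: spec[of _ j])
    then have LL: "L \<le> L'" and "\<beta> j = 0" using \<beta>(1) by (auto dest: spec[of _ j])
    then have "\<gamma> j \<noteq> 0" using j False by (simp add: \<gamma>_def)
    moreover have "\<forall>j. \<gamma> j \<noteq> 0 \<longrightarrow> p \<le> j \<and> j < L'"
    proof (intro allI impI)
      fix i assume "\<gamma> i \<noteq> 0"
      then have "\<beta> i \<noteq> 0 \<or> \<beta>' i \<noteq> 0" by (auto simp: \<gamma>_def)
      then show "p \<le> i \<and> i < L'" using \<beta>(1) \<beta>'(1) LL by (metis less_le_trans max.boundedE)
    qed
    moreover have xL': "x = (\<Sum>j<L'. \<beta> j *\<^sub>R w j)"
      unfolding x_def using \<beta>(1) LL by (intro sum.mono_neutral_left) auto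
    have "(\<Sum>j<L'. \<gamma> j *\<^sub>R w j) = \<phi> x' *\<^sub>R x - \<phi> x *\<^sub>R x'"
      unfolding \<gamma>_def by (subst xL') (simp add: x'_def scaleR_diff_left sum_subtractf scaleR_sum_right)
    then have "\<forall>\<phi>'\<in>insert \<phi> \<Phi>. \<phi>' (\<Sum>j<L'. \<gamma> j *\<^sub>R w j) = 0"
      using \<beta>(3) \<beta>'(3) lin lin' by (auto simp: linear_diff linear_scale x_def[symmetric] x'_def[symmetric])
    moreover have "\<exists>j. \<gamma> j \<noteq> 0" using \<open>\<gamma> j \<noteq> 0\<close> by (rule exI)
    ultimately show ?thesis by (rule_tac x = L' in exI, rule_tac x = \<gamma> in exI) (intro conjI)
  qed
qed

text \<open>Blocks of a c_0 basis, scaled to largest coefficient 1, satisfy the estimates of the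
  basis with the same constants. So a copy of c_0 can be moved into the kernel of finitely many
  functionals at no cost.\<close>

lemma kernel_blocks:
  fixes w :: "nat \<Rightarrow> 'e::real_normed_vector"
  assumes \<Phi>: "finite \<Phi>" "\<And>\<phi>. \<phi> \<in> \<Phi> \<Longrightarrow> linear (\<phi> :: 'e \<Rightarrow> real)"
    and lower: "\<And>n a i. i < n \<Longrightarrow> c * \<bar>a i\<bar> \<le> norm (\<Sum>i<n. a i *\<^sub>R w i)"
    and upper: "\<And>n a M. (\<And>i. i < n \<Longrightarrow> \<bar>a i\<bar> \<le> M) \<Longrightarrow> M \<ge> 0 \<Longrightarrow> norm (\<Sum>i<n. a i *\<^sub>R w i) \<le> K * M"
  shows "\<exists>z :: nat \<Rightarrow> 'e. (\<forall>i. \<forall>\<phi>\<in>\<Phi>. \<phi> (z i) = 0) \<and>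
    (\<forall>n a i. i < n \<longrightarrow> c * \<bar>a i\<bar> \<le> norm (\<Sum>i<n. a i *\<^sub>R z i)) \<and>
    (\<forall>n a M. (\<forall>i<n. \<bar>a i\<bar> \<le> M) \<longrightarrow> M \<ge> 0 \<longrightarrow> norm (\<Sum>i<n. a i *\<^sub>R z i) \<le> K * M)"
proof -
  have lin\<Phi>: "\<forall>\<phi>\<in>\<Phi>. linear \<phi>" using \<Phi>(2) by blast
  have "\<exists>L \<beta>. (\<forall>j. \<beta> j \<noteq> 0 \<longrightarrow> p \<le> j \<and> j < L) \<and> (\<exists>j. \<beta> j = 1) \<and> (\<forall>j. \<bar>\<beta> j\<bar> \<le> 1) \<and>
    (\<forall>\<phi>\<in>\<Phi>. \<phi> (\<Sum>j<L. \<beta> j *\<^sub>R w j) = 0)" for p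
  proof -
    obtain L \<beta> where "(\<forall>j. \<beta> j \<noteq> 0 \<longrightarrow> p \<le> j \<and> j < L) \<and> (\<exists>j. \<beta> j \<noteq> 0) \<and>
      (\<forall>\<phi>\<in>\<Phi>. \<phi> (\<Sum>j<L. \<beta> j *\<^sub>R w j) = 0)" using kernel_combination[OF \<Phi>(1) lin\<Phi>, of p w] by (elim exE)
    then have \<beta>: "\<forall>j. \<beta> j \<noteq> 0 \<longrightarrow> p \<le> j \<and> j < L" "\<exists>j. \<beta> j \<noteq> 0"
      "\<forall>\<phi>\<in>\<Phi>. \<phi> (\<Sum>j<L. \<beta> j *\<^sub>R w j) = 0" by simp_all
    obtain j1 where j1: "\<beta> j1 \<noteq> 0" using \<beta>(2) by blast
    then have "j1 < L" using \<beta>(1) by blast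
    define m where "m = Max ((\<lambda>j. \<bar>\<beta> j\<bar>) ` {..<L})"
    have "m \<in> (\<lambda>j. \<bar>\<beta> j\<bar>) ` {..<L}" unfolding m_def using \<open>j1 < L\<close> by (intro Max_in) auto
    then obtain j0 where j0: "j0 < L" "m = \<bar>\<beta> j0\<bar>" by blast
    have m_ge: "\<bar>\<beta> j\<bar> \<le> \<bar>\<beta> j0\<bar>" if "j < L" for j
      unfolding j0(2)[symmetric] m_def using that by (intro Max_ge) auto
    have pos: "\<bar>\<beta> j0\<bar> > 0" using m_ge[OF \<open>j1 < L\<close>] j1 by linarith
    define \<beta>' where "\<beta>' j = \<beta> j / \<beta> j0" for j
    have "\<bar>\<beta>' j\<bar> \<le> 1" for j
    proof (cases "j < L")
      case True
      then show ?thesis using m_ge[OF True] pos by (simp add: \<beta>'_def abs_divide)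
    next
      case False
      then have "\<beta> j = 0" using \<beta>(1) by blast
      then show ?thesis by (simp add: \<beta>'_def)
    qed
    then have "\<forall>j. \<bar>\<beta>' j\<bar> \<le> 1" by blast
    moreover have "(\<Sum>j<L. \<beta>' j *\<^sub>R w j) = (1 / \<beta> j0) *\<^sub>R (\<Sum>j<L. \<beta> j *\<^sub>R w j)"
      by (simp add: \<beta>'_def scaleR_sum_right)
    then have "\<forall>\<phi>\<in>\<Phi>. \<phi> (\<Sum>j<L. \<beta>' j *\<^sub>R w j) = 0"
      using \<beta>(3) \<Phi>(2) by (simp add: linear_scale)
    moreover have "\<beta>' j0 = 1" using pos by (simp add: \<beta>'_def)
    moreover have "\<forall>j. \<beta>' j \<noteq> 0 \<longrightarrow> p \<le> j \<and> j < L" using \<beta>(1) by (simp add: \<beta>'_def)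
    moreover have "\<exists>j. \<beta>' j = 1" using \<open>\<beta>' j0 = 1\<close> by (rule exI)
    ultimately show ?thesis by (rule_tac x = L in exI, rule_tac x = \<beta>' in exI) (intro conjI)
  qed
  then have blocks: "\<exists>L \<beta>. (\<forall>j. \<beta> j \<noteq> 0 \<longrightarrow> p \<le> j \<and> j < L) \<and> (\<exists>j. \<beta> j = 1) \<and> (\<forall>j. \<bar>\<beta> j\<bar> \<le> 1) \<and>
    (\<forall>\<phi>\<in>\<Phi>. \<phi> (\<Sum>j<L. \<beta> j *\<^sub>R w j) = 0)" for p .
  define R where "R p r \<longleftrightarrow> (\<forall>j. snd r j \<noteq> 0 \<longrightarrow> p \<le> j \<and> j < fst r) \<and> (\<exists>j. snd r j = 1) \<and>
    (\<forall>j. \<bar>snd r j\<bar> \<le> 1) \<and> (\<forall>\<phi>\<in>\<Phi>. \<phi> (\<Sum>j<fst r. snd r j *\<^sub>R w j) = 0)"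
    for p :: nat and r :: "nat \<times> (nat \<Rightarrow> real)"
  have "\<forall>p. \<exists>r. R p r"
  proof
    fix p
    obtain L \<beta> where "(\<forall>j. \<beta> j \<noteq> 0 \<longrightarrow> p \<le> j \<and> j < L) \<and> (\<exists>j. \<beta> j = 1) \<and> (\<forall>j. \<bar>\<beta> j\<bar> \<le> 1) \<and>
      (\<forall>\<phi>\<in>\<Phi>. \<phi> (\<Sum>j<L. \<beta> j *\<^sub>R w j) = 0)" using blocks[of p] by (elim exE)
    then have "R p (L, \<beta>)" unfolding R_def fst_conv snd_conv .
    then show "\<exists>r. R p r" by (rule exI)
  qed
  from choice[OF this] obtain r where "\<forall>p. R p (r p)" by (elim exE)
  then have r: "snd (r p) j \<noteq> 0 \<Longrightarrow> p \<le> j \<and> j < fst (r p)" "\<exists>j. snd (r p) j = 1" "\<bar>snd (r p) j\<bar> \<le> 1"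
    "\<phi> \<in> \<Phi> \<Longrightarrow> \<phi> (\<Sum>j<fst (r p). snd (r p) j *\<^sub>R w j) = 0" for p j \<phi>
    unfolding R_def by simp_all
  \<comment> \<open>The i-th block occupies indices from \<open>pos i\<close> to below
    \<open>pos (Suc i)\<close>.\<close>
  define pos where "pos i = ((\<lambda>p. fst (r p)) ^^ i) 0" for i
  define \<beta> where "\<beta> i = snd (r (pos i))" for i
  have pos_Suc: "pos (Suc i) = fst (r (pos i))" for i by (simp add: pos_def)
  have supp: "pos i \<le> j" "j < pos (Suc i)" if "\<beta> i j \<noteq> 0" for i j
    using r(1)[of "pos i" j] that by (auto simp: \<beta>_def pos_Suc)
  have "pos i < pos (Suc i)" for i
  proof -
    obtain j where "\<beta> i j = 1" using r(2)[of "pos i"] by (auto simp: \<beta>_def)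
    then show ?thesis using supp[of i j] by simp
  qed
  then have mono: "strict_mono pos" by (simp add: strict_mono_Suc_iff)
  define z where "z i = (\<Sum>j<pos (Suc i). \<beta> i j *\<^sub>R w j)" for i
  have disj: "i = i'" if ij: "\<beta> i j \<noteq> 0" "\<beta> i' j \<noteq> 0" for i i' j
  proof (rule ccontr)
    have *: False if "a < b" "\<beta> a j \<noteq> 0" "\<beta> b j \<noteq> 0" for a b
    proof -
      have "pos (Suc a) \<le> pos b" using that(1) mono by (simp add: strict_mono_less_eq)
      then show False using supp(2)[OF that(2)] supp(1)[OF that(3)] by simp
    qed
    assume "i \<noteq> i'"
    then consider "i < i'" | "i' < i" by linarith
    then show False using * ij by cases blast+
  qed
  have z_sum: "(\<Sum>i<n. a i *\<^sub>R z i) = (\<Sum>j<pos n. (\<Sum>i<n. a i * \<beta> i j) *\<^sub>R w j)" for n a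
  proof -
    have "z i = (\<Sum>j<pos n. \<beta> i j *\<^sub>R w j)" if "i < n" for i
    proof -
      have "pos (Suc i) \<le> pos n" using that mono by (simp add: strict_mono_less_eq)
      then show ?thesis unfolding z_def using supp(2)[of i] by (intro sum.mono_neutral_left) force+
    qed
    then have "(\<Sum>i<n. a i *\<^sub>R z i) = (\<Sum>i<n. \<Sum>j<pos n. (a i * \<beta> i j) *\<^sub>R w j)"
      by (intro sum.cong) (simp_all add: scaleR_sum_right)
    also have "\<dots> = (\<Sum>j<pos n. \<Sum>i<n. (a i * \<beta> i j) *\<^sub>R w j)" by (rule sum.swap)
    finally show ?thesis by (simp add: scaleR_sum_left)
  qed
  have single: "(\<Sum>i<n. a i * \<beta> i j) = a i * \<beta> i j" if "i < n" "\<beta> i j \<noteq> 0" for n a i j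
  proof -
    have "(\<Sum>i<n. a i * \<beta> i j) = (\<Sum>i\<in>{i}. a i * \<beta> i j)"
      using that disj by (intro sum.mono_neutral_right) auto
    then show ?thesis by simp
  qed
  show ?thesis
  proof (intro exI[of _ z] conjI allI impI ballI)
    fix i \<phi> assume "\<phi> \<in> \<Phi>"
    then show "\<phi> (z i) = 0" unfolding z_def \<beta>_def pos_Suc by (rule r(4))
  next
    fix n i :: nat and a :: "nat \<Rightarrow> real" assume i: "i < n"
    obtain j where j: "\<beta> i j = 1" using r(2)[of "pos i"] by (auto simp: \<beta>_def)
    have "j < pos n"
    proof -
      have "pos (Suc i) \<le> pos n" using i mono by (simp add: strict_mono_less_eq)
      then show ?thesis using supp(2)[of i j] j by simp
    qed
    from lower[OF this, of "\<lambda>j. \<Sum>i<n. a i * \<beta> i j"] single[OF i, of j a]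
    show "c * \<bar>a i\<bar> \<le> norm (\<Sum>i<n. a i *\<^sub>R z i)" unfolding z_sum using j by simp
  next
    fix n :: nat and a :: "nat \<Rightarrow> real" and M assume a: "\<forall>i<n. \<bar>a i\<bar> \<le> M" and M: "0 \<le> (M::real)"
    have "\<bar>\<Sum>i<n. a i * \<beta> i j\<bar> \<le> M" for j
    proof (cases "\<exists>i<n. \<beta> i j \<noteq> 0")
      case True
      then obtain i where i: "i < n" "\<beta> i j \<noteq> 0" by blast
      have "\<bar>\<beta> i j\<bar> \<le> 1" unfolding \<beta>_def by (rule r(3))
      then have "\<bar>a i\<bar> * \<bar>\<beta> i j\<bar> \<le> M * 1" using a i(1) M by (intro mult_mono) auto
      then show ?thesis unfolding single[OF i] by (simp add: abs_mult)
    next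
      case False
      then have "(\<Sum>i<n. a i * \<beta> i j) = 0" by (intro sum.neutral) auto
      then show ?thesis using M by simp
    qed
    then show "norm (\<Sum>i<n. a i *\<^sub>R z i) \<le> K * M" unfolding z_sum using M by (intro upper) auto
  qed
qed

text \<open>The image of the cube lies in a compact set, and functionals norming the points of a
  finite \<eta> / 2 net almost norm the rest; \<eta> / 2 is lost twice.\<close>

lemma almost_norming_functionals:
  fixes q :: "nat \<Rightarrow> 'e::real_normed_vector"
  assumes \<eta>: "\<eta> > 0"
  shows "\<exists>\<Phi>. finite \<Phi> \<and> (\<forall>\<phi>\<in>\<Phi>. linear \<phi> \<and> (\<forall>v. \<bar>\<phi> v\<bar> \<le> norm v)) \<and>
    (\<forall>x. (\<forall>i<N. \<bar>x i\<bar> \<le> 1) \<longrightarrow> (\<exists>\<phi>\<in>\<Phi>. norm (\<Sum>i<N. x i *\<^sub>R q i) - \<eta> \<le> \<phi> (\<Sum>i<N. x i *\<^sub>R q i)))"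
proof -
  have "\<exists>Q. compact Q \<and> (\<forall>x. (\<forall>i<N. \<bar>x i\<bar> \<le> 1) \<longrightarrow> (\<Sum>i<N. x i *\<^sub>R q i) \<in> Q)"
  proof (induction N)
    case 0
    then show ?case by (intro exI[of _ "{0}"]) auto
  next
    case (Suc N)
    then obtain Q where Q: "compact Q" "\<And>x. (\<forall>i<N. \<bar>x i\<bar> \<le> 1) \<Longrightarrow> (\<Sum>i<N. x i *\<^sub>R q i) \<in> Q" by blast
    have seg: "compact ((\<lambda>t. t *\<^sub>R q N) ` {-1..1})"
      by (intro compact_continuous_image continuous_intros compact_Icc)
    have "(\<Sum>i<Suc N. x i *\<^sub>R q i) \<in> {u + v |u v. u \<in> Q \<and> v \<in> (\<lambda>t. t *\<^sub>R q N) ` {-1..1}}"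
      if x: "\<forall>i<Suc N. \<bar>x i\<bar> \<le> 1" for x
    proof -
      have "x N \<in> {-1..1}" using x by (auto simp: abs_le_iff)
      moreover have "(\<Sum>i<N. x i *\<^sub>R q i) \<in> Q" using x by (intro Q(2)) auto
      ultimately show ?thesis
        by (intro CollectI exI[of _ "\<Sum>i<N. x i *\<^sub>R q i"] exI[of _ "x N *\<^sub>R q N"] conjI) auto
    qed
    then show ?case using compact_sums[OF Q(1) seg]
      by (intro exI[of _ "{u + v |u v. u \<in> Q \<and> v \<in> (\<lambda>t. t *\<^sub>R q N) ` {-1..1}}"] conjI allI impI)
  qed
  then obtain Q where Q: "compact Q" "\<And>x. (\<forall>i<N. \<bar>x i\<bar> \<le> 1) \<Longrightarrow> (\<Sum>i<N. x i *\<^sub>R q i) \<in> Q" by blast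
  have "\<exists>k. finite k \<and> k \<subseteq> Q \<and> Q \<subseteq> (\<Union>x\<in>k. ball x (\<eta> / 2))"
    using seq_compact_imp_totally_bounded[OF compact_imp_seq_compact[OF Q(1)]] half_gt_zero[OF \<eta>] by simp
  then obtain k where k: "finite k" "Q \<subseteq> (\<Union>x\<in>k. ball x (\<eta> / 2))" by blast
  have "\<forall>x. \<exists>\<phi> :: 'e \<Rightarrow> real. linear \<phi> \<and> (\<forall>v. \<bar>\<phi> v\<bar> \<le> norm v) \<and> \<phi> x = norm x"
    using norming_functional by metis
  from choice[OF this] obtain \<Psi> :: "'e \<Rightarrow> 'e \<Rightarrow> real"
    where *: "\<forall>x. linear (\<Psi> x) \<and> (\<forall>v. \<bar>\<Psi> x v\<bar> \<le> norm v) \<and> \<Psi> x x = norm x" by (elim exE)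
  then have \<Psi>: "linear (\<Psi> x)" "\<bar>\<Psi> x v\<bar> \<le> norm v" "\<Psi> x x = norm x" for x v by auto
  have "\<exists>\<phi>\<in>\<Psi> ` k. norm w - \<eta> \<le> \<phi> w" if w: "w \<in> Q" for w
  proof -
    obtain u where u: "u \<in> k" "norm (u - w) < \<eta> / 2" using k(2) w by (auto simp: dist_norm)
    have "norm w \<le> norm u + norm (u - w)" by (metis norm_triangle_sub norm_minus_commute add.commute)
    moreover have "\<Psi> u w = norm u - \<Psi> u (u - w)" using \<Psi>(3)[of u] by (simp add: linear_diff[OF \<Psi>(1)])
    moreover have "\<Psi> u (u - w) \<le> norm (u - w)" using \<Psi>(2)[of u "u - w"] by linarith
    ultimately have "norm w - \<eta> \<le> \<Psi> u w" using u(2) by linarith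
    then show ?thesis using u(1) by blast
  qed
  note near = this
  show ?thesis
  proof (rule exI[of _ "\<Psi> ` k"], intro conjI ballI allI impI)
    show "finite (\<Psi> ` k)" using k(1) by simp
    show "linear \<phi>" "\<bar>\<phi> v\<bar> \<le> norm v" if "\<phi> \<in> \<Psi> ` k" for \<phi> v using that \<Psi>(1,2) by auto
    show "\<exists>\<phi>\<in>\<Psi> ` k. norm (\<Sum>i<N. x i *\<^sub>R q i) - \<eta> \<le> \<phi> (\<Sum>i<N. x i *\<^sub>R q i)"
      if "\<forall>i<N. \<bar>x i\<bar> \<le> 1" for x using Q(2)[OF that] by (rule near)
  qed
qed

subsection \<open>Injective spaces\<close>

lemma linear_on_coordinates:
  fixes f :: "(nat \<Rightarrow> real) \<Rightarrow> 'e::real_vector"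
  assumes add: "\<And>x y. f (\<lambda>i. x i + y i) = f x + f y" and scale: "\<And>a x. f (\<lambda>i. a * x i) = a *\<^sub>R f x"
    and local: "\<And>x y. (\<And>i. i < N \<Longrightarrow> x i = y i) \<Longrightarrow> f x = f y"
  shows "f x = (\<Sum>i<N. x i *\<^sub>R f (\<lambda>j. if j = i then 1 else 0))"
proof -
  have "f (\<lambda>j. \<Sum>i<n. x i * (if j = i then 1 else 0)) = (\<Sum>i<n. x i *\<^sub>R f (\<lambda>j. if j = i then 1 else 0))" for n
  proof (induction n)
    case 0
    show ?case using scale[of 0 "\<lambda>i. 0"] by simp
  next
    case (Suc n)
    show ?case
      using add[of "\<lambda>j. \<Sum>i<n. x i * (if j = i then 1 else 0)" "\<lambda>j. x n * (if j = n then 1 else 0)"]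
        scale[of "x n" "\<lambda>j. if j = n then 1 else 0"] Suc by simp
  qed
  moreover have "f x = f (\<lambda>j. \<Sum>i<N. x i * (if j = i then 1 else 0))"
  proof (rule local)
    fix j assume "j < N"
    moreover have "(\<Sum>i<N. x i * (if j = i then 1 else 0)) = (\<Sum>i<N. if i = j then x j else 0)"
      by (intro sum.cong) auto
    ultimately show "x j = (\<Sum>i<N. x i * (if j = i then 1 else 0))" by simp
  qed
  ultimately show ?thesis by simp
qed

text \<open>Let \<open>R\<close> restrict a function to one point of each of the \<open>N\<close> label classes. A correction of \<open>S\<close> by
  finitely many point evaluations gives an operator \<open>S1\<close> from the \<open>N\<close>-dimensional sup-normed space
  with \<open>S1 (R v) = v\<close> for all \<open>v\<close> in the span of \<open>B\<close>. It need not be an isomorphism, but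
  \<open>S1 x + I (x - R (S1 x))\<close> is, where \<open>I\<close> embeds the sup-normed space almost transversally to the
  range of \<open>S1\<close>; on the image of \<open>R\<close> it agrees with \<open>S1\<close>.\<close>

lemma L_inf_embedding:
  fixes e w :: "nat \<Rightarrow> 'e::banach"
  assumes emb: "embedded_span (label_functions g) S K e \<psi>"
    and fin: "\<And>p. finite (range (g p))" and point: "\<And>i. \<exists>p. \<forall>k. g p k = (if k = i then 1 else 0)"
    and c1: "c1 > 0" and K1: "K1 \<ge> 0"
    and w_lower: "\<And>n a i. i < n \<Longrightarrow> c1 * \<bar>a i\<bar> \<le> norm (\<Sum>i<n. a i *\<^sub>R w i)"
    and w_upper: "\<And>n a M. (\<And>i. i < n \<Longrightarrow> \<bar>a i\<bar> \<le> M) \<Longrightarrow> M \<ge> 0 \<Longrightarrow> norm (\<Sum>i<n. a i *\<^sub>R w i) \<le> K1 * M"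
    and B: "finite B" "B \<subseteq> span (range e)"
  shows "\<exists>F. finite_dim_subspace F \<and> span B \<subseteq> F \<and>
    banach_mazur_dist F (l_inf_dim (dim F)) \<le> ereal ((2 * K + K1 * (1 + 2 * K)) / (1 / (2 * (1 + 2 / c1))))"
proof -
  interpret embedded_span "label_functions g" S K e \<psi> by (rule emb)
  let ?X = "label_functions g"
  have spanB: "span B \<subseteq> span (range e)" by (rule span_minimal[OF B(2) subspace_span])
  have "\<exists>m h. (\<forall>i<m. h i \<in> span B) \<and> (\<forall>v\<in>span B. (\<Sum>i<m. \<psi> i v *\<^sub>R h i) = v)"
  proof (rule reproducing_vectors[OF B(1) \<psi>_linear])
    fix v assume v: "v \<in> span B" "\<And>k. \<psi> k v = 0"
    have "norm v \<le> 0" using v spanB by (intro norming) auto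
    then show "v = 0" by simp
  qed
  then obtain m h where
    "(\<forall>i<m. h i \<in> span B) \<and> (\<forall>v\<in>span B. (\<Sum>i<m. \<psi> i v *\<^sub>R h i) = v)" by (elim exE)
  then have h: "i < m \<Longrightarrow> h i \<in> span B" and repr: "v \<in> span B \<Longrightarrow> (\<Sum>i<m. \<psi> i v *\<^sub>R h i) = v" for i v by auto
  \<comment> \<open>The m oscillations of size 1 / (m + 1) add up to less than 1, so the bound for
    S1 does not depend on B.\<close>
  have "\<forall>i. \<exists>n. i < m \<longrightarrow> (\<forall>m'\<ge>n. \<forall>k l. labels g m' k = labels g m' l \<longrightarrow> \<bar>\<psi> k (h i) - \<psi> l (h i)\<bar> \<le> 1 / (m + 1))"
  proof
    fix i
    show "\<exists>n. i < m \<longrightarrow> (\<forall>m'\<ge>n. \<forall>k l. labels g m' k = labels g m' l \<longrightarrow> \<bar>\<psi> k (h i) - \<psi> l (h i)\<bar> \<le> 1 / (m + 1))"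
    proof (cases "i < m")
      case True
      then have "(\<lambda>k. \<psi> k (h i)) \<in> ?X" using h spanB by (intro \<psi>_in) auto
      then show ?thesis using label_functionsD[of "\<lambda>k. \<psi> k (h i)" g "1 / (m + 1)"] by auto
    qed simp
  qed
  from choice[OF this] obtain nn where nn: "\<forall>i. i < m \<longrightarrow> (\<forall>m'\<ge>nn i. \<forall>k l. labels g m' k = labels g m' l \<longrightarrow>
      \<bar>\<psi> k (h i) - \<psi> l (h i)\<bar> \<le> 1 / (m + 1))" by (elim exE)
  have "\<forall>i. \<exists>p. \<forall>k. g p k = (if k = i then 1 else 0)" using point by (intro allI)
  from choice[OF this] obtain pp where pp: "\<forall>i k. g (pp i) k = (if k = i then 1 else 0)" by (elim exE)
  \<comment> \<open>So many labels control the oscillation of every h i with i < m and isolate every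
    point below m.\<close>
  define n where "n = (\<Sum>i<m. nn i + Suc (pp i))"
  have n: "nn i + Suc (pp i) \<le> n" if "i < m" for i
    unfolding n_def using that by (intro member_le_sum) auto
  have osc: "\<bar>\<psi> k (h i) - \<psi> l (h i)\<bar> \<le> 1 / (m + 1)" if "i < m" "labels g n k = labels g n l" for i k l
  proof -
    have "nn i \<le> n" using n[OF that(1)] by simp
    then show ?thesis using nn that by blast
  qed
  have pt: "k = i" if "i < m" "labels g n k = labels g n i" for i k
  proof -
    have "pp i < n" using n[OF that(1)] by simp
    then have "g (pp i) k = g (pp i) i" using that(2) unfolding labels_eq_iff by blast
    then show ?thesis using pp by (simp split: if_splits)
  qed
  define \<rho> where "\<rho> c = (SOME l. labels g n l = c)" for c
  \<comment> \<open>Constant on label classes, and the identity below m; the values \<psi> i v with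
    i < m, which determine v \<in> span B, survive the restriction to representatives.\<close>
  define rep where "rep k = \<rho> (labels g n k)" for k
  have lab_rep: "labels g n (rep k) = labels g n k" for k
    unfolding rep_def \<rho>_def by (rule someI) (rule refl)
  have rep_rep: "rep (rep k) = rep k" for k using lab_rep[of k] by (simp add: rep_def)
  have rep_small: "rep i = i" if "i < m" for i using pt[OF that lab_rep] .
  have rep_in: "(\<lambda>k. f (rep k)) \<in> ?X" for f :: "nat \<Rightarrow> real"
  proof (rule label_functionsI, rule exI[of _ n], intro allI impI)
    fix \<epsilon> :: real and k l assume "\<epsilon> > 0" "labels g n k = labels g n l"
    then show "\<bar>f (rep k) - f (rep l)\<bar> \<le> \<epsilon>" by (simp add: rep_def)
  qed
  define P where "P = range rep"
  have "P = \<rho> ` range (labels g n)" by (auto simp: P_def rep_def)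
  then have finP: "finite P" using finite_labels[of g n, OF fin] by simp
  define N where "N = card P"
  obtain t where "bij_betw t {0..<N} P" using ex_bij_betw_nat_finite[OF finP] unfolding N_def by blast
  then have t: "inj_on t {..<N}" "t ` {..<N} = P" by (auto simp: bij_betw_def atLeast0LessThan)
  have ex_t: "\<exists>i<N. rep k = t i" for k
  proof -
    have "rep k \<in> t ` {..<N}" unfolding t(2) P_def by (rule rangeI)
    then show ?thesis by auto
  qed
  define A where "A x k = (\<Sum>i<N. x i * (if rep k = t i then 1 else 0))" for x :: "nat \<Rightarrow> real" and k
  have A_eq: "A x k = x i" if "i < N" "rep k = t i" for x i k
  proof -
    have "A x k = (\<Sum>j<N. if j = i then x i else 0)"
      unfolding A_def using that t(1) by (intro sum.cong) (auto simp: inj_on_def)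
    then show ?thesis using that(1) by simp
  qed
  have A_rep: "A x (rep k) = A x k" for x k by (simp add: A_def rep_rep)
  have A_in: "(\<lambda>k. A x k) \<in> ?X" for x using rep_in[of "A x"] by (simp add: A_rep)
  have A_add: "A (\<lambda>i. x i + y i) k = A x k + A y k" and A_scale: "A (\<lambda>i. a * x i) k = a * A x k" for x y a k
    by (simp_all only: A_def distrib_right sum.distrib mult.assoc sum_distrib_left)
  have A_local: "A x k = A y k" if "\<And>i. i < N \<Longrightarrow> x i = y i" for x y k
    unfolding A_def using that by (intro sum.cong) auto
  have A_le: "\<bar>A x k\<bar> \<le> M" if "\<And>i. i < N \<Longrightarrow> \<bar>x i\<bar> \<le> M" for x k M
  proof -
    obtain i where i: "i < N" "rep k = t i" using ex_t by blast
    show ?thesis unfolding A_eq[OF i] using i(1) by (rule that)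
  qed
  \<comment> \<open>If x lists the values of v \<in> span B at the representatives, then the
    reproducing formula gives p x = v.\<close>
  define p where "p x = (\<Sum>i<m. A x i *\<^sub>R h i)" for x
  have p_add: "p (\<lambda>i. x i + y i) = p x + p y" and p_scale: "p (\<lambda>i. a * x i) = a *\<^sub>R p x" for x y a
    by (simp_all add: p_def A_add A_scale scaleR_add_left sum.distrib scaleR_sum_right)
  have p_local: "p x = p y" if "\<And>i. i < N \<Longrightarrow> x i = y i" for x y
    unfolding p_def using A_local[OF that] by (intro sum.cong) auto
  have p_B: "p x \<in> span B" for x unfolding p_def using h by (intro span_sum span_scale) auto
  then have p_e: "p x \<in> span (range e)" for x using spanB by blast
  have r_in: "(\<lambda>k. \<psi> (rep k) v) \<in> ?X" for v by (rule rep_in)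
  have d_in: "(\<lambda>k. A x k - \<psi> (rep k) v) \<in> ?X" for x v by (intro diff A_in r_in)
  \<comment> \<open>S is applied only to the part of A x that the restriction of p x does not
    explain; that part vanishes when x comes from some v \<in> span B, and then S1 x = v.\<close>
  define S1 where "S1 x = S (\<lambda>k. A x k - \<psi> (rep k) (p x)) + p x" for x
  have S1_add: "S1 (\<lambda>i. x i + y i) = S1 x + S1 y" for x y
  proof -
    have "(\<lambda>k. A (\<lambda>i. x i + y i) k - \<psi> (rep k) (p (\<lambda>i. x i + y i))) =
        (\<lambda>k. (A x k - \<psi> (rep k) (p x)) + (A y k - \<psi> (rep k) (p y)))"
      by (rule ext) (simp add: A_add p_add \<psi>_simps)
    then show ?thesis using U_add[OF d_in[of x "p x"] d_in[of y "p y"]] by (simp add: S1_def p_add)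
  qed
  have S1_scale: "S1 (\<lambda>i. a * x i) = a *\<^sub>R S1 x" for a x
  proof -
    have "(\<lambda>k. A (\<lambda>i. a * x i) k - \<psi> (rep k) (p (\<lambda>i. a * x i))) = (\<lambda>k. a * (A x k - \<psi> (rep k) (p x)))"
      by (rule ext) (simp add: A_scale p_scale \<psi>_simps right_diff_distrib)
    then show ?thesis using U_scale[OF d_in[of x "p x"], of a] by (simp add: S1_def p_scale scaleR_add_right)
  qed
  have S1_local: "S1 x = S1 y" if "\<And>i. i < N \<Longrightarrow> x i = y i" for x y
  proof -
    have "p x = p y" using that by (rule p_local)
    moreover have "A x k = A y k" for k using that by (rule A_local)
    ultimately show ?thesis by (simp add: S1_def)
  qed
  have S1_bound: "norm (S1 x) \<le> 2 * K * M" if x: "\<And>i. i < N \<Longrightarrow> \<bar>x i\<bar> \<le> M" and M: "M \<ge> 0" for x M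
  proof -
    define v where "v = p x"
    have v: "v \<in> span (range e)" unfolding v_def by (rule p_e)
    \<comment> \<open>As S recovers v from its image, S1 x differs from S (A x) only by S of the
      variation of v within label classes.\<close>
    have "S1 x = S (\<lambda>k. A x k) + S (\<lambda>k. \<psi> k v - \<psi> (rep k) v)"
      unfolding S1_def v_def[symmetric] U_diff[OF A_in r_in] U_diff[OF \<psi>_in[OF v] r_in] S_\<psi>[OF v] by simp
    moreover have "norm (S (\<lambda>k. A x k)) \<le> K * M" by (rule U_bound[OF A_in A_le[OF x]])
    moreover have "norm (S (\<lambda>k. \<psi> k v - \<psi> (rep k) v)) \<le> K * M"
    proof (rule U_bound[OF diff[OF \<psi>_in[OF v] r_in]])
      fix k
      have eq: "\<psi> j v = (\<Sum>i<m. A x i * \<psi> j (h i))" for j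
        by (simp add: v_def p_def linear_sum[OF \<psi>_linear] \<psi>_simps)
      have "\<psi> k v - \<psi> (rep k) v = (\<Sum>i<m. A x i * (\<psi> k (h i) - \<psi> (rep k) (h i)))"
        unfolding eq by (simp add: right_diff_distrib sum_subtractf)
      also have "\<bar>\<dots>\<bar> \<le> (\<Sum>i<m. M * (1 / (m + 1)))"
      proof (rule order_trans[OF sum_abs], rule sum_mono)
        fix i assume "i \<in> {..<m}"
        then have "\<bar>\<psi> k (h i) - \<psi> (rep k) (h i)\<bar> \<le> 1 / (m + 1)" by (intro osc) (auto simp: lab_rep)
        then show "\<bar>A x i * (\<psi> k (h i) - \<psi> (rep k) (h i))\<bar> \<le> M * (1 / (m + 1))"
          unfolding abs_mult using A_le[OF x] M by (intro mult_mono) auto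
      qed
      also have "\<dots> = M * (m / (m + 1))" by simp
      also have "\<dots> \<le> M * 1" using M by (intro mult_left_mono) auto
      finally show "\<bar>\<psi> k v - \<psi> (rep k) v\<bar> \<le> M" by simp
    qed
    ultimately have "norm (S1 x) \<le> K * M + K * M" by (metis norm_triangle_mono)
    then show ?thesis by simp
  qed
  define q where "q i = S1 (\<lambda>j. if j = i then 1 else 0)" for i
  have S1_sum: "S1 x = (\<Sum>i<N. x i *\<^sub>R q i)" for x
    unfolding q_def using S1_add S1_scale S1_local by (rule linear_on_coordinates)
  \<comment> \<open>The value for which \<eta> * (1 + 1 / c1) = 1/2 in the final inequality of
    \<open>unit\<close>; the constant \<open>c\<close> below is then read off from 1/2 \<le> norm
    (S' x) * (1 + 2 / c1).\<close>
  define \<eta> where "\<eta> = 1 / (2 * (1 + 1 / c1))"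
  have \<eta>: "\<eta> > 0" using c1 by (simp add: \<eta>_def add_pos_pos)
  obtain \<Phi> :: "('e \<Rightarrow> real) set" where "finite \<Phi> \<and> (\<forall>\<phi>\<in>\<Phi>. linear \<phi> \<and> (\<forall>v. \<bar>\<phi> v\<bar> \<le> norm v)) \<and>
    (\<forall>x. (\<forall>i<N. \<bar>x i\<bar> \<le> 1) \<longrightarrow> (\<exists>\<phi>\<in>\<Phi>. norm (\<Sum>i<N. x i *\<^sub>R q i) - \<eta> \<le> \<phi> (\<Sum>i<N. x i *\<^sub>R q i)))"
    using almost_norming_functionals[OF \<eta>, of N q] by (elim exE)
  then have \<Phi>: "finite \<Phi>" "\<And>\<phi>. \<phi> \<in> \<Phi> \<Longrightarrow> linear \<phi>" "\<And>\<phi> v. \<phi> \<in> \<Phi> \<Longrightarrow> \<bar>\<phi> v\<bar> \<le> norm v"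
    and near: "\<And>x. (\<forall>i<N. \<bar>x i\<bar> \<le> 1) \<Longrightarrow> \<exists>\<phi>\<in>\<Phi>. norm (S1 x) - \<eta> \<le> \<phi> (S1 x)"
    unfolding S1_sum by simp_all
  have "\<exists>z :: nat \<Rightarrow> 'e. (\<forall>i. \<forall>\<phi>\<in>\<Phi>. \<phi> (z i) = 0) \<and>
    (\<forall>n a i. i < n \<longrightarrow> c1 * \<bar>a i\<bar> \<le> norm (\<Sum>i<n. a i *\<^sub>R z i)) \<and>
    (\<forall>n a M. (\<forall>i<n. \<bar>a i\<bar> \<le> M) \<longrightarrow> M \<ge> 0 \<longrightarrow> norm (\<Sum>i<n. a i *\<^sub>R z i) \<le> K1 * M)"
  proof (rule kernel_blocks[OF \<Phi>(1)])
    show "linear \<phi>" if "\<phi> \<in> \<Phi>" for \<phi> using that by (rule \<Phi>(2))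
    show "c1 * \<bar>a i\<bar> \<le> norm (\<Sum>i<n. a i *\<^sub>R w i)" if "i < n" for n a i using that by (rule w_lower)
    show "norm (\<Sum>i<n. a i *\<^sub>R w i) \<le> K1 * M" if "\<And>i. i < n \<Longrightarrow> \<bar>a i\<bar> \<le> M" "M \<ge> 0" for n a M
      using that by (rule w_upper)
  qed
  then obtain z :: "nat \<Rightarrow> 'e" where "(\<forall>i. \<forall>\<phi>\<in>\<Phi>. \<phi> (z i) = 0) \<and>
    (\<forall>n a i. i < n \<longrightarrow> c1 * \<bar>a i\<bar> \<le> norm (\<Sum>i<n. a i *\<^sub>R z i)) \<and>
    (\<forall>n a M. (\<forall>i<n. \<bar>a i\<bar> \<le> M) \<longrightarrow> M \<ge> 0 \<longrightarrow> norm (\<Sum>i<n. a i *\<^sub>R z i) \<le> K1 * M)"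
    by (elim exE)
  then have z0: "\<And>i \<phi>. \<phi> \<in> \<Phi> \<Longrightarrow> \<phi> (z i) = 0"
    and z_lower: "\<And>a i. i < N \<Longrightarrow> c1 * \<bar>a i\<bar> \<le> norm (\<Sum>i<N. a i *\<^sub>R z i)"
    and z_upper: "\<And>a M. (\<forall>i<N. \<bar>a i\<bar> \<le> M) \<Longrightarrow> M \<ge> 0 \<Longrightarrow> norm (\<Sum>i<N. a i *\<^sub>R z i) \<le> K1 * M"
    by simp_all
  define r where "r x i = x i - \<psi> (t i) (S1 x)" for x :: "nat \<Rightarrow> real" and i
  define I where "I x = (\<Sum>i<N. r x i *\<^sub>R z i)" for x
  define S' where "S' x = S1 x + I x" for x
  define s where "s i = S' (\<lambda>j. if j = i then 1 else 0)" for i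
  have r_add: "r (\<lambda>i. x i + y i) i = r x i + r y i" and r_scale: "r (\<lambda>i. a * x i) i = a * r x i" for x y a i
    by (simp_all add: r_def S1_add S1_scale \<psi>_simps right_diff_distrib)
  have S'_add: "S' (\<lambda>i. x i + y i) = S' x + S' y" and S'_scale: "S' (\<lambda>i. a * x i) = a *\<^sub>R S' x" for x y a
    by (simp_all add: S'_def I_def S1_add S1_scale r_add r_scale scaleR_add_left scaleR_add_right sum.distrib scaleR_sum_right)
  have S'_local: "S' x = S' y" if "\<And>i. i < N \<Longrightarrow> x i = y i" for x y
  proof -
    have "S1 x = S1 y" using that by (rule S1_local)
    then have "I x = I y" unfolding I_def r_def using that by (intro sum.cong) auto
    then show ?thesis using \<open>S1 x = S1 y\<close> by (simp add: S'_def)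
  qed
  have S'_sum: "S' x = (\<Sum>i<N. x i *\<^sub>R s i)" for x
    unfolding s_def using S'_add S'_scale S'_local by (rule linear_on_coordinates)
  define c where "c = 1 / (2 * (1 + 2 / c1))"
  have c: "c > 0" using c1 by (simp add: c_def add_pos_pos)
  \<comment> \<open>An almost norming functional of S1 x annihilates I x, so I x cannot cancel S1 x:
    if S' x is small, S1 x is at most slightly larger than \<eta>, and I x is small as well. Then r
    x is small, although x i0 has modulus 1 and S1 x contributes little to it.\<close>
  have unit: "c \<le> norm (S' x)" if x: "\<forall>i<N. \<bar>x i\<bar> \<le> 1" and i0: "i0 < N" "\<bar>x i0\<bar> = 1" for x i0
  proof -
    obtain \<phi> where \<phi>: "\<phi> \<in> \<Phi>" "norm (S1 x) - \<eta> \<le> \<phi> (S1 x)" using near[OF x] by blast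
    have "\<phi> (I x) = 0" unfolding I_def using z0[OF \<phi>(1)] by (simp add: linear_sum[OF \<Phi>(2)[OF \<phi>(1)]] linear_scale[OF \<Phi>(2)[OF \<phi>(1)]])
    then have "\<phi> (S' x) = \<phi> (S1 x)" by (simp add: S'_def linear_add[OF \<Phi>(2)[OF \<phi>(1)]])
    then have 1: "norm (S1 x) \<le> norm (S' x) + \<eta>" using \<phi>(2) \<Phi>(3)[OF \<phi>(1), of "S' x"] by linarith
    have 2: "norm (I x) \<le> norm (S' x) + norm (S1 x)"
      using norm_triangle_ineq4[of "S' x" "S1 x"] by (simp add: S'_def)
    have 3: "c1 * \<bar>r x i0\<bar> \<le> norm (I x)" unfolding I_def using i0(1) by (rule z_lower)
    have 4: "1 \<le> norm (S1 x) + \<bar>r x i0\<bar>" using i0(2) \<psi>_le[of "t i0" "S1 x"] unfolding r_def by linarith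
    have "\<bar>r x i0\<bar> \<le> norm (I x) / c1" using 3 c1 by (simp add: field_simps)
    also have "\<dots> \<le> (2 * norm (S' x) + \<eta>) / c1" using 1 2 c1 by (intro divide_right_mono) auto
    finally have "1 \<le> norm (S' x) + \<eta> + (2 * norm (S' x) + \<eta>) / c1" using 1 4 by linarith
    also have "\<dots> = norm (S' x) * (1 + 2 / c1) + \<eta> * (1 + 1 / c1)"
      by (simp add: add_divide_distrib distrib_left)
    also have "\<eta> * (1 + 1 / c1) = 1 / 2"
    proof -
      have "1 + 1 / c1 > 0" using c1 by (simp add: add_pos_pos)
      then show ?thesis by (simp add: \<eta>_def)
    qed
    finally have 5: "1 / 2 \<le> norm (S' x) * (1 + 2 / c1)" by linarith
    have "1 + 2 / c1 > 0" using c1 by (simp add: add_pos_pos)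
    then have "(1 / 2) / (1 + 2 / c1) \<le> norm (S' x)" using 5 by (subst pos_divide_le_eq) auto
    then show ?thesis by (simp add: c_def)
  qed
  have lower: "c * \<bar>x j\<bar> \<le> norm (\<Sum>i<N. x i *\<^sub>R s i)" if j: "j < N" for x j
  proof -
    define M where "M = Max ((\<lambda>i. \<bar>x i\<bar>) ` {..<N})"
    have M_ge: "\<bar>x i\<bar> \<le> M" if "i < N" for i unfolding M_def using that by (intro Max_ge) auto
    have "M \<in> (\<lambda>i. \<bar>x i\<bar>) ` {..<N}" unfolding M_def using j by (intro Max_in) auto
    then obtain i0 where i0: "i0 < N" "M = \<bar>x i0\<bar>" by blast
    show ?thesis
    proof (cases "M = 0")
      case True
      then show ?thesis using M_ge[OF j] by simp
    next
      case False
      then have M: "M > 0" using i0 by simp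
      have "c \<le> norm (S' (\<lambda>i. (1 / M) * x i))"
      proof (rule unit[OF _ i0(1)])
        show "\<forall>i<N. \<bar>1 / M * x i\<bar> \<le> 1" using M_ge M by (simp add: abs_mult field_simps)
        show "\<bar>1 / M * x i0\<bar> = 1" using i0(2) M by (simp add: abs_mult)
      qed
      then have "c * M \<le> norm (S' x)" unfolding S'_scale using M by (simp add: field_simps)
      moreover have "c * \<bar>x j\<bar> \<le> c * M" using M_ge[OF j] c by (intro mult_left_mono) auto
      ultimately show ?thesis unfolding S'_sum by linarith
    qed
  qed
  define K' where "K' = 2 * K + K1 * (1 + 2 * K)"
  have K': "K' \<ge> 0" using K_nonneg K1 by (simp add: K'_def)
  have upper: "norm (\<Sum>i<N. x i *\<^sub>R s i) \<le> K' * M" if x: "\<And>i. i < N \<Longrightarrow> \<bar>x i\<bar> \<le> M" and M: "M \<ge> 0" for x M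
  proof -
    have b1: "norm (S1 x) \<le> 2 * K * M" using x M by (rule S1_bound)
    have "\<forall>i<N. \<bar>r x i\<bar> \<le> M + 2 * K * M"
    proof (intro allI impI)
      fix i assume "i < N"
      then show "\<bar>r x i\<bar> \<le> M + 2 * K * M"
        using x[of i] \<psi>_le[of "t i" "S1 x"] b1 unfolding r_def by linarith
    qed
    then have "norm (I x) \<le> K1 * (M + 2 * K * M)"
      unfolding I_def using M K_nonneg by (intro z_upper) auto
    then have "norm (S' x) \<le> 2 * K * M + K1 * (M + 2 * K * M)"
      unfolding S'_def using b1 norm_triangle_ineq[of "S1 x" "I x"] by linarith
    also have "\<dots> = K' * M" by (simp add: K'_def algebra_simps)
    finally show ?thesis unfolding S'_sum .
  qed
  have F: "finite_dim_subspace (span (s ` {..<N}))"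
    "banach_mazur_dist (span (s ` {..<N})) (l_inf_dim (dim (span (s ` {..<N})))) \<le> ereal (K' / c)"
    using banach_mazur_dist_span[OF c lower K' upper] by simp_all
  have "span B \<subseteq> span (s ` {..<N})"
  proof
    fix v assume v: "v \<in> span B"
    define x where "x i = \<psi> (t i) v" for i
    have A: "A x k = \<psi> (rep k) v" for k
    proof -
      obtain i where i: "i < N" "rep k = t i" using ex_t by blast
      show ?thesis unfolding A_eq[OF i] x_def i(2) ..
    qed
    have "p x = (\<Sum>i<m. \<psi> i v *\<^sub>R h i)" unfolding p_def A using rep_small by (intro sum.cong) auto
    then have p: "p x = v" using repr[OF v] by simp
    have "S1 x = v" unfolding S1_def p A using U_zero by simp
    \<comment> \<open>On coordinates that come from v the remainder r vanishes, and with it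
      I.\<close>
    then have "S' x = v" unfolding S'_def I_def r_def x_def by simp
    then have "v = (\<Sum>i<N. x i *\<^sub>R s i)" unfolding S'_sum by simp
    also have "\<dots> \<in> span (s ` {..<N})" by (intro span_sum span_scale span_base) auto
    finally show "v \<in> span (s ` {..<N})" .
  qed
  then show ?thesis using F unfolding K'_def c_def by (intro exI[of _ "span (s ` {..<N})"] conjI)
qed

text \<open>The vectors correspond to the unit vectors of c_0 under the isomorphism.\<close>

lemma c0_copy_vectors:
  assumes "fixes_copy_of c0_space (\<lambda>x::'e::banach. x)"
  shows "\<exists>(w :: nat \<Rightarrow> 'e) c K. c > 0 \<and> K \<ge> 0 \<and>
    (\<forall>n a i. i < n \<longrightarrow> c * \<bar>a i\<bar> \<le> norm (\<Sum>i<n. a i *\<^sub>R w i)) \<and>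
    (\<forall>n a M. (\<forall>i<n. \<bar>a i\<bar> \<le> M) \<longrightarrow> M \<ge> 0 \<longrightarrow> norm (\<Sum>i<n. a i *\<^sub>R w i) \<le> K * M)"
proof -
  obtain S :: "'e set" and f where iso: "isomorphism_on S c0_space f"
    using assms unfolding fixes_copy_of_def isomorphic_subspaces_def by blast
  define V where "V = inv_into S f"
  have bij: "bij_betw f S c0_space" and V: "operator_on c0_space V" and "operator_on S f"
    using iso by (simp_all add: isomorphism_on_def V_def)
  then obtain L K where L: "\<And>s. s \<in> S \<Longrightarrow> norm (f s) \<le> L * norm s" and K: "\<And>x. x \<in> c0_space \<Longrightarrow> norm (V x) \<le> K * norm x"
    unfolding operator_on_def by blast
  have V_add: "V (x + y) = V x + V y" if "x \<in> c0_space" "y \<in> c0_space" for x y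
    using V that unfolding operator_on_def by blast
  have V_scale: "V (a *\<^sub>R x) = a *\<^sub>R V x" if "x \<in> c0_space" for a x
    using V that unfolding operator_on_def by blast
  interpret Z: sequence_space c0_space by (rule sequence_space_c0)
  define u where "u i = (Bcontfun (\<lambda>j. if j = i then 1 else 0) :: l_inf)" for i :: nat
  have u: "apply_bcontfun (u i) = (\<lambda>j. if j = i then 1 else 0)" for i
    unfolding u_def by (rule apply_Bcontfun[of _ 1]) simp
  have u_in: "u i \<in> c0_space" for i
  proof -
    have "eventually (\<lambda>j. (if j = i then 1 else 0 :: real) = 0) sequentially"
      using eventually_gt_at_top[of i] by eventually_elim simp
    then have "(\<lambda>j. if j = i then 1 else 0 :: real) \<longlonglongrightarrow> 0" by (rule tendsto_eventually)
    then show ?thesis by (simp add: c0_space_def u)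
  qed
  have sum_in: "(\<Sum>i<n. a i *\<^sub>R u i) \<in> c0_space" for n a
    using Z.Z(1) u_in by (intro subspace_sum subspace_scale) auto
  have V_sum: "V (\<Sum>i<n. a i *\<^sub>R u i) = (\<Sum>i<n. a i *\<^sub>R V (u i))" for n a
  proof (induction n)
    case 0
    show ?case using V_scale[OF u_in[of 0], of 0] by simp
  next
    case (Suc n)
    then show ?case using V_add[OF sum_in[of a n] subspace_scale[OF Z.Z(1) u_in[of n], of "a n"]] V_scale[OF u_in] by simp
  qed
  have coord: "apply_bcontfun (\<Sum>i<n. a i *\<^sub>R u i) j = (if j < n then a j else 0)" for n a j
    by (induction n) (auto simp: u less_Suc_eq)
  show ?thesis
  proof (rule exI[of _ "\<lambda>i. V (u i)"], rule exI[of _ "1 / (\<bar>L\<bar> + 1)"], rule exI[of _ "\<bar>K\<bar>"], intro conjI allI impI)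
    show "0 < 1 / (\<bar>L\<bar> + 1)" by (simp add: add_nonneg_pos)
    show "0 \<le> \<bar>K\<bar>" by simp
  next
    fix n i :: nat and a :: "nat \<Rightarrow> real" assume i: "i < n"
    define x where "x = (\<Sum>i<n. a i *\<^sub>R u i)"
    have x: "x \<in> c0_space" unfolding x_def by (rule sum_in)
    then have fV: "f (V x) = x" "V x \<in> S"
      using bij bij_betw_inv_into_right[OF bij] inv_into_into[of x f S] by (auto simp: V_def bij_betw_def)
    have "\<bar>a i\<bar> \<le> norm x" using norm_bounded[of x i] coord[of a n i] i by (simp add: x_def)
    also have "\<dots> \<le> L * norm (V x)" using L[OF fV(2)] fV(1) by simp
    also have "\<dots> \<le> (\<bar>L\<bar> + 1) * norm (V x)" by (intro mult_right_mono) auto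
    finally have "\<bar>a i\<bar> \<le> (\<bar>L\<bar> + 1) * norm (V x)" .
    then have "1 / (\<bar>L\<bar> + 1) * \<bar>a i\<bar> \<le> norm (V x)" by (simp add: field_simps)
    then show "1 / (\<bar>L\<bar> + 1) * \<bar>a i\<bar> \<le> norm (\<Sum>i<n. a i *\<^sub>R V (u i))" by (simp add: x_def V_sum)
  next
    fix n :: nat and a :: "nat \<Rightarrow> real" and M :: real assume a: "\<forall>i<n. \<bar>a i\<bar> \<le> M" and M: "0 \<le> M"
    define x where "x = (\<Sum>i<n. a i *\<^sub>R u i)"
    have "norm x \<le> M" unfolding x_def using a M by (intro norm_bound) (simp add: coord)
    have "norm (V x) \<le> K * norm x" unfolding x_def by (rule K[OF sum_in])
    also have "\<dots> \<le> \<bar>K\<bar> * M" using \<open>norm x \<le> M\<close> by (intro mult_mono) auto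
    finally show "norm (\<Sum>i<n. a i *\<^sub>R V (u i)) \<le> \<bar>K\<bar> * M" by (simp add: x_def V_sum)
  qed
qed

text \<open>A common consequence of both injectivity notions in which the universe no longer occurs;
  it lets the L_inf property be proved once for both parts.\<close>

definition separable_extension :: "'e::banach itself \<Rightarrow> bool" where
  "separable_extension _ \<longleftrightarrow> (\<forall>X Y D D' (t :: l_inf \<Rightarrow> 'e).
     subspace X \<and> closed X \<and> countable D' \<and> D' \<subseteq> X \<and> X \<subseteq> closure D' \<and>
     subspace Y \<and> closed Y \<and> Y \<subseteq> X \<and> countable D \<and> D \<subseteq> Y \<and> Y \<subseteq> closure D \<and> operator_on Y t \<longrightarrow>
     (\<exists>T. operator_on X T \<and> (\<forall>y\<in>Y. T y = t y)))"

lemma separable_extension_embedding: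
  fixes e :: "nat \<Rightarrow> 'e::banach"
  assumes "separable_extension TYPE('e)"
  shows "\<exists>g S K \<psi>. (\<forall>p. finite (range (g p))) \<and> (\<forall>i. \<exists>p. \<forall>k. g p k = (if k = i then 1 else 0)) \<and>
    embedded_span (label_functions g) S K e \<psi>"
proof (rule separable_embedding)
  fix X Y D D' :: "l_inf set" and t :: "l_inf \<Rightarrow> 'e"
  assume "subspace X" "closed X" "countable D'" "D' \<subseteq> X" "X \<subseteq> closure D'"
    "subspace Y" "closed Y" "Y \<subseteq> X" "countable D" "D \<subseteq> Y" "Y \<subseteq> closure D" "operator_on Y t"
  then show "\<exists>T. operator_on X T \<and> (\<forall>y\<in>Y. T y = t y)"
    using assms[unfolded separable_extension_def, rule_format, of X D' Y D t] by simp
qed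

lemma separable_extension_embeds_c0:
  assumes "separable_extension TYPE('e::banach)"
  shows "embeds_sequences TYPE('e) c0_space"
  unfolding embeds_sequences_def
proof
  fix e :: "nat \<Rightarrow> 'e"
  from separable_extension_embedding[OF assms, of e] obtain g S K \<psi>
    where emb: "embedded_span (label_functions g) S K e \<psi>" by (elim exE conjE)
  interpret embedded_span "label_functions g" S K e \<psi> by (rule emb)
  show "\<exists>X S K \<psi>. embedded_span X S K e \<psi> \<and> glues X c0_space"
    using emb glues_c0 by (intro exI conjI)
qed

text \<open>The constant of \<open>L_inf_embedding\<close> depends on the embedded sequence through
  K, so it must not be chosen anew for each subspace. If every constant failed, one bad finite set
  for each n would fit into a single sequence, whose constant is then good for some bad set.\<close>

lemma separable_extension_L_inf:
  assumes ext: "separable_extension TYPE('e::banach)"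
  shows "L_inf_space TYPE('e)"
proof (cases "infinite_dimensional TYPE('e)")
  case False
  then show ?thesis by (rule finite_dim_L_inf)
next
  case True
  have "fixes_copy_of c0_space (\<lambda>x::'e. x)"
    by (rule infinite_dimensional_fixes_copy[OF separable_extension_embeds_c0[OF ext] sequence_space_c0 True])
  from c0_copy_vectors[OF this] obtain w :: "nat \<Rightarrow> 'e" and c1 K1 where c1: "c1 > 0" and K1: "K1 \<ge> 0"
    and w: "\<forall>n a i. i < n \<longrightarrow> c1 * \<bar>a i\<bar> \<le> norm (\<Sum>i<n. a i *\<^sub>R w i)"
      "\<forall>n a M. (\<forall>i<n. \<bar>a i\<bar> \<le> M) \<longrightarrow> M \<ge> 0 \<longrightarrow> norm (\<Sum>i<n. a i *\<^sub>R w i) \<le> K1 * M" by (elim exE conjE)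
  show ?thesis
  proof (rule ccontr)
    assume not: "\<not> ?thesis"
    define good where "good lam B \<longleftrightarrow> (\<exists>F. finite_dim_subspace F \<and> span B \<subseteq> F \<and>
      banach_mazur_dist F (l_inf_dim (dim F)) \<le> ereal lam)" for lam and B :: "'e set"
    have "\<exists>B. finite B \<and> \<not> good (real (Suc n)) B" for n
    proof (rule ccontr)
      assume "\<not> ?thesis"
      then have all: "\<And>B. finite B \<Longrightarrow> good (real (Suc n)) B" by blast
      have "L_inf_space TYPE('e)"
        unfolding L_inf_space_def
      proof (rule exI[of _ "real (Suc n)"], intro conjI allI impI)
        fix G :: "'e set" assume "finite_dim_subspace G"
        then obtain B where "finite B" "G = span B" unfolding finite_dim_subspace_def by blast
        then show "\<exists>F. finite_dim_subspace F \<and> G \<subseteq> F \<and> banach_mazur_dist F (l_inf_dim (dim F)) \<le> ereal (real (Suc n))"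
          using all[of B] unfolding good_def by simp
      qed simp
      with not show False by blast
    qed
    then have "\<forall>n. \<exists>B. finite B \<and> \<not> good (real (Suc n)) B" by (intro allI)
    from choice[OF this] obtain B where "\<forall>n. finite (B n) \<and> \<not> good (real (Suc n)) (B n)" by (elim exE)
    then have B: "finite (B n)" "\<not> good (real (Suc n)) (B n)" for n by auto
    define U where "U = insert 0 (\<Union>n. B n)"
    have "countable U" unfolding U_def using B(1) by (intro countable_insert countable_UN) (auto intro: countable_finite)
    then have eU: "range (from_nat_into U) = U" by (intro range_from_nat_into) (auto simp: U_def)
    define e where "e = from_nat_into U"
    from separable_extension_embedding[OF ext, of e] obtain g S K \<psi>
      where fin: "\<forall>p. finite (range (g p))" and point: "\<forall>i. \<exists>p. \<forall>k. g p k = (if k = i then 1 else 0)"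
        and emb: "embedded_span (label_functions g) S K e \<psi>" by (elim exE conjE)
    define lam where "lam = (2 * K + K1 * (1 + 2 * K)) / (1 / (2 * (1 + 2 / c1)))"
    obtain n where n: "lam \<le> real n" using real_arch_simple by blast
    have sub: "B n \<subseteq> span (range e)"
      unfolding e_def eU using span_superset[of U] by (auto simp: U_def)
    have "\<exists>F. finite_dim_subspace F \<and> span (B n) \<subseteq> F \<and> banach_mazur_dist F (l_inf_dim (dim F)) \<le> ereal lam"
      unfolding lam_def using w
      by (intro L_inf_embedding[OF emb spec[OF fin] spec[OF point] c1 K1 _ _ B(1) sub, of w]) blast+
    then obtain F where F: "finite_dim_subspace F \<and> span (B n) \<subseteq> F \<and> banach_mazur_dist F (l_inf_dim (dim F)) \<le> ereal lam"
      by (elim exE)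
    have "ereal lam \<le> ereal (real (Suc n))" using n by simp
    with F have "good (real (Suc n)) (B n)" unfolding good_def using order_trans by blast
    then show False using B(2) by blast
  qed
qed

section \<open>From the injectivity notions to embeddings of sequences\<close>

lemma universally_separably_injective_embeds:
  fixes c :: "real \<Rightarrow> 'u"
  assumes c: "inj c" and E: "universally_separably_injective TYPE('u) TYPE('e::banach)"
  shows "embeds_sequences TYPE('e) UNIV"
  unfolding embeds_sequences_def
proof
  fix e :: "nat \<Rightarrow> 'e"
  obtain d :: "nat \<Rightarrow> 'e" and \<psi> :: "nat \<Rightarrow> 'e \<Rightarrow> real"
    where d: "range d \<subseteq> span (range e)" "span (range e) \<subseteq> closure (range d)"
    and \<psi>': "\<forall>k. linear (\<psi> k)" "\<forall>k v. \<bar>\<psi> k v\<bar> \<le> norm v"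
      "\<forall>v\<in>closure (range d). \<forall>c. (\<forall>k. \<bar>\<psi> k v\<bar> \<le> c) \<longrightarrow> norm v \<le> c"
    using norming_sequence[of e] by (elim exE conjE)
  have \<psi>: "linear (\<psi> k)" "\<bar>\<psi> k v\<bar> \<le> norm v"
    "v \<in> closure (range d) \<Longrightarrow> (\<And>k. \<bar>\<psi> k v\<bar> \<le> c) \<Longrightarrow> norm v \<le> c" for k v c
    using \<psi>' by auto
  have e_in: "(\<lambda>k. \<psi> k (e i)) \<in> bounded_functions" for i
    using \<psi>(2)[of _ "e i"] unfolding bounded_functions_def by blast
  have "\<exists>S K. embedded_span bounded_functions S K e \<psi>"
  proof (rule embedding[OF function_algebra_bounded_functions d \<psi> e_in])
    fix Xb Y D :: "l_inf set" and t :: "l_inf \<Rightarrow> 'e"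
    assume Xb: "subspace Xb" "closed Xb"
      and Y: "subspace Y" "closed Y" "Y \<subseteq> Xb" "countable D" "D \<subseteq> Y" "Y \<subseteq> closure D" "operator_on Y t"
    show "\<exists>T. operator_on Xb T \<and> (\<forall>y\<in>Y. T y = t y)"
      by (rule universally_separably_injective_extension[OF c E Xb Y])
  qed
  then obtain S K where "embedded_span bounded_functions S K e \<psi>" by (elim exE)
  then show "\<exists>X S K \<psi>. embedded_span X S K e \<psi> \<and> glues X UNIV"
    using glues_bounded_functions by (intro exI conjI)
qed

lemma separably_injective_imp_extension:
  fixes c :: "real \<Rightarrow> 'u"
  assumes c: "inj c" and E: "separably_injective TYPE('u) TYPE('e::banach)"
  shows "separable_extension TYPE('e)"
  unfolding separable_extension_def
proof (intro allI impI, elim conjE)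
  fix X Y D D' :: "l_inf set" and t :: "l_inf \<Rightarrow> 'e"
  assume X: "subspace X" "closed X" "countable D'" "D' \<subseteq> X" "X \<subseteq> closure D'"
    and Y: "subspace Y" "closed Y" "Y \<subseteq> X" "operator_on Y t"
  show "\<exists>T. operator_on X T \<and> (\<forall>y\<in>Y. T y = t y)"
    by (rule separably_injective_extension[OF c E X Y])
qed

lemma universally_separably_injective_imp_extension:
  fixes c :: "real \<Rightarrow> 'u"
  assumes c: "inj c" and E: "universally_separably_injective TYPE('u) TYPE('e::banach)"
  shows "separable_extension TYPE('e)"
  unfolding separable_extension_def
proof (intro allI impI, elim conjE)
  fix X Y D D' :: "l_inf set" and t :: "l_inf \<Rightarrow> 'e"
  assume X: "subspace X" "closed X"
    and Y: "subspace Y" "closed Y" "Y \<subseteq> X" "countable D" "D \<subseteq> Y" "Y \<subseteq> closure D" "operator_on Y t"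
  show "\<exists>T. operator_on X T \<and> (\<forall>y\<in>Y. T y = t y)"
    by (rule universally_separably_injective_extension[OF c E X Y])
qed

text \<open>Indicators of distinct sets of natural numbers are at distance 1, and their images under
  T remain at distance at least 1 / M. Choosing points of a dense set within 1 / (2 * M) of the
  images would inject the power set of the naturals into a countable set.\<close>

lemma fixes_l_inf_imp_not_separable:
  fixes T :: "'e::banach \<Rightarrow> 'f::banach"
  assumes "fixes_copy_of UNIV T"
  shows "\<not> separable_space (euclidean :: 'f topology)"
proof
  assume "separable_space (euclidean :: 'f topology)"
  then obtain C :: "'f set" where C: "countable C" "closure C = UNIV" unfolding separable_space_def by auto
  obtain S :: "'e set" and f where S: "subspace S" and f: "isomorphism_on S (UNIV :: l_inf set) f"
    and T: "isomorphism_on S (T ` S) T"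
    using assms unfolding fixes_copy_of_def isomorphic_subspaces_def by blast
  define V where "V = inv_into S f"
  have bij: "bij_betw f S UNIV" using f by (simp add: isomorphism_on_def)
  have fV: "f (V x) = x" "V x \<in> S" for x
    using bij bij_betw_inv_into_right[OF bij] inv_into_into[of x f S] by (auto simp: V_def bij_betw_def)
  have injT: "inj_on T S" using T by (simp add: isomorphism_on_def bij_betw_def)
  obtain L where L: "\<And>s. s \<in> S \<Longrightarrow> norm (f s) \<le> L * norm s"
    using f unfolding isomorphism_on_def operator_on_def by blast
  have "\<exists>K. \<forall>y\<in>T ` S. norm (inv_into S T y) \<le> K * norm y"
    using T unfolding isomorphism_on_def operator_on_def by blast
  then obtain K where K: "\<And>s. s \<in> S \<Longrightarrow> norm s \<le> K * norm (T s)"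
    using inv_into_f_f[OF injT] by auto
  have T_diff: "T (s - s') = T s - T s'" if "s \<in> S" "s' \<in> S" for s s'
  proof -
    have op: "operator_on S T" using T by (simp add: isomorphism_on_def)
    have "T (s + (-1) *\<^sub>R s') = T s + T ((-1) *\<^sub>R s')"
      using op that subspace_scale[OF S that(2), of "-1"] unfolding operator_on_def by blast
    also have "T ((-1) *\<^sub>R s') = (-1) *\<^sub>R T s'" using op that unfolding operator_on_def by blast
    finally show ?thesis by simp
  qed
  have f_diff: "f (s - s') = f s - f s'" if "s \<in> S" "s' \<in> S" for s s'
  proof -
    have op: "operator_on S f" using f by (simp add: isomorphism_on_def)
    have "f (s + (-1) *\<^sub>R s') = f s + f ((-1) *\<^sub>R s')"
      using op that subspace_scale[OF S that(2), of "-1"] unfolding operator_on_def by blast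
    also have "f ((-1) *\<^sub>R s') = (-1) *\<^sub>R f s'" using op that unfolding operator_on_def by blast
    finally show ?thesis by simp
  qed
  define M where "M = (\<bar>L\<bar> + 1) * (\<bar>K\<bar> + 1)"
  have M: "M > 0" by (simp add: M_def add_nonneg_pos)
  have sep: "norm (x - y) \<le> M * norm (T (V x) - T (V y))" for x y
  proof -
    have s: "V x - V y \<in> S" using fV(2) S by (intro subspace_diff) auto
    have "norm (x - y) = norm (f (V x - V y))" using fV by (simp add: f_diff)
    also have "\<dots> \<le> L * norm (V x - V y)" using s by (rule L)
    also have "\<dots> \<le> (\<bar>L\<bar> + 1) * norm (V x - V y)" by (intro mult_right_mono) auto
    also have "\<dots> \<le> (\<bar>L\<bar> + 1) * ((\<bar>K\<bar> + 1) * norm (T (V x - V y)))"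
    proof (intro mult_left_mono)
      have "K * norm (T (V x - V y)) \<le> (\<bar>K\<bar> + 1) * norm (T (V x - V y))" by (intro mult_right_mono) auto
      then show "norm (V x - V y) \<le> (\<bar>K\<bar> + 1) * norm (T (V x - V y))" using K[OF s] by linarith
    qed simp
    finally show ?thesis using fV by (simp add: M_def T_diff mult.assoc)
  qed
  define u where "u A = (Bcontfun (indicat_real A) :: l_inf)" for A :: "nat set"
  have u: "apply_bcontfun (u A) = indicat_real A" for A
    unfolding u_def by (rule apply_Bcontfun[of _ 1]) (simp add: indicator_def)
  have u_sep: "1 \<le> norm (u A - u B)" if AB: "A \<noteq> B" for A B
  proof -
    obtain k where "(k \<in> A) \<noteq> (k \<in> B)" using AB by blast
    then have "norm (apply_bcontfun (u A - u B) k) = 1" by (auto simp: u indicator_def)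
    then show ?thesis using norm_bounded[of "u A - u B" k] by simp
  qed
  have "\<forall>A. \<exists>y. y \<in> C \<and> dist y (T (V (u A))) < 1 / (2 * M)"
  proof
    fix A
    have "T (V (u A)) \<in> closure C" by (simp add: C(2))
    then show "\<exists>y. y \<in> C \<and> dist y (T (V (u A))) < 1 / (2 * M)"
      unfolding closure_approachable using M by (auto simp: Bex_def)
  qed
  from choice[OF this] obtain y where "\<forall>A. y A \<in> C \<and> dist (y A) (T (V (u A))) < 1 / (2 * M)" by (elim exE)
  then have y: "y A \<in> C" "dist (y A) (T (V (u A))) < 1 / (2 * M)" for A by auto
  have "inj y"
  proof (rule injI, rule ccontr)
    fix A B assume AB: "y A = y B" "A \<noteq> B"
    have "dist (T (V (u A))) (T (V (u B))) < 1 / (2 * M) + 1 / (2 * M)"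
      using y(2)[of A] y(2)[of B] dist_triangle3[of "T (V (u A))" "T (V (u B))" "y A"] AB(1) by simp
    also have "\<dots> = 1 / M" using M by (simp add: field_simps)
    finally have "M * norm (T (V (u A)) - T (V (u B))) < 1" using M by (simp add: dist_norm field_simps)
    then show False using sep[of "u A" "u B"] u_sep[OF AB(2)] by linarith
  qed
  moreover have "countable (range y)" using C(1) y(1) by (meson countable_subset image_subsetI)
  ultimately have "countable (UNIV :: nat set set)" using countable_image_inj_on by blast
  then have "range (from_nat_into (UNIV :: nat set set)) = UNIV" by (intro range_from_nat_into) auto
  then have "\<exists>h :: nat \<Rightarrow> nat set. h ` UNIV = Pow UNIV" by (intro exI[of _ "from_nat_into UNIV"]) simp
  then show False using Cantors_theorem[of "UNIV :: nat set"] by blast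
qed

theorem proposition3p4:
  fixes c :: "real \<Rightarrow> 'u"
  assumes universe: "inj c"
  shows "(separably_injective TYPE('u) TYPE('e::banach) \<longrightarrow>
            L_inf_space TYPE('e) \<and>
            pelczynski_property_V TYPE('e) TYPE('f::banach) \<and>
            (infinite_dimensional TYPE('e) \<longrightarrow> contains_copy_of TYPE('e) c0_space)) \<and>
         (universally_separably_injective TYPE('u) TYPE('e) \<longrightarrow>
            grothendieck_space TYPE('e) TYPE('f) \<and>
            L_inf_space TYPE('e) \<and>
            rosenthal_property_V TYPE('e) TYPE('f) \<and>
            (infinite_dimensional TYPE('e) \<longrightarrow> contains_copy_of TYPE('e) (UNIV :: l_inf set)))"
proof -
  have copy: "contains_copy_of TYPE('e) Z" if "fixes_copy_of Z (\<lambda>x::'e. x)" for Z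
    using that unfolding fixes_copy_of_def contains_copy_of_def by blast
  show ?thesis
  proof (intro conjI impI)
    assume E: "separably_injective TYPE('u) TYPE('e)"
    have ext: "separable_extension TYPE('e)" using universe E by (rule separably_injective_imp_extension)
    have emb: "embeds_sequences TYPE('e) c0_space" using ext by (rule separable_extension_embeds_c0)
    show "L_inf_space TYPE('e)" using ext by (rule separable_extension_L_inf)
    show "pelczynski_property_V TYPE('e) TYPE('f)"
      unfolding pelczynski_property_V_def using property_V[OF emb sequence_space_c0] by (intro allI impI)
    show "contains_copy_of TYPE('e) c0_space" if "infinite_dimensional TYPE('e)"
      by (rule copy[OF infinite_dimensional_fixes_copy[OF emb sequence_space_c0 that]])
  next
    assume E: "universally_separably_injective TYPE('u) TYPE('e)"
    have ext: "separable_extension TYPE('e)"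
      using universe E by (rule universally_separably_injective_imp_extension)
    have emb: "embeds_sequences TYPE('e) UNIV"
      using universe E by (rule universally_separably_injective_embeds)
    show "L_inf_space TYPE('e)" using ext by (rule separable_extension_L_inf)
    show "rosenthal_property_V TYPE('e) TYPE('f)"
      unfolding rosenthal_property_V_def using property_V[OF emb sequence_space_UNIV] by (intro allI impI)
    show "grothendieck_space TYPE('e) TYPE('f)"
      unfolding grothendieck_space_def
    proof (intro impI allI)
      fix T :: "'e \<Rightarrow> 'f" assume sep: "separable_space (euclidean :: 'f topology)" and T: "bounded_linear T"
      have "weakly_compact_operator T \<or> fixes_copy_of UNIV T" using emb sequence_space_UNIV T by (rule property_V)
      then show "weakly_compact_operator T" using fixes_l_inf_imp_not_separable sep by blast
    qed
    show "contains_copy_of TYPE('e) (UNIV :: l_inf set)" if "infinite_dimensional TYPE('e)"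
      by (rule copy[OF infinite_dimensional_fixes_copy[OF emb sequence_space_UNIV that]])
  qed
qed

end
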